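(* Let $A\in\mathbb{C}^{n\times n}$ and let $u,v\in\mathbb{C}^n$ be two nonzero vectors. Let $Q(\lambda)=v^*(\lambda I_n-A)^{-1}u$, let $z_1,\dots,z_d$ be the (mutually different) zeroes of $Q'(\lambda)$, and let $t_j=1/|Q(z_j)|$, $j=1,\dots,d$. Then the following holds. (i) For $t>0$, $t\neq t_j$ $(j=1,\dots,d)$, the set $\sigma(A,u,v;t)$ consists of a union of smooth closed algebraic curves that do not intersect mutually. (ii) For $t=t_j$ $(j=1,\dots,d)$ the set $\sigma(A,u,v;t)$ is locally diffeomorphic with the interval, except the intersection points at those $z_i$ for which $t_j=1/|Q(z_i)|$ (possibly there are several such $z_i$'s). (iii) For generic $u,v\in\mathbb{C}^n$ and for all $j=1,\dots,d$ the point $z_j$ is a double eigenvalue of $A+\tau uv^*$, for $\tau=1/Q(z_j)$. Two of the curves $\sigma(A,u,v;t)$ meet for $t=t_j$ at the point $z_j$. These curves are at the point $z_j$ not differentiable, they make a right angle corner, and meet at right angles as well. (iv) $\displaystyle \sigma(A)\cup\bigcup_{t>0}\sigma(A,u,v;t)\cup Q^{-1}(0)=\mathbb{C}.$ (v) The function $t\mapsto\sigma(A,u,v;t)$ is continuous in the Hausdorff metric for $t>0$. (vi) $\sigma(A,u,v;t)$ converges to $Q^{-1}(0)\cup\{\infty\}$ with $t\to\infty$.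
   Context: $X^*=\bar X^\top$, and $\sigma(\cdot)$ denotes the spectrum of a matrix. For $t>0$, $$\sigma(A,u,v;t)=\bigcup_{0\le\theta<2\pi}\sigma(A+te^{i\theta}uv^* ).$$ $Q$ is a rational function whose poles lie in the set of eigenvalues of $A$ (not every eigenvalue of $A$ need be a pole). A smooth closed curve is a $\mathcal{C}^\infty$-diffeomorphic image of a circle. For a given $A$, a property holds for generic vectors $u,v\in\mathbb{C}^n$ if there exists a finite set of nonzero complex polynomials of $2n$ variables (possibly depending on $A$) which are zero on all $u,v$ not enjoying the property.
   Formalization: Eigenvalues common to all A+τuv* are added to the curves in (i), (iii) and to the limit set in (vi), and may be isolated points in (ii); generic in (iii) means polynomials in the entries of u and conj(v); (vi) assumes Q' has finitely many zeros (Q not identically 0). *)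

theory Defs
  imports
    "HOL-Complex_Analysis.Complex_Analysis"
    "HOL-Library.Poly_Mapping"
    "HOL-Library.Disjoint_Sets"
begin

section \<open>Spectra of rank one perturbations\<close>

definition spectrum :: "complex^'n^'n \<Rightarrow> complex set" where
  "spectrum A = {z. \<exists>x. x \<noteq> 0 \<and> A *v x = z *s x}"

definition charpoly :: "complex^'n^'n \<Rightarrow> complex poly" where
  "charpoly A = det (mat [:0, 1:] - (\<chi> i j. [:A $ i $ j:]))"

text \<open>The rank one matrix \<open>u v\<^sup>*\<close> and the scalar \<open>v\<^sup>* x\<close>.\<close>

definition outer_prod :: "complex^'n \<Rightarrow> complex^'n \<Rightarrow> complex^'n^'n" where
  "outer_prod u v = (\<chi> i j. u $ i * cnj (v $ j))"

definition cdot :: "complex^'n \<Rightarrow> complex^'n \<Rightarrow> complex" where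
  "cdot v x = (\<Sum>i\<in>UNIV. cnj (v $ i) * x $ i)"

definition perturb :: "complex^'n^'n \<Rightarrow> complex^'n \<Rightarrow> complex^'n \<Rightarrow> complex \<Rightarrow> complex^'n^'n" where
  "perturb A u v \<tau> = A + mat \<tau> ** outer_prod u v"

definition perturbed_spectrum ::
    "complex^'n^'n \<Rightarrow> complex^'n \<Rightarrow> complex^'n \<Rightarrow> real \<Rightarrow> complex set" where
  "perturbed_spectrum A u v t =
     (\<Union>\<theta>\<in>{0..<2*pi}. spectrum (perturb A u v (of_real t * exp (\<i> * of_real \<theta>))))"

text \<open>
  The eigenvalues of \<open>A\<close> that no perturbation along \<open>u v\<^sup>*\<close> moves. They exist for instance
  whenever some eigenvalue of \<open>A\<close> has geometric multiplicity at least two, they belong to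
  every \<open>perturbed_spectrum A u v t\<close>, and they may be isolated points of it.
\<close>

definition fixed_eigenvalues :: "complex^'n^'n \<Rightarrow> complex^'n \<Rightarrow> complex^'n \<Rightarrow> complex set" where
  "fixed_eigenvalues A u v = (\<Inter>\<tau>. spectrum (perturb A u v \<tau>))"

text \<open>
  \<open>Q\<close> as a rational function: the resolvent expression is meaningful only off the spectrum
  of \<open>A\<close>; \<open>remove_sings\<close> supplies the value of the rational function at those eigenvalues
  of \<open>A\<close> that are not poles. At a pole it returns the dummy value 0, so poles have to be
  excluded explicitly from the sets of zeros of \<open>Q\<close> and of its derivative.
\<close>

definition Q_fun :: "complex^'n^'n \<Rightarrow> complex^'n \<Rightarrow> complex^'n \<Rightarrow> complex \<Rightarrow> complex" where
  "Q_fun A u v = remove_sings (\<lambda>z. cdot v (matrix_inv (mat z - A) *v u))"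

definition Q_zeros :: "complex^'n^'n \<Rightarrow> complex^'n \<Rightarrow> complex^'n \<Rightarrow> complex set" where
  "Q_zeros A u v = {z. \<not> is_pole (Q_fun A u v) z \<and> Q_fun A u v z = 0}"

definition Q_crit :: "complex^'n^'n \<Rightarrow> complex^'n \<Rightarrow> complex^'n \<Rightarrow> complex set" where
  "Q_crit A u v = {z. \<not> is_pole (Q_fun A u v) z \<and> deriv (Q_fun A u v) z = 0}"

text \<open>
  The zeros \<open>z\<close> of the derivative with \<open>t = 1 / \<bar>Q z\<bar>\<close>. If \<open>Q z = 0\<close> the critical
  parameter is infinite; since \<open>1 / 0 = 0\<close>, such a \<open>z\<close> occurs for no \<open>t > 0\<close>.
\<close>

definition Q_crit_at ::
    "complex^'n^'n \<Rightarrow> complex^'n \<Rightarrow> complex^'n \<Rightarrow> real \<Rightarrow> complex set" where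
  "Q_crit_at A u v t = {z \<in> Q_crit A u v. t = 1 / cmod (Q_fun A u v z)}"


section \<open>Smoothness and curves\<close>

text \<open>
  \<open>C\<^sup>k\<close> maps on an open subset of a Euclidean space, through iterated directional derivatives.
\<close>

primrec Ck_on :: "nat \<Rightarrow> 'a::real_normed_vector set \<Rightarrow> ('a \<Rightarrow> 'b::real_normed_vector) \<Rightarrow> bool" where
  "Ck_on 0 U f \<longleftrightarrow> continuous_on U f"
| "Ck_on (Suc k) U f \<longleftrightarrow>
     (\<forall>x\<in>U. f differentiable (at x)) \<and> (\<forall>h. Ck_on k U (\<lambda>x. frechet_derivative f (at x) h))"

text \<open>On an arbitrary set, smoothness means having smooth local extensions.\<close>

definition smooth_on :: "'a::real_normed_vector set \<Rightarrow> ('a \<Rightarrow> 'b::real_normed_vector) \<Rightarrow> bool" where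
  "smooth_on X f \<longleftrightarrow>
     (\<forall>x\<in>X. \<exists>U F. open U \<and> x \<in> U \<and> (\<forall>k. Ck_on k U F) \<and> (\<forall>y\<in>U \<inter> X. F y = f y))"

definition diffeomorphic :: "'a::real_normed_vector set \<Rightarrow> 'b::real_normed_vector set \<Rightarrow> bool" where
  "diffeomorphic X Y \<longleftrightarrow> (\<exists>f g. homeomorphism X Y f g \<and> smooth_on X f \<and> smooth_on Y g)"

definition smooth_closed_curve :: "complex set \<Rightarrow> bool" where
  "smooth_closed_curve C \<longleftrightarrow> diffeomorphic (sphere (0::complex) 1) C"

definition locally_interval :: "complex set \<Rightarrow> complex \<Rightarrow> bool" where
  "locally_interval S z \<longleftrightarrow> (\<exists>U. open U \<and> z \<in> U \<and> diffeomorphic {-1<..<1::real} (S \<inter> U))"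

text \<open>The zero set, in the plane, of a real polynomial in the two variables \<open>Re z\<close>, \<open>Im z\<close>.\<close>

definition real_zero_set :: "real poly poly \<Rightarrow> complex set" where
  "real_zero_set F = {z. poly (poly F [:Im z:]) (Re z) = 0}"

text \<open>
  Near \<open>z\<close> the set \<open>C\<close> consists of two smooth arcs that leave \<open>z\<close> in the unit
  directions \<open>a\<close> and \<open>b\<close>.
\<close>

definition corner_at :: "complex set \<Rightarrow> complex \<Rightarrow> complex \<Rightarrow> complex \<Rightarrow> bool" where
  "corner_at C z a b \<longleftrightarrow> norm a = 1 \<and> norm b = 1 \<and>
     (\<exists>U \<gamma> \<delta>. open U \<and> z \<in> U \<and> \<gamma> (0::real) = z \<and>
        homeomorphism {-1<..<1} (C \<inter> U) \<gamma> \<delta> \<and>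
        smooth_on {-1<..0} \<gamma> \<and> smooth_on {0..<1} \<gamma> \<and>
        (\<gamma> has_vector_derivative - a) (at_left 0) \<and>
        (\<gamma> has_vector_derivative b) (at_right 0))"

text \<open>\<open>C\<close> has near \<open>z\<close> a parametrization with a nonzero derivative at \<open>z\<close>.\<close>

definition differentiable_curve_at :: "complex set \<Rightarrow> complex \<Rightarrow> bool" where
  "differentiable_curve_at C z \<longleftrightarrow>
     (\<exists>U \<gamma> \<delta> D. open U \<and> z \<in> U \<and> \<gamma> (0::real) = z \<and>
        homeomorphism {-1<..<1} (C \<inter> U) \<gamma> \<delta> \<and>
        D \<noteq> 0 \<and> (\<gamma> has_vector_derivative D) (at 0))"

text \<open>
  \<open>C\<close> and \<open>D\<close> have right angle corners at \<open>z\<close>, and meet there at right angles: the four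
  tangent rays are pairwise distinct, \<open>C\<close> having \<open>a\<close>, \<open>b\<close> and \<open>D\<close> having the
  opposite ones, so that the sectors between \<open>C\<close> and \<open>D\<close> are right angles too.
\<close>

definition right_angle_contact :: "complex set \<Rightarrow> complex set \<Rightarrow> complex \<Rightarrow> bool" where
  "right_angle_contact C D z \<longleftrightarrow>
     (\<exists>a b. orthogonal a b \<and> corner_at C z a b \<and> corner_at D z (- a) (- b))"


section \<open>Genericity\<close>

text \<open>
  Polynomials in the variables indexed by \<open>'x\<close>: a monomial is a finitely supported map from
  variables to exponents, a polynomial a finitely supported map from monomials to coefficients.
\<close>

definition mpoly_eval :: "('x \<Rightarrow> complex) \<Rightarrow> (('x \<Rightarrow>\<^sub>0 nat) \<Rightarrow>\<^sub>0 complex) \<Rightarrow> complex" where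
  "mpoly_eval x p =
     (\<Sum>m\<in>Poly_Mapping.keys p. Poly_Mapping.lookup p m *
        (\<Prod>i\<in>Poly_Mapping.keys m. x i ^ Poly_Mapping.lookup m i))"

text \<open>
  The \<open>2n\<close> variables are the entries of \<open>u\<close> and of \<open>v\<^sup>*\<close>. The conjugation matters: the
  discriminants that detect non-generic pairs are polynomials in the entries of \<open>u\<close> and
  \<open>v\<^sup>*\<close>, and in general no nonzero polynomial in the entries of \<open>u\<close> and \<open>v\<close> vanishes on
  their zero set. Without nonemptiness of \<open>F\<close> the condition would be void.
\<close>

definition generic :: "(complex^'n \<Rightarrow> complex^'n \<Rightarrow> bool) \<Rightarrow> bool" where
  "generic P \<longleftrightarrow>
     (\<exists>F :: (('n + 'n \<Rightarrow>\<^sub>0 nat) \<Rightarrow>\<^sub>0 complex) set. finite F \<and> F \<noteq> {} \<and> 0 \<notin> F \<and>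
        (\<forall>u v. \<not> P u v \<longrightarrow>
           (\<forall>p\<in>F. mpoly_eval (case_sum (\<lambda>i. u $ i) (\<lambda>i. cnj (v $ i))) p = 0)))"


section \<open>Hausdorff distance and the Riemann sphere\<close>

text \<open>The Hausdorff distance; meaningful for nonempty bounded sets.\<close>

definition hausdorff_dist :: "'a::metric_space set \<Rightarrow> 'a set \<Rightarrow> real" where
  "hausdorff_dist X Y = max (SUP x\<in>X. infdist x Y) (SUP y\<in>Y. infdist y X)"

text \<open>
  Inverse stereographic projection onto the unit sphere of \<open>complex \<times> real\<close>; the point
  at infinity corresponds to the north pole.
\<close>

definition riemann_sphere :: "complex \<Rightarrow> complex \<times> real" where
  "riemann_sphere z =
     ((2 / (1 + (cmod z)\<^sup>2)) *\<^sub>R z, ((cmod z)\<^sup>2 - 1) / ((cmod z)\<^sup>2 + 1))"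

definition sphere_infinity :: "complex \<times> real" where
  "sphere_infinity = (0, 1)"

end

theory Submission
  imports "Jordan_Normal_Form.Determinant" "HOL-Combinatorics.Cycles"
    "HOL-Computational_Algebra.Fundamental_Theorem_Algebra" Defs
begin

text \<open>
  By the matrix determinant lemma the characteristic polynomial of \<open>A + \<tau> u v\<^sup>*\<close> is \<open>p - \<tau> q\<close>
  with \<open>Q = q / p\<close>. Writing \<open>p = g P\<close>, \<open>q = g R\<close> with \<open>P\<close>, \<open>R\<close> coprime, the set
  \<open>\<sigma>(A,u,v;t)\<close> is the level set \<open>\<bar>Q\<bar> = 1/t\<close> together with the finitely many roots of \<open>g\<close>.
  Near a point \<open>z\<close> of the level set there is a conformal chart \<open>\<phi>\<close> in which \<open>Q\<close> is
  \<open>Q(z) exp (\<i> \<phi>\<^sup>k)\<close>, where \<open>k = 1\<close> unless \<open>Q'(z) = 0\<close>; so the level set is there the union of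
  \<open>2k\<close> rays, which is an arc exactly for \<open>k = 1\<close>.

  For the global picture fix \<open>c = 1/t\<close> and select the roots of \<open>c exp (\<i> s) P - R\<close> continuously
  over one turn of \<open>s\<close>. The monodromy is a permutation of the sheets and each of its cycles closes
  up to a curve. Two sheets that collide at a double point may be exchanged from there on, which
  composes the monodromy with a transposition; a selection whose monodromy has as many cycles as
  possible therefore puts colliding sheets into different cycles, and then every cycle is a simple
  closed curve. At a double root the sheets turn by a right angle in the chart.

  A pair \<open>u\<close>, \<open>v\<close> is generic if some resultants do not vanish; these are polynomials in the entries
  of \<open>u\<close> and of \<open>v\<^sup>*\<close>, and nonzero since along a suitable line of vectors \<open>u\<close> only finitely many
  members are excluded. The Hausdorff limits follow from the continuity of the roots of a polynomial.
\<close>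

text \<open>A common divisor is split off because an eigenvalue may be a root of both
  \<open>p\<close> and \<open>q\<close>; it then belongs to the spectrum for all \<tau> without
  lying on a level curve. A careless selection of roots can make one cycle of sheets pass twice
  through the same point. Counting cycles replaces a global argument on how plane curves cross: the
  count is bounded by the degree and grows with every exchange inside a cycle. For genericity the
  obstacle is that the critical polynomial R' P - R P' may have multiple roots for all u and v, for
  instance at a root of the minimal polynomial of multiplicity three or more. Such roots are poles
  and not critical points, but they make the discriminant vanish identically; the fixed factor
  responsible is divided out first. The line of vectors u points along an eigenvector of
  \<open>A\<close>: in this direction the numerator moves by E h and the critical polynomial by - E
  h^2, with one fixed polynomial h. A multiple root then requires E to be a critical value of a
  fixed rational function, and a rational function has only finitely many critical values, even if
  it is constant.\<close>

unbundle no fps_syntax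
no_notation Matrix.vec_index (infixl "$" 100)

section \<open>Rank one perturbations\<close>

lemma det_row_add_multiples:
  fixes B :: "'a::comm_ring_1^'n^'n"
  assumes "finite K" "k \<notin> K"
  shows "det (\<chi> i. if i = k then u else B $ i + (if i \<in> K then a i *s u else 0))
       = det (\<chi> i. if i = k then u else B $ i)"
  using assms
proof (induction K rule: finite_induct)
  case empty
  then show ?case by (simp cong: if_cong)
next
  case (insert m K)
  have mk: "m \<noteq> k" using insert by auto
  let ?C = "(\<chi> i. if i = k then u else B $ i + (if i \<in> K then a i *s u else 0)) :: 'a^'n^'n"
  have eq: "(\<chi> i. if i = k then u else B $ i + (if i \<in> insert m K then a i *s u else 0))
      = (\<chi> i. if i = m then row m ?C + a m *s row k ?C else row i ?C)"
    using insert mk by (auto simp: vec_eq_iff row_def)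
  have "det (\<chi> i. if i = k then u else B $ i + (if i \<in> insert m K then a i *s u else 0)) = det ?C"
    unfolding eq by (rule det_row_operation[OF mk])
  moreover have "det ?C = det (\<chi> i. if i = k then u else B $ i)" using insert by blast
  ultimately show ?case by (rule trans)
qed

text \<open>The determinant is multilinear in the rows, and a term in which two rows are multiples
  of \<open>u\<close> vanishes; what survives is affine in \<open>a\<close>. The induction runs over
  the set \<open>K\<close> of rows that have been changed.\<close>

lemma det_add_rank_one_aux:
  fixes B :: "'a::comm_ring_1^'n^'n"
  assumes "finite K"
  shows "det (\<chi> i. B $ i + (if i \<in> K then a i *s u else 0))
       = det B + (\<Sum>k\<in>K. a k * det (\<chi> i. if i = k then u else B $ i))"
  using assms
proof (induction K rule: finite_induct)
  case empty
  then show ?case by (simp add: vec_lambda_eta)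
next
  case (insert m K)
  let ?c = "\<lambda>i. B $ i + (if i \<in> K then a i *s u else 0)"
  have "(\<chi> i. B $ i + (if i \<in> insert m K then a i *s u else 0))
      = (\<chi> i. if i = m then B $ i + a m *s u else ?c i)"
    using insert by (auto simp: vec_eq_iff)
  then have "det (\<chi> i. B $ i + (if i \<in> insert m K then a i *s u else 0))
     = det (\<chi> i. if i = m then B $ i else ?c i) + det (\<chi> i. if i = m then a m *s u else ?c i)"
    by (simp only: det_row_add)
  also have "(\<chi> i. if i = m then B $ i else ?c i) = (\<chi> i. ?c i)"
    using insert by (auto simp: vec_eq_iff)
  also have "det (\<chi> i. if i = m then a m *s u else ?c i) = a m * det (\<chi> i. if i = m then u else ?c i)"
    by (rule det_row_mul)
  also have "det (\<chi> i. if i = m then u else ?c i) = det (\<chi> i. if i = m then u else B $ i)"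
    using insert by (intro det_row_add_multiples) auto
  finally show ?case using insert by (simp add: algebra_simps)
qed

text \<open>Stated over a ring because \<open>B\<close> is going to be the polynomial matrix zI - A.
  Transposition turns the columns here into the rows of the induction.\<close>

lemma det_add_rank_one:
  fixes B :: "'a::comm_ring_1^'n^'n"
  shows "det (\<chi> i j. B $ i $ j + u $ i * a $ j)
       = det B + (\<Sum>k\<in>UNIV. a $ k * det (\<chi> i j. if j = k then u $ i else B $ i $ j))"
proof -
  have "det (\<chi> i j. B $ i $ j + u $ i * a $ j) = det (transpose (\<chi> i j. B $ i $ j + u $ i * a $ j))"
    by (rule det_transpose [symmetric])
  also have "transpose (\<chi> i j. B $ i $ j + u $ i * a $ j)
      = (\<chi> i. transpose B $ i + (if i \<in> UNIV then (a $ i) *s u else 0))"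
    by (simp add: vec_eq_iff transpose_def algebra_simps)
  also have "det \<dots> = det (transpose B) + (\<Sum>k\<in>UNIV. a $ k * det (\<chi> i. if i = k then u else transpose B $ i))"
    by (rule det_add_rank_one_aux) simp
  also have "(\<lambda>k. det (\<chi> i. if i = k then u else transpose B $ i))
     = (\<lambda>k. det (\<chi> i j. if j = k then u $ i else B $ i $ j))"
  proof
    fix k
    have "(\<chi> i. if i = k then u else transpose B $ i)
        = transpose (\<chi> i j. if j = k then u $ i else B $ i $ j)"
      by (auto simp: vec_eq_iff transpose_def)
    then show "det (\<chi> i. if i = k then u else transpose B $ i) = det (\<chi> i j. if j = k then u $ i else B $ i $ j)"
      by simp
  qed
  finally show ?thesis by simp
qed

text \<open>Expansion along column \<open>k\<close>: it splits the determinants into cofactors and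
  makes the numerator of \<open>Q\<close> visibly linear in the entries of \<open>u\<close>.\<close>

lemma det_column_linear:
  fixes B :: "'a::comm_ring_1^'n^'n"
  shows "det (\<chi> i j. if j = k then u $ i else B $ i $ j)
       = (\<Sum>l\<in>UNIV. u $ l * det (\<chi> i j. if j = k then (if i = l then 1 else 0) else B $ i $ j))"
proof -
  have tr: "det (\<chi> i j. if j = k then w $ i else B $ i $ j) = det (\<chi> i. if i = k then w else transpose B $ i)"
    for w :: "'a^'n"
  proof -
    have "(\<chi> i. if i = k then w else transpose B $ i)
        = transpose (\<chi> i j. if j = k then w $ i else B $ i $ j)"
      by (auto simp: vec_eq_iff transpose_def)
    then show ?thesis by simp
  qed
  have tr': "det (\<chi> i j. if j = k then (if i = l then 1 else 0) else B $ i $ j)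
      = det (\<chi> i. if i = k then axis l 1 else transpose B $ i)" for l
    using tr[of "axis l 1"] by (simp add: axis_def eq_commute cong: if_cong)
  have "det (\<chi> i. if i = k then u else transpose B $ i)
      = det (\<chi> i. if i = k then (\<Sum>l\<in>UNIV. u $ l *s axis l 1) else transpose B $ i)"
    by (subst basis_expansion) (rule refl)
  also have "\<dots> = (\<Sum>l\<in>UNIV. det (\<chi> i. if i = k then u $ l *s axis l 1 else transpose B $ i))"
    by (rule det_linear_row_sum) simp
  also have "\<dots> = (\<Sum>l\<in>UNIV. u $ l * det (\<chi> i. if i = k then axis l 1 else transpose B $ i))"
    by (intro sum.cong refl det_row_mul)
  finally show ?thesis unfolding tr tr' .
qed

section \<open>Characteristic polynomials and the numerator of the resolvent\<close>

lemma poly_det: "poly (det M) z = det (\<chi> i j. poly (M $ i $ j) z)"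
  for M :: "complex poly^'n^'n"
  by (simp add: det_def poly_sum poly_prod)

lemma poly_charpoly: "poly (charpoly A) z = det (mat z - A)"
proof -
  have "(\<chi> i j. poly ((mat [:0, 1:] - (\<chi> i j. [:A $ i $ j:])) $ i $ j) z) = mat z - A"
    by (auto simp: vec_eq_iff mat_def)
  then show ?thesis by (simp add: charpoly_def poly_det)
qed

text \<open>In the Leibniz sum only diagonal factors have degree one, and every permutation other
  than the identity misses at least one of them.\<close>

lemma degree_charpoly_aux:
  fixes A :: "complex^'n^'n"
  shows "degree (charpoly A - (\<Prod>i\<in>UNIV. [:- (A $ i $ i), 1:])) < CARD('n)"
proof -
  define M where "M = mat [:0, 1:] - (\<chi> i j. [:A $ i $ j:])"
  have M: "M $ i $ j = (if i = j then [:- (A $ i $ i), 1:] else [:- (A $ i $ j):])" for i j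
    by (simp add: M_def mat_def)
  let ?t = "\<lambda>p. of_int (sign p) * (\<Prod>i\<in>UNIV. M $ i $ p i)"
  have fin: "finite {p. p permutes (UNIV :: 'n set)}" by (simp add: finite_permutations)
  have "charpoly A = (\<Sum>p\<in>{p. p permutes (UNIV :: 'n set)}. ?t p)"
    by (simp add: charpoly_def M_def det_def)
  also have "\<dots> = ?t id + (\<Sum>p\<in>{p. p permutes (UNIV :: 'n set)} - {id}. ?t p)"
    using fin by (intro sum.remove) (auto simp: permutes_id)
  finally have eq: "charpoly A - (\<Prod>i\<in>UNIV. [:- (A $ i $ i), 1:])
       = (\<Sum>p\<in>{p. p permutes (UNIV :: 'n set)} - {id}. ?t p)"
    by (simp add: M)
  have "degree (?t p) < CARD('n)" if p: "p permutes UNIV" "p \<noteq> id" for p :: "'n \<Rightarrow> 'n"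
  proof -
    obtain i0 where i0: "p i0 \<noteq> i0" using p by (auto simp: fun_eq_iff)
    have "degree (?t p) \<le> degree (of_int (sign p) :: complex poly) + degree (\<Prod>i\<in>UNIV. M $ i $ p i)"
      by (rule degree_mult_le)
    also have "degree (of_int (sign p) :: complex poly) = 0" by simp
    also have "degree (\<Prod>i\<in>UNIV. M $ i $ p i) \<le> sum (degree \<circ> (\<lambda>i. M $ i $ p i)) UNIV"
      by (rule degree_prod_sum_le) simp
    also have "sum (degree \<circ> (\<lambda>i. M $ i $ p i)) UNIV = sum (degree \<circ> (\<lambda>i. M $ i $ p i)) (UNIV - {i0})"
      using i0 by (subst sum.remove[of _ i0]) (auto simp: M)
    also have "\<dots> \<le> sum (\<lambda>_. 1) (UNIV - {i0})"
      by (rule sum_mono) (simp add: M)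
    also have "\<dots> < CARD('n)" by simp
    finally show ?thesis by simp
  qed
  then show ?thesis unfolding eq
    by (intro degree_sum_less) auto
qed

lemma degree_charpoly: "degree (charpoly A) = CARD('n)"
  and lead_coeff_charpoly: "lead_coeff (charpoly A) = 1"
  for A :: "complex^'n^'n"
proof -
  let ?P = "\<Prod>i\<in>UNIV. [:- (A $ i $ i), 1:]"
  have dP: "degree ?P = CARD('n)" by (subst degree_prod_sum_eq) auto
  have lP: "lead_coeff ?P = 1" by (simp add: lead_coeff_prod)
  have eq: "charpoly A = (charpoly A - ?P) + ?P" by simp
  have d: "degree (charpoly A - ?P) < degree ?P" using degree_charpoly_aux[of A] dP by simp
  show "degree (charpoly A) = CARD('n)" using degree_add_eq_right[OF d] eq dP by metis
  show "lead_coeff (charpoly A) = 1" using lead_coeff_add_le[OF d] eq lP by metis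
qed

lemma charpoly_nonzero [simp]: "charpoly A \<noteq> 0"
  using lead_coeff_charpoly[of A] by force

lemma spectrum_eq_roots: "spectrum A = {z. poly (charpoly A) z = 0}"
proof -
  have "z \<in> spectrum A \<longleftrightarrow> \<not> invertible (mat z - A)" for z
  proof -
    have m: "mat z *v x = z *s x" for x :: "complex^'n"
      by (simp add: matrix_vector_mult_def mat_def vec_eq_iff if_distrib [of "\<lambda>c. c * _"] cong: if_cong)
    have "z \<in> spectrum A \<longleftrightarrow> (\<exists>x. x \<noteq> 0 \<and> (mat z - A) *v x = 0)"
      unfolding spectrum_def by (auto simp: matrix_vector_mult_diff_rdistrib m)
    also have "\<dots> \<longleftrightarrow> \<not> invertible (mat z - A)"
      unfolding invertible_left_inverse matrix_left_invertible_ker by auto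
    finally show ?thesis .
  qed
  then show ?thesis by (auto simp: poly_charpoly invertible_det_nz)
qed

text \<open>The characteristic polynomial of A + \<tau> u v* is affine in \<tau>, and this is minus
  its slope. It equals v* adj(zI - A) u, the numerator of \<open>Q\<close> over
  \<open>charpoly A\<close> before cancellation.\<close>

definition num_poly :: "complex^'n^'n \<Rightarrow> complex^'n \<Rightarrow> complex^'n \<Rightarrow> complex poly" where
  "num_poly A u v = charpoly A - charpoly (perturb A u v 1)"

text \<open>Entry (k, l) of the adjugate of zI - A, written in the manner of Cramer's rule with
  column k replaced by a unit vector.\<close>

definition adj_poly :: "complex^'n^'n \<Rightarrow> 'n \<Rightarrow> 'n \<Rightarrow> complex poly" where
  "adj_poly A k l = det (\<chi> i j. if j = k then (if i = l then 1 else 0)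
      else (mat [:0, 1:] - (\<chi> i j. [:A $ i $ j:])) $ i $ j)"

lemma smult_sum_right: "smult c (\<Sum>i\<in>S. f i) = (\<Sum>i\<in>S. smult c (f i))"
  by (induction S rule: infinite_finite_induct) (auto simp: smult_add_right)

lemma charpoly_perturb_aux:
  "charpoly (perturb A u v \<tau>) =
     charpoly A - smult \<tau> (\<Sum>k\<in>UNIV. \<Sum>l\<in>UNIV. smult (cnj (v $ k) * u $ l) (adj_poly A k l))"
proof -
  let ?B = "mat [:0, 1:] - (\<chi> i j. [:A $ i $ j:]) :: complex poly^_^_"
  have pe: "perturb A u v \<tau> $ i $ j = A $ i $ j + \<tau> * (u $ i * cnj (v $ j))" for i j
    by (simp add: perturb_def outer_prod_def matrix_matrix_mult_def mat_def
        if_distrib [of "\<lambda>c. c * _"] cong: if_cong)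
  have "charpoly (perturb A u v \<tau>)
     = det (\<chi> i j. ?B $ i $ j + (\<chi> i. [:u $ i:]) $ i * (\<chi> j. [:- (\<tau> * cnj (v $ j)):]) $ j)"
    unfolding charpoly_def by (rule arg_cong[where f = det]) (simp add: vec_eq_iff pe mat_def algebra_simps)
  also have "\<dots> = det ?B + (\<Sum>k\<in>UNIV. [:- (\<tau> * cnj (v $ k)):] *
       (\<Sum>l\<in>UNIV. [:u $ l:] * adj_poly A k l))"
    by (subst det_add_rank_one, subst det_column_linear) (simp add: adj_poly_def)
  also have "(\<Sum>k\<in>UNIV. [:- (\<tau> * cnj (v $ k)):] * (\<Sum>l\<in>UNIV. [:u $ l:] * adj_poly A k l))
     = - smult \<tau> (\<Sum>k\<in>UNIV. \<Sum>l\<in>UNIV. smult (cnj (v $ k) * u $ l) (adj_poly A k l))"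
    by (simp add: smult_sum_right sum_negf mult_ac)
  finally show ?thesis by (simp add: charpoly_def)
qed

lemma num_poly_bilinear:
  "num_poly A u v = (\<Sum>k\<in>UNIV. \<Sum>l\<in>UNIV. smult (cnj (v $ k) * u $ l) (adj_poly A k l))"
  by (simp add: num_poly_def charpoly_perturb_aux)

lemma charpoly_perturb: "charpoly (perturb A u v \<tau>) = charpoly A - smult \<tau> (num_poly A u v)"
  by (simp add: charpoly_perturb_aux num_poly_bilinear)

lemma degree_num_poly: "degree (num_poly A u v) < CARD('n)"
  for A :: "complex^'n^'n"
proof -
  have "degree (num_poly A u v) \<le> CARD('n)"
    unfolding num_poly_def by (rule degree_diff_le) (simp_all add: degree_charpoly)
  moreover have "coeff (num_poly A u v) (CARD('n)) = 0"
    using lead_coeff_charpoly[of A] lead_coeff_charpoly[of "perturb A u v 1"]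
    by (simp add: num_poly_def degree_charpoly)
  ultimately show ?thesis
    by (metis coeff_0 degree_0 le_neq_implies_less leading_coeff_0_iff zero_less_card_finite)
qed

text \<open>From adj(zI - A) (zI - A) = p(z) I and (zI - A) x = (z - a) x. Moving \<open>u\<close>
  along an eigenvector therefore changes the numerator by multiples of the single polynomial p / (z
  - a); the genericity argument rests on this.\<close>

lemma adj_poly_eigenvector:
  assumes x: "A *v x = a *s x" and z: "z \<noteq> a"
  shows "(z - a) * (\<Sum>l\<in>UNIV. x $ l * poly (adj_poly A k l) z) = poly (charpoly A) z * x $ k"
proof -
  let ?B = "mat z - A"
  have m: "mat z *v x = z *s x"
    by (simp add: matrix_vector_mult_def mat_def vec_eq_iff if_distrib [of "\<lambda>c. c * _"] cong: if_cong)
  have Bx: "(?B *v x) $ i = (z - a) * x $ i" for i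
    by (simp add: matrix_vector_mult_diff_rdistrib m x algebra_simps)
  have ad: "poly (adj_poly A k l) z = det (\<chi> i j. if j = k then (if i = l then 1 else 0) else ?B $ i $ j)" for l
    unfolding adj_poly_def poly_det by (rule arg_cong[where f = det]) (auto simp: vec_eq_iff mat_def)
  have "x $ k * det ?B = det (\<chi> i j. if j = k then (?B *v x) $ i else ?B $ i $ j)"
    by (rule cramer_lemma [symmetric])
  also have "\<dots> = (\<Sum>l\<in>UNIV. (?B *v x) $ l * poly (adj_poly A k l) z)"
    unfolding ad by (rule det_column_linear)
  also have "\<dots> = (z - a) * (\<Sum>l\<in>UNIV. x $ l * poly (adj_poly A k l) z)"
    unfolding Bx by (simp add: sum_distrib_left mult.assoc)
  finally show ?thesis by (simp add: poly_charpoly mult.commute)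
qed

text \<open>Cramer's rule for the solution \<open>x\<close> of (zI - A) x = u, weighted with the
  conjugate entries of \<open>v\<close>.\<close>

lemma resolvent_eq:
  assumes "poly (charpoly A) z \<noteq> 0"
  shows "cdot v (matrix_inv (mat z - A) *v u) = poly (num_poly A u v) z / poly (charpoly A) z"
proof -
  let ?B = "mat z - A"
  define x where "x = matrix_inv ?B *v u"
  have "invertible ?B" using assms by (simp add: poly_charpoly invertible_det_nz)
  then have "?B ** matrix_inv ?B = mat 1"
    unfolding invertible_def matrix_inv_def by (metis (mono_tags, lifting) someI_ex)
  then have Bx: "?B *v x = u" by (simp add: x_def matrix_vector_mul_assoc)
  have ad: "poly (adj_poly A k l) z = det (\<chi> i j. if j = k then (if i = l then 1 else 0) else ?B $ i $ j)" for k l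
    unfolding adj_poly_def poly_det by (rule arg_cong[where f = det]) (auto simp: vec_eq_iff mat_def)
  have "poly (num_poly A u v) z = (\<Sum>k\<in>UNIV. cnj (v $ k) * (\<Sum>l\<in>UNIV. u $ l * poly (adj_poly A k l) z))"
    by (simp add: num_poly_bilinear poly_sum sum_distrib_left mult.assoc)
  also have "\<dots> = (\<Sum>k\<in>UNIV. cnj (v $ k) * det (\<chi> i j. if j = k then u $ i else ?B $ i $ j))"
    unfolding ad by (subst det_column_linear [symmetric]) simp
  also have "\<dots> = (\<Sum>k\<in>UNIV. cnj (v $ k) * (x $ k * det ?B))"
    using cramer_lemma[where A = ?B and x = x] unfolding Bx by simp
  also have "\<dots> = cdot v x * det ?B"
    by (simp add: cdot_def sum_distrib_right mult.assoc)
  finally show ?thesis using assms by (simp add: poly_charpoly x_def)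
qed

section \<open>Reduced fractions\<close>

lemma eventually_poly_nonzero:
  fixes p :: "complex poly"
  assumes "p \<noteq> 0"
  shows "\<forall>\<^sub>F w in at z. poly p w \<noteq> 0"
proof -
  have "\<not> z islimpt {w. poly p w = 0}"
    using poly_roots_finite[OF assms] by (rule islimpt_finite)
  then show ?thesis by (simp add: islimpt_conv_frequently_at not_frequently)
qed

text \<open>A common root of all cofactors would allow a larger common divisor. Three families
  \<open>F\<close> occur below: the numerator alone, all entries of the adjugate, and a
  derivative.\<close>

lemma maximal_common_divisor:
  fixes p :: "complex poly" and F :: "complex poly set"
  assumes "p \<noteq> 0"
  obtains g m where "p = g * m" "\<And>q. q \<in> F \<Longrightarrow> g dvd q"
    "\<And>a. poly m a = 0 \<Longrightarrow> \<exists>q\<in>F. \<forall>r. q = g * r \<longrightarrow> poly r a \<noteq> 0"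
proof -
  let ?D = "\<lambda>g. g dvd p \<and> (\<forall>q\<in>F. g dvd q)"
  have "\<exists>g. ?D g \<and> (\<forall>h. ?D h \<longrightarrow> degree h \<le> degree g)"
    by (rule ex_has_greatest_nat[where k = 1 and b = "Suc (degree p)"])
       (use assms dvd_imp_degree_le in \<open>auto simp: less_Suc_eq_le\<close>)
  then obtain g where g: "?D g" and max: "\<And>h. ?D h \<Longrightarrow> degree h \<le> degree g" by blast
  then obtain m where m: "p = g * m" by blast
  have "g \<noteq> 0" using m assms by auto
  have "\<exists>q\<in>F. \<forall>r. q = g * r \<longrightarrow> poly r a \<noteq> 0" if a: "poly m a = 0" for a
  proof (rule ccontr)
    assume "\<not> ?thesis"
    then have *: "\<And>q. q \<in> F \<Longrightarrow> \<exists>r. q = g * r \<and> poly r a = 0" by blast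
    let ?h = "g * [:- a, 1:]"
    have "?h dvd p" using a by (auto simp: m poly_eq_0_iff_dvd simp del: mult_pCons_right intro!: mult_dvd_mono)
    moreover have "\<forall>q\<in>F. ?h dvd q"
    proof
      fix q assume "q \<in> F"
      then obtain r where "q = g * r" "poly r a = 0" using * by blast
      then show "?h dvd q" by (auto simp: poly_eq_0_iff_dvd simp del: mult_pCons_right intro!: mult_dvd_mono)
    qed
    ultimately have "degree ?h \<le> degree g" using max by blast
    then show False using \<open>g \<noteq> 0\<close> by (subst (asm) degree_mult_eq) auto
  qed
  then show ?thesis using that m g by blast
qed

text \<open>If \<open>R = 0\<close>, then \<open>P\<close> has no root and is constant, so a strict
  inequality of degrees cannot hold; this is the case in which \<open>Q\<close> vanishes
  identically.\<close>

locale coprime_fraction =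
  fixes P R :: "complex poly"
  assumes no_common_root: "\<And>z. poly P z = 0 \<Longrightarrow> poly R z \<noteq> 0"
    and deg: "R = 0 \<or> degree R < degree P"
begin

lemma P_nonzero: "P \<noteq> 0"
  using no_common_root[of 0] deg by (cases "R = 0") auto

definition ratio :: "complex \<Rightarrow> complex" where
  "ratio z = poly R z / poly P z"

text \<open>Free of division: the equation itself excludes the poles, where \<open>R\<close> does
  not vanish, and the set is visibly closed.\<close>

definition level :: "real \<Rightarrow> complex set" where
  "level c = {z. cmod (poly R z) = c * cmod (poly P z)}"

definition crit :: "complex set" where
  "crit = {z. poly P z \<noteq> 0 \<and> poly (pderiv R * P - R * pderiv P) z = 0}"

lemma level_iff: "c > 0 \<Longrightarrow> z \<in> level c \<longleftrightarrow> poly P z \<noteq> 0 \<and> cmod (ratio z) = c"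
  using no_common_root[of z] by (auto simp: level_def ratio_def norm_divide field_simps)

lemma ratio_has_derivative:
  assumes "poly P z \<noteq> 0"
  shows "(ratio has_field_derivative poly (pderiv R * P - R * pderiv P) z / (poly P z)\<^sup>2) (at z)"
  unfolding ratio_def using assms
  by (auto intro!: derivative_eq_intros simp: power2_eq_square field_simps)

lemma ratio_holomorphic: "ratio holomorphic_on {z. poly P z \<noteq> 0}"
  unfolding ratio_def by (intro holomorphic_intros) auto

lemma open_nonpoles: "open {z. poly P z \<noteq> 0}"
  by (intro open_Collect_neq continuous_intros)

lemma crit_iff: "z \<in> crit \<longleftrightarrow> poly P z \<noteq> 0 \<and> deriv ratio z = 0"
  using DERIV_imp_deriv[OF ratio_has_derivative] by (auto simp: crit_def)

lemma is_pole_ratio: "is_pole ratio z \<longleftrightarrow> poly P z = 0"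
proof
  assume "poly P z = 0"
  have "is_pole (\<lambda>w. poly R w / poly P w) z"
  proof (rule is_pole_divide)
    show "poly R z \<noteq> 0" using \<open>poly P z = 0\<close> by (rule no_common_root)
    have "\<forall>\<^sub>F w in at z. poly P w \<noteq> 0"
      using P_nonzero by (rule eventually_poly_nonzero)
    moreover have "(poly P \<longlongrightarrow> 0) (at z)"
      by (rule tendsto_eq_rhs[OF isContD[OF poly_isCont]]) (fact \<open>poly P z = 0\<close>)
    ultimately show "filterlim (poly P) (at 0) (at z)" by (simp add: filterlim_at)
  qed simp
  then show "is_pole ratio z" by (simp add: ratio_def[abs_def])
next
  assume "is_pole ratio z"
  then show "poly P z = 0"
    using not_is_pole_holomorphic[OF open_nonpoles _ ratio_holomorphic] by auto
qed

end

locale perturbation = coprime_fraction P R for P R :: "complex poly" +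
  fixes A :: "complex^'n^'n" and u v :: "complex^'n" and g :: "complex poly"
  assumes charpoly_eq: "charpoly A = g * P"
    and num_poly_eq: "num_poly A u v = g * R"
begin

lemma g_nonzero: "g \<noteq> 0"
  using charpoly_eq charpoly_nonzero[of A] by auto

lemma perturb_eq: "charpoly (perturb A u v \<tau>) = g * (P - smult \<tau> R)"
  by (simp add: charpoly_perturb charpoly_eq num_poly_eq algebra_simps)

lemma Q_fun_eq: "Q_fun A u v = ratio"
proof
  fix z
  let ?f = "\<lambda>z. cdot v (matrix_inv (mat z - A) *v u)"
  have "\<forall>\<^sub>F w in at z. poly (charpoly A) w \<noteq> 0"
    by (simp add: eventually_poly_nonzero)
  then have ev: "\<forall>\<^sub>F w in at z. ?f w = ratio w"
  proof eventually_elim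
    case (elim w)
    then show ?case
      using resolvent_eq[OF elim, of v u] by (simp add: charpoly_eq num_poly_eq ratio_def)
  qed
  then have "Q_fun A u v z = remove_sings ratio z"
    unfolding Q_fun_def by (rule remove_sings_cong) simp
  also have "\<dots> = ratio z"
  proof (cases "poly P z = 0")
    \<comment> \<open>The conventions agree at a pole: \<open>remove_sings\<close> yields 0 there,
      and so does division by zero.\<close>
    case True
    then have "remove_sings ratio z = 0" by (simp add: is_pole_ratio)
    then show ?thesis using True by (simp add: ratio_def)
  next
    case False
    have "ratio analytic_on {z}"
      using ratio_holomorphic open_nonpoles False by (auto simp: analytic_at)
    then show ?thesis by simp
  qed
  finally show "Q_fun A u v z = ratio z" .
qed

lemma Q_crit_eq: "Q_crit A u v = crit"
  by (auto simp: Q_crit_def Q_fun_eq is_pole_ratio crit_iff)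

lemma Q_zeros_eq: "Q_zeros A u v = {z. poly R z = 0}"
  using no_common_root by (auto simp: Q_zeros_def Q_fun_eq is_pole_ratio ratio_def)

lemma perturbed_spectrum_charpoly:
  assumes "t > 0"
  shows "perturbed_spectrum A u v t = {z. cmod (poly (charpoly A) z) = t * cmod (poly (num_poly A u v) z)}"
proof -
  have sp: "z \<in> spectrum (perturb A u v \<tau>) \<longleftrightarrow> poly (charpoly A) z = \<tau> * poly (num_poly A u v) z" for z \<tau>
    by (simp add: spectrum_eq_roots charpoly_perturb)
  have "\<exists>\<theta>\<in>{0..<2*pi}. a = of_real t * exp (\<i> * of_real \<theta>) * b" if "cmod a = t * cmod b" for a b
  proof (cases "b = 0")
    case True
    then show ?thesis using that by (auto intro!: bexI[of _ 0])
  next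
    case False
    have "a / b = of_real (cmod (a / b)) * exp (\<i> * of_real (Arg2pi (a / b)))"
      by (rule Arg2pi_eq)
    moreover have "cmod (a / b) = t" using that False by (simp add: norm_divide)
    ultimately show ?thesis using False Arg2pi_ge_0 Arg2pi_lt_2pi
      by (auto intro!: bexI[of _ "Arg2pi (a / b)"] simp: field_simps)
  qed
  moreover have "cmod a = t * cmod b" if "a = of_real t * exp (\<i> * of_real \<theta>) * b" for a b \<theta>
    using assms by (simp add: that norm_mult)
  ultimately show ?thesis unfolding perturbed_spectrum_def sp by (auto simp: sp)
qed

lemma perturbed_spectrum_eq:
  assumes "t > 0"
  shows "perturbed_spectrum A u v t = level (1 / t) \<union> {z. poly g z = 0}"
proof -
  have "cmod (poly (charpoly A) z) = t * cmod (poly (num_poly A u v) z) \<longleftrightarrow>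
      cmod (poly R z) = 1 / t * cmod (poly P z) \<or> poly g z = 0" for z
    using assms by (auto simp: charpoly_eq num_poly_eq norm_mult field_simps)
  then show ?thesis unfolding perturbed_spectrum_charpoly[OF assms] by (auto simp: level_def)
qed

text \<open>Two values decide: if \<open>g\<close> does not vanish at z, then \<tau> = 0 gives P(z)
  = 0 and \<tau> = 1 gives R(z) = 0 as well, against coprimality.\<close>

lemma fixed_eigenvalues_eq: "fixed_eigenvalues A u v = {z. poly g z = 0}"
proof -
  have "poly g z = 0" if "\<And>\<tau>. poly g z = 0 \<or> poly P z = \<tau> * poly R z" for z
    using that[of 0] that[of 1] no_common_root[of z] by auto
  then show ?thesis
    by (auto simp: fixed_eigenvalues_def spectrum_eq_roots perturb_eq)
qed

lemma Q_crit_at_eq: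
  assumes "t > 0"
  shows "Q_crit_at A u v t = crit \<inter> level (1 / t)"
proof -
  \<comment> \<open>Valid for \<open>x = 0\<close> as well: then 1 / x = 0, whereas t and 1 / t are
    positive.\<close>
  have e: "t = 1 / x \<longleftrightarrow> x = 1 / t" for x using assms by (metis inverse_eq_divide inverse_inverse_eq)
  have "z \<in> level (1 / t) \<longleftrightarrow> t = 1 / cmod (ratio z)" if "z \<in> crit" for z
    using that assms level_iff[of "1 / t" z] by (simp add: e crit_iff)
  then show ?thesis by (auto simp: Q_crit_at_def Q_crit_eq Q_fun_eq)
qed

end

lemma perturbation_exists:
  fixes A :: "complex^'n^'n" and u v :: "complex^'n"
  obtains P R g where "perturbation P R A u v g"
proof -
  obtain g P where g: "charpoly A = g * P" "g dvd num_poly A u v"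
    "\<And>a. poly P a = 0 \<Longrightarrow> \<exists>q\<in>{num_poly A u v}. \<forall>r. q = g * r \<longrightarrow> poly r a \<noteq> 0"
    using maximal_common_divisor[of "charpoly A" "{num_poly A u v}"] by (metis charpoly_nonzero singletonI)
  then obtain R where R: "num_poly A u v = g * R" by blast
  have nz: "g \<noteq> 0" "P \<noteq> 0" using g(1) charpoly_nonzero[of A] by auto
  have "degree R < degree P" if "R \<noteq> 0"
    using degree_num_poly[of A u v] degree_charpoly[of A] nz that
    by (simp add: g(1) R degree_mult_eq)
  then have "R = 0 \<or> degree R < degree P" by blast
  moreover have "poly R z \<noteq> 0" if "poly P z = 0" for z using g(3)[OF that] R by simp
  ultimately have "perturbation P R A u v g"
    unfolding perturbation_def perturbation_axioms_def coprime_fraction_def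
    using g(1) R by blast
  then show ?thesis by (rule that)
qed

section \<open>Smooth maps and charts\<close>

lemma Ck_on_cong:
  assumes "open U" "\<And>x. x \<in> U \<Longrightarrow> f x = g x" "Ck_on k U f"
  shows "Ck_on k U g"
  using assms(2,3)
proof (induction k arbitrary: f g)
  case 0
  then show ?case using continuous_on_cong[of U U f g] by simp
next
  case (Suc k)
  have d: "f differentiable (at x)" if "x \<in> U" for x using Suc.prems that by simp
  have fr: "frechet_derivative f (at x) = frechet_derivative g (at x)" if "x \<in> U" for x
    by (rule frechet_derivative_transform_within_open[OF d[OF that] assms(1) that Suc.prems(1)])
  have "g differentiable (at x)" if xU: "x \<in> U" for x
  proof -
    obtain f' where f': "(f has_derivative f') (at x)" using d[OF xU] unfolding differentiable_def by blast
    have "(g has_derivative f') (at x)"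
      by (rule has_derivative_transform_within_open[OF f' assms(1) xU]) (use Suc.prems in auto)
    then show ?thesis unfolding differentiable_def by blast
  qed
  moreover have "Ck_on k U (\<lambda>x. frechet_derivative g (at x) h)" for h
  proof (rule Suc.IH[of "\<lambda>x. frechet_derivative f (at x) h"])
    show "frechet_derivative f (at x) h = frechet_derivative g (at x) h" if "x \<in> U" for x
      using fr[OF that] by simp
    show "Ck_on k U (\<lambda>x. frechet_derivative f (at x) h)" using Suc.prems(2) by simp
  qed
  ultimately show ?case by simp
qed

text \<open>The directional derivative of \<open>L (f (M x))\<close> along \<open>h\<close> is again
  of this form, with \<open>deriv f\<close> in place of \<open>f\<close> and with multiplication by
  \<open>M h\<close> absorbed into \<open>L\<close>; this closes the induction on
  \<open>k\<close>.\<close>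

lemma Ck_on_holomorphic:
  fixes L :: "complex \<Rightarrow> 'b::real_normed_vector" and M :: "'a::real_normed_vector \<Rightarrow> complex"
  assumes "bounded_linear M" "open V" "open U" "M ` U \<subseteq> V"
    and "bounded_linear L" "f holomorphic_on V"
  shows "Ck_on k U (\<lambda>x. L (f (M x)))"
  using assms(5,6)
proof (induction k arbitrary: f L)
  case 0
  have "continuous_on V f" using 0 by (simp add: holomorphic_on_imp_continuous_on)
  then have "continuous_on U (\<lambda>x. f (M x))"
    using assms(4) by (intro continuous_on_compose2[of V f U M] linear_continuous_on[OF assms(1)]) auto
  then have "continuous_on U (\<lambda>x. L (f (M x)))"
    by (rule bounded_linear.continuous_on[OF 0(1)])
  then show ?case by simp
next
  case (Suc k)
  have der: "((\<lambda>x. L (f (M x))) has_derivative (\<lambda>h. L (deriv f (M x) * M h))) (at x)" if "x \<in> U" for x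
  proof -
    have "(f has_field_derivative deriv f (M x)) (at (M x))"
      using Suc.prems(2) assms(2,4) that by (intro holomorphic_derivI[of f V]) auto
    then have "(f has_derivative (\<lambda>y. deriv f (M x) * y)) (at (M x))"
      by (simp add: has_field_derivative_def)
    then have "((\<lambda>x. f (M x)) has_derivative (\<lambda>h. deriv f (M x) * M h)) (at x)"
      by (rule has_derivative_compose[OF bounded_linear_imp_has_derivative[OF assms(1)]])
    then show ?thesis by (rule bounded_linear.has_derivative[OF Suc.prems(1)])
  qed
  have fr: "frechet_derivative (\<lambda>x. L (f (M x))) (at x) = (\<lambda>h. L (deriv f (M x) * M h))" if "x \<in> U" for x
    using frechet_derivative_at[OF der[OF that]] by simp
  have "Ck_on k U (\<lambda>x. L (deriv f (M x) * M h))" for h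
    by (rule Suc.IH[OF bounded_linear_compose[OF Suc.prems(1) bounded_linear_mult_left]
          holomorphic_deriv[OF Suc.prems(2) assms(2)]])
  then have "Ck_on k U (\<lambda>x. frechet_derivative (\<lambda>x. L (f (M x))) (at x) h)" for h
    by (rule Ck_on_cong[OF assms(3), rotated]) (simp add: fr)
  moreover have "(\<lambda>x. L (f (M x))) differentiable (at x)" if "x \<in> U" for x
    unfolding differentiable_def by (rule exI, rule der[OF that])
  ultimately show ?case unfolding Ck_on.simps by (intro conjI ballI allI)
qed

text \<open>All maps that have to be smooth below are locally a holomorphic function between two
  real-linear maps. The three corollaries cover maps between plane sets, parametrizations by an
  interval, and real coordinates on a curve.\<close>

lemma smooth_on_holomorphicI:
  fixes L :: "complex \<Rightarrow> 'b::real_normed_vector" and M :: "'a::real_normed_vector \<Rightarrow> complex"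
  assumes "bounded_linear M" "bounded_linear L"
    and "\<And>x. x \<in> X \<Longrightarrow> \<exists>V f. open V \<and> M x \<in> V \<and> f holomorphic_on V \<and>
           (\<forall>y\<in>X. M y \<in> V \<longrightarrow> L (f (M y)) = F y)"
  shows "smooth_on X F"
  unfolding smooth_on_def
proof
  fix x assume "x \<in> X"
  obtain V f where V: "open V" "M x \<in> V" "f holomorphic_on V"
    "\<forall>y\<in>X. M y \<in> V \<longrightarrow> L (f (M y)) = F y" using assms(3)[OF \<open>x \<in> X\<close>] by (elim exE conjE)
  have o: "open (M -` V)"
    by (rule open_vimage[OF V(1) linear_continuous_on[OF assms(1)]])
  have "Ck_on k (M -` V) (\<lambda>x. L (f (M x)))" for k
    by (rule Ck_on_holomorphic[OF assms(1) V(1) o _ assms(2) V(3)]) auto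
  then show "\<exists>U G. open U \<and> x \<in> U \<and> (\<forall>k. Ck_on k U G) \<and> (\<forall>y\<in>U \<inter> X. G y = F y)"
    using o V(2,4) by (intro exI[of _ "M -` V"] exI[of _ "\<lambda>x. L (f (M x))"]) simp
qed

lemma smooth_on_complexI:
  fixes F :: "complex \<Rightarrow> complex"
  assumes "\<And>x. x \<in> X \<Longrightarrow> \<exists>V f. open V \<and> x \<in> V \<and> f holomorphic_on V \<and> (\<forall>y\<in>X. y \<in> V \<longrightarrow> f y = F y)"
  shows "smooth_on X F"
  by (rule smooth_on_holomorphicI[OF bounded_linear_ident bounded_linear_ident]) (rule assms)

lemma smooth_on_realI:
  fixes F :: "real \<Rightarrow> complex"
  assumes "\<And>x. x \<in> X \<Longrightarrow> \<exists>V f. open V \<and> complex_of_real x \<in> V \<and> f holomorphic_on V \<and>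
      (\<forall>y\<in>X. complex_of_real y \<in> V \<longrightarrow> f (complex_of_real y) = F y)"
  shows "smooth_on X F"
  by (rule smooth_on_holomorphicI[OF bounded_linear_of_real bounded_linear_ident]) (rule assms)

lemma smooth_on_ReI:
  assumes "\<And>x. x \<in> X \<Longrightarrow> \<exists>V f. open V \<and> x \<in> V \<and> f holomorphic_on V \<and> (\<forall>y\<in>X. y \<in> V \<longrightarrow> Re (f y) = F y)"
  shows "smooth_on X F"
  by (rule smooth_on_holomorphicI[OF bounded_linear_ident bounded_linear_Re]) (rule assms)

text \<open>In this normal form the level set of the modulus is Im(\<phi>^k) = 0, and on it
  Re(\<phi>^k) is the increase of the argument of \<open>f\<close>. The same chart thus describes
  both the local shape of the level set and the sheets over the circle of values.\<close>

locale power_chart =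
  fixes f :: "complex \<Rightarrow> complex" and z0 :: complex and k :: nat and r :: real
    and U :: "complex set" and \<phi> \<psi> :: "complex \<Rightarrow> complex"
  assumes k_pos: "k > 0" and r_pos: "r > 0" and open_U: "open U" and z0_in: "z0 \<in> U"
    and \<phi>_z0: "\<phi> z0 = 0"
    and homeo: "homeomorphism U (ball 0 r) \<phi> \<psi>"
    and hol_\<phi>: "\<phi> holomorphic_on U" and hol_\<psi>: "\<psi> holomorphic_on ball 0 r"
    and f_nonzero: "f z0 \<noteq> 0"
    and f_eq: "\<And>z. z \<in> U \<Longrightarrow> f z = f z0 * exp (\<i> * \<phi> z ^ k)"
begin

lemma \<psi>_0: "\<psi> 0 = z0"
  using homeo z0_in \<phi>_z0 by (metis homeomorphism_apply1)

lemma \<psi>_in: "w \<in> ball 0 r \<Longrightarrow> \<psi> w \<in> U"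
  using homeo by (auto simp: homeomorphism_def)

lemma \<phi>_in: "z \<in> U \<Longrightarrow> \<phi> z \<in> ball 0 r"
  using homeo unfolding homeomorphism_def by blast

lemma \<phi>\<psi>: "w \<in> ball 0 r \<Longrightarrow> \<phi> (\<psi> w) = w"
  using homeo by (auto simp: homeomorphism_def)

lemma \<psi>\<phi>: "z \<in> U \<Longrightarrow> \<psi> (\<phi> z) = z"
  using homeo by (auto simp: homeomorphism_def)

lemma f_\<psi>: "w \<in> ball 0 r \<Longrightarrow> f (\<psi> w) = f z0 * exp (\<i> * w ^ k)"
  using f_eq[OF \<psi>_in] \<phi>\<psi> by simp

lemma inj_\<psi>: "w \<in> ball 0 r \<Longrightarrow> w' \<in> ball 0 r \<Longrightarrow> \<psi> w = \<psi> w' \<longleftrightarrow> w = w'"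
  using \<phi>\<psi> by metis

lemma deriv_\<psi>\<phi>: "deriv \<phi> z0 * deriv \<psi> 0 = 1"
proof -
  have d: "(\<psi> has_field_derivative deriv \<psi> 0) (at (\<phi> z0))"
    unfolding \<phi>_z0 using hol_\<psi> r_pos by (intro holomorphic_derivI[of _ "ball 0 r"]) auto
  have d': "(\<phi> has_field_derivative deriv \<phi> z0) (at z0)"
    using hol_\<phi> open_U z0_in by (intro holomorphic_derivI[of _ U]) auto
  have "((\<lambda>z. \<psi> (\<phi> z)) has_field_derivative deriv \<psi> 0 * deriv \<phi> z0) (at z0)"
    using DERIV_chain2[OF d d'] .
  then have "((\<lambda>z. z) has_field_derivative deriv \<psi> 0 * deriv \<phi> z0) (at z0)"
    by (rule has_field_derivative_transform_within_open[OF _ open_U z0_in]) (simp add: \<psi>\<phi>)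
  then have "deriv \<psi> 0 * deriv \<phi> z0 = 1" using DERIV_ident by (rule DERIV_unique)
  then show ?thesis by (simp only: mult.commute)
qed

lemma deriv_\<psi>_nonzero: "deriv \<psi> 0 \<noteq> 0" and deriv_\<phi>_nonzero: "deriv \<phi> z0 \<noteq> 0"
  using deriv_\<psi>\<phi> by auto

lemma norm_f: "z \<in> U \<Longrightarrow> cmod (f z) = cmod (f z0) \<longleftrightarrow> Im (\<phi> z ^ k) = 0"
  using f_nonzero by (simp add: f_eq norm_mult)

lemma norm_f_\<psi>: "w \<in> ball 0 r \<Longrightarrow> cmod (f (\<psi> w)) = cmod (f z0) \<longleftrightarrow> Im (w ^ k) = 0"
  using f_nonzero by (simp add: f_\<psi> norm_mult)

lemma image_ball: "0 < s \<Longrightarrow> s \<le> r \<Longrightarrow> \<psi> ` ball 0 s = {z \<in> U. \<phi> z \<in> ball 0 s}"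
proof (intro equalityI subsetI)
  fix z assume "0 < s" "s \<le> r" "z \<in> \<psi> ` ball 0 s"
  then obtain w where "w \<in> ball 0 s" "z = \<psi> w" by blast
  moreover then have "w \<in> ball 0 r" using \<open>s \<le> r\<close> by simp
  ultimately show "z \<in> {z \<in> U. \<phi> z \<in> ball 0 s}" using \<psi>_in[of w] \<phi>\<psi>[of w] by simp
next
  fix z assume "z \<in> {z \<in> U. \<phi> z \<in> ball 0 s}"
  then show "z \<in> \<psi> ` ball 0 s" using \<psi>\<phi>[of z] by (metis (no_types, lifting) imageI mem_Collect_eq)
qed

lemma open_image_ball: "0 < s \<Longrightarrow> s \<le> r \<Longrightarrow> open (\<psi> ` ball 0 s)"
proof -
  assume s: "0 < s" "s \<le> r"
  have "open (U \<inter> \<phi> -` ball 0 s)"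
    using hol_\<phi> open_U by (intro continuous_open_preimage holomorphic_on_imp_continuous_on) auto
  moreover have "U \<inter> \<phi> -` ball 0 s = \<psi> ` ball 0 s" using image_ball[OF s] by auto
  ultimately show ?thesis by simp
qed

lemma restrict:
  assumes "0 < s" "s \<le> r"
  shows "power_chart f z0 k s (\<psi> ` ball 0 s) \<phi> \<psi>"
proof -
  have sub: "\<psi> ` ball 0 s \<subseteq> U" "ball 0 s \<subseteq> ball (0::complex) r" using assms by (auto simp: image_ball)
  have im: "\<phi> ` \<psi> ` ball 0 s = ball 0 s" unfolding image_image using sub(2) \<phi>\<psi> by (subst image_cong[OF refl, of _ _ "\<lambda>w. w"]) auto
  show ?thesis
  proof
    show "homeomorphism (\<psi> ` ball 0 s) (ball 0 s) \<phi> \<psi>"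
      by (rule homeomorphism_of_subsets[OF homeo]) (use sub im in auto)
    show "z0 \<in> \<psi> ` ball 0 s" using \<psi>_0 assms by (auto intro!: image_eqI[of _ _ 0])
    show "\<phi> holomorphic_on \<psi> ` ball 0 s" using hol_\<phi> sub by (blast intro: holomorphic_on_subset)
    show "\<psi> holomorphic_on ball 0 s" using hol_\<psi> sub by (blast intro: holomorphic_on_subset)
    show "f z = f z0 * exp (\<i> * \<phi> z ^ k)" if "z \<in> \<psi> ` ball 0 s" for z using f_eq sub that by blast
  qed (use assms k_pos \<phi>_z0 f_nonzero open_image_ball[OF assms] in simp_all)
qed

lemma small:
  assumes "open W" "z0 \<in> W"
  obtains s where "0 < s" "s \<le> r" "\<psi> ` ball 0 s \<subseteq> W"
proof -
  have "open (ball 0 r \<inter> \<psi> -` W)"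
    using hol_\<psi> assms by (intro continuous_open_preimage holomorphic_on_imp_continuous_on) auto
  moreover have "0 \<in> ball 0 r \<inter> \<psi> -` W" using \<psi>_0 assms r_pos by auto
  ultimately obtain s where s: "s > 0" "ball 0 s \<subseteq> ball 0 r \<inter> \<psi> -` W"
    by (meson openE)
  have "ball 0 (min s r) \<subseteq> ball (0::complex) s" by auto
  then have "\<psi> ` ball 0 (min s r) \<subseteq> W" using s(2) by blast
  then show ?thesis using that[of "min s r"] s(1) r_pos by simp
qed

text \<open>The factor \<open>0 ^ (k - 1)\<close> is 1 for k = 1 and 0 otherwise, so the derivative
  vanishes exactly for k >= 2.\<close>

lemma deriv_f: "(f has_field_derivative f z0 * (\<i> * (of_nat k * 0 ^ (k - 1) * deriv \<phi> z0))) (at z0)"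
proof -
  have d': "(\<phi> has_field_derivative deriv \<phi> z0) (at z0)"
    using hol_\<phi> open_U z0_in by (intro holomorphic_derivI[of _ U]) auto
  have a: "((\<lambda>z. \<i> * \<phi> z ^ k) has_field_derivative \<i> * (of_nat k * 0 ^ (k - 1) * deriv \<phi> z0)) (at z0)"
    using DERIV_cmult[OF DERIV_power[OF d', of k], of \<i>] by (simp add: \<phi>_z0 mult_ac)
  have "((\<lambda>z. f z0 * exp (\<i> * \<phi> z ^ k)) has_field_derivative f z0 * (\<i> * (of_nat k * 0 ^ (k - 1) * deriv \<phi> z0))) (at z0)"
    using DERIV_cmult[OF DERIV_chain2[OF DERIV_exp a], of "f z0"] k_pos by (simp add: \<phi>_z0 power_0_left)
  then show ?thesis
    by (rule has_field_derivative_transform_within_open[OF _ open_U z0_in]) (simp add: f_eq)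
qed

lemma k_eq_1_iff: "k = 1 \<longleftrightarrow> deriv f z0 \<noteq> 0"
  using DERIV_imp_deriv[OF deriv_f] f_nonzero deriv_\<phi>_nonzero k_pos by (auto simp: power_0_left)

end

text \<open>The function h = -i log(f / f(z0)) has a zero of some order n at z0, so h = ((z - z0)
  g)^n with a nonvanishing g. The base of this power has derivative g(z0) at z0 and is therefore a
  local coordinate.\<close>

lemma power_chart_exists:
  fixes f :: "complex \<Rightarrow> complex"
  assumes "f holomorphic_on W" "open W" "z0 \<in> W" "f z0 \<noteq> 0"
    and nonconst: "\<not> (\<forall>\<^sub>F z in at z0. f z = f z0)"
  obtains k r U \<phi> \<psi> where "power_chart f z0 k r U \<phi> \<psi>" "U \<subseteq> W"
proof -
  \<comment> \<open>Values of f / f(z0) at distance less than 1 from 1 stay off the branch cut of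
    \<open>Ln\<close>.\<close>
  have "open (W \<inter> (\<lambda>z. f z / f z0) -` ball 1 1)"
    using assms by (intro continuous_open_preimage holomorphic_on_imp_continuous_on holomorphic_intros) auto
  moreover have "z0 \<in> W \<inter> (\<lambda>z. f z / f z0) -` ball 1 1" using assms by simp
  ultimately obtain e where e: "e > 0" "ball z0 e \<subseteq> W \<inter> (\<lambda>z. f z / f z0) -` ball 1 1"
    by (meson openE)
  let ?B = "ball z0 e"
  define h where "h = (\<lambda>z. - \<i> * Ln (f z / f z0))"
  have q: "f z / f z0 \<in> ball 1 1" if "z \<in> ?B" for z using e that by auto
  have pos: "f z / f z0 \<notin> \<real>\<^sub>\<le>\<^sub>0" if "z \<in> ?B" for z
  proof
    assume a: "f z / f z0 \<in> \<real>\<^sub>\<le>\<^sub>0"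
    have "\<bar>Re (1 - f z / f z0)\<bar> < 1" using q[OF that] abs_Re_le_cmod[of "1 - f z / f z0"] by (simp add: dist_norm)
    then show False using a by (auto simp: complex_nonpos_Reals_iff)
  qed
  have hol_h: "h holomorphic_on ?B"
    unfolding h_def using assms e pos
    by (intro holomorphic_intros holomorphic_on_subset[OF assms(1)]) auto
  have h0: "h z0 = 0" using assms by (simp add: h_def)
  have fh: "f z = f z0 * exp (\<i> * h z)" if "z \<in> ?B" for z
  proof -
    have "f z / f z0 \<noteq> 0" using pos[OF that] by auto
    then show ?thesis using assms by (simp add: h_def exp_Ln)
  qed
  have "\<exists>n>0. (deriv ^^ n) h z0 \<noteq> 0"
  proof (rule ccontr)
    assume "\<not> ?thesis"
    then have "(deriv ^^ n) h z0 = 0" if "0 < n" for n using that by blast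
    then have "h z = h z0" if "z \<in> ?B" for z
      using holomorphic_fun_eq_const_on_connected[OF hol_h open_ball connected_ball _ _ that, of z0] e(1) by simp
    then have "\<forall>\<^sub>F z in at z0. f z = f z0"
      using e(1) unfolding eventually_at
      by (intro exI[of _ e]) (metis fh h0 dist_commute mem_ball centre_in_ball)
    then show False using nonconst by blast
  qed
  then obtain n0 where n0: "n0 > 0 \<and> (deriv ^^ n0) h z0 \<noteq> 0" by blast
  define n where [abs_def]: "n = (LEAST n. n > 0 \<and> (deriv ^^ n) h z0 \<noteq> 0)"
  have n_ne: "n > 0" "(deriv ^^ n) h z0 \<noteq> 0"
    using def_LeastI [OF n_def n0] by auto
  have n_min: "\<And>k. 0 < k \<Longrightarrow> k < n \<Longrightarrow> (deriv ^^ k) h z0 = 0"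
    using def_Least_le [OF n_def] not_le by auto
  obtain g d where d: "0 < d" and holg: "g holomorphic_on ball z0 d"
      and hg: "\<And>w. w \<in> ball z0 d \<Longrightarrow> h w - h z0 = ((w - z0) * g w) ^ n"
      and gnz: "\<And>w. w \<in> ball z0 d \<Longrightarrow> g w \<noteq> 0"
    using holomorphic_factor_order_of_zero_strong[OF hol_h open_ball _ n_ne(1,2) n_min] e by (metis centre_in_ball)
  define \<phi> where "\<phi> = (\<lambda>w. (w - z0) * g w)"
  define V where "V = ball z0 (min d e)"
  have V: "open V" "z0 \<in> V" "V \<subseteq> ?B" "V \<subseteq> ball z0 d" using d e by (auto simp: V_def)
  have hol_\<phi>: "\<phi> holomorphic_on V" unfolding \<phi>_def
    using V by (intro holomorphic_intros holomorphic_on_subset[OF holg])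
  have "(g has_field_derivative deriv g z0) (at z0)"
    using holg d by (intro holomorphic_derivI[of _ "ball z0 d"]) auto
  then have "(\<phi> has_field_derivative g z0) (at z0)"
    unfolding \<phi>_def by (auto intro!: derivative_eq_intros)
  then have "deriv \<phi> z0 \<noteq> 0" using gnz d by (simp add: DERIV_imp_deriv)
  then obtain e' where e': "e' > 0" "ball z0 e' \<subseteq> V" "inj_on \<phi> (ball z0 e')"
    using has_complex_derivative_locally_injective[OF hol_\<phi>] V by metis
  have hol': "\<phi> holomorphic_on ball z0 e'" using hol_\<phi> e' by (blast intro: holomorphic_on_subset)
  obtain \<psi> where \<psi>: "\<psi> holomorphic_on \<phi> ` ball z0 e'" "\<And>z. z \<in> ball z0 e' \<Longrightarrow> \<psi> (\<phi> z) = z"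
    using holomorphic_has_inverse[OF hol' open_ball e'(3)] by metis
  have "open (\<phi> ` ball z0 e')" by (rule open_mapping_thm3[OF hol' open_ball e'(3)])
  moreover have "0 \<in> \<phi> ` ball z0 e'" using e' by (auto simp: \<phi>_def image_iff intro!: bexI[of _ z0])
  ultimately obtain r where r: "r > 0" "ball 0 r \<subseteq> \<phi> ` ball z0 e'" by (meson openE)
  define U where "U = ball z0 e' \<inter> \<phi> -` ball 0 r"
  have U: "open U" unfolding U_def
    using hol' by (intro continuous_open_preimage holomorphic_on_imp_continuous_on) auto
  have Usub: "U \<subseteq> ball z0 e'" by (auto simp: U_def)
  have "power_chart f z0 n r U \<phi> \<psi>"
  proof
    show "homeomorphism U (ball 0 r) \<phi> \<psi>"
    proof (rule homeomorphismI)
      show "continuous_on U \<phi>" "continuous_on (ball 0 r) \<psi>"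
        using hol' \<psi>(1) Usub r(2) by (meson holomorphic_on_imp_continuous_on holomorphic_on_subset)+
      show "\<phi> ` U \<subseteq> ball 0 r" by (auto simp: U_def)
      show "\<psi> ` ball 0 r \<subseteq> U"
      proof
        fix z assume "z \<in> \<psi> ` ball 0 r"
        then obtain w where w: "w \<in> ball 0 r" "z = \<psi> w" by blast
        then obtain y where "y \<in> ball z0 e'" "w = \<phi> y" using r by blast
        then show "z \<in> U" using w \<psi>(2) by (simp add: U_def)
      qed
      show "\<psi> (\<phi> z) = z" if "z \<in> U" for z using that Usub \<psi>(2) by blast
      show "\<phi> (\<psi> w) = w" if "w \<in> ball 0 r" for w using that r(2) \<psi>(2) by force
    qed
    show "z0 \<in> U" using e' r by (simp add: U_def \<phi>_def)
    show "\<phi> holomorphic_on U" using hol' Usub by (blast intro: holomorphic_on_subset)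
    show "\<psi> holomorphic_on ball 0 r" using \<psi>(1) r by (blast intro: holomorphic_on_subset)
    show "f z = f z0 * exp (\<i> * \<phi> z ^ n)" if "z \<in> U" for z
    proof -
      have "z \<in> ?B" "z \<in> ball z0 d" using that Usub e'(2) V by blast+
      then show ?thesis using fh[of z] hg[of z] h0 by (simp add: \<phi>_def)
    qed
  qed (use n_ne r U assms in \<open>auto simp: \<phi>_def\<close>)
  moreover have "U \<subseteq> W" using Usub e'(2) V(3) e(2) by blast
  ultimately show ?thesis by (rule that)
qed

text \<open>For k = 1 the rays form the real diameter of the disc; the factor r rescales it to (-1,
  1).\<close>

lemma (in power_chart) level_arc_diffeomorphic:
  assumes "k = 1"
  shows "diffeomorphic {-1<..<1::real} {z \<in> U. cmod (f z) = cmod (f z0)}"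
proof -
  let ?g = "\<lambda>s::real. \<psi> (complex_of_real (r * s))" and ?h = "\<lambda>z. Re (\<phi> z) / r"
  have inb: "complex_of_real (r * s) \<in> ball 0 r" if "s \<in> {-1<..<1}" for s
    using that r_pos mult_strict_left_mono[of "\<bar>s\<bar>" 1 r] by (simp add: norm_mult abs_less_iff)
  have "homeomorphism {-1<..<1::real} {z \<in> U. cmod (f z) = cmod (f z0)} ?g ?h"
  proof (rule homeomorphismI)
    show "continuous_on {-1<..<1} ?g"
      by (rule continuous_on_compose2[OF holomorphic_on_imp_continuous_on[OF hol_\<psi>]])
        (use inb in \<open>auto intro!: continuous_intros\<close>)
    show "continuous_on {z \<in> U. cmod (f z) = cmod (f z0)} ?h"
      using r_pos by (intro continuous_intros continuous_on_subset[OF holomorphic_on_imp_continuous_on[OF hol_\<phi>]]) auto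
    show "?g ` {-1<..<1} \<subseteq> {z \<in> U. cmod (f z) = cmod (f z0)}"
      using inb \<psi>_in norm_f_\<psi> assms by auto
    show "?h ` {z \<in> U. cmod (f z) = cmod (f z0)} \<subseteq> {-1<..<1}"
    proof
      fix x assume "x \<in> ?h ` {z \<in> U. cmod (f z) = cmod (f z0)}"
      then obtain z where z: "z \<in> U" "x = ?h z" by auto
      have "\<bar>Re (\<phi> z)\<bar> < r" using \<phi>_in[OF z(1)] abs_Re_le_cmod[of "\<phi> z"] by simp
      then have "\<bar>Re (\<phi> z) / r\<bar> < 1" using r_pos by simp
      then show "x \<in> {-1<..<1}" unfolding z(2) greaterThanLessThan_iff abs_less_iff by linarith
    qed
    show "?h (?g s) = s" if "s \<in> {-1<..<1}" for s
      using \<phi>\<psi>[OF inb[OF that]] r_pos by simp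
    show "?g (?h z) = z" if "z \<in> {z \<in> U. cmod (f z) = cmod (f z0)}" for z
    proof -
      have "Im (\<phi> z) = 0" using that norm_f assms by auto
      then have "complex_of_real (r * ?h z) = \<phi> z" using r_pos by (simp add: complex_eq_iff)
      then show ?thesis using \<psi>\<phi> that by simp
    qed
  qed
  moreover have "smooth_on {-1<..<1} ?g"
  proof (rule smooth_on_realI)
    fix x :: real assume "x \<in> {-1<..<1}"
    let ?V = "{\<zeta>. cmod (complex_of_real r * \<zeta>) < r}"
    have "open ?V" by (intro open_Collect_less continuous_intros)
    moreover have "(\<lambda>\<zeta>. \<psi> (complex_of_real r * \<zeta>)) holomorphic_on ?V"
      by (rule holomorphic_on_compose_gen[OF _ hol_\<psi>, unfolded o_def]) (auto intro!: holomorphic_intros)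
    ultimately show "\<exists>V g. open V \<and> complex_of_real x \<in> V \<and> g holomorphic_on V \<and>
        (\<forall>y\<in>{-1<..<1}. complex_of_real y \<in> V \<longrightarrow> g (complex_of_real y) = ?g y)"
      using inb[OF \<open>x \<in> _\<close>] by (intro exI[of _ ?V] exI[of _ "\<lambda>\<zeta>. \<psi> (complex_of_real r * \<zeta>)"]) auto
  qed
  moreover have "smooth_on {z \<in> U. cmod (f z) = cmod (f z0)} ?h"
  proof (rule smooth_on_ReI)
    fix x assume "x \<in> {z \<in> U. cmod (f z) = cmod (f z0)}"
    moreover have "(\<lambda>z. \<phi> z / complex_of_real r) holomorphic_on U"
      using hol_\<phi> r_pos by (intro holomorphic_intros) auto
    ultimately show "\<exists>V g. open V \<and> x \<in> V \<and> g holomorphic_on V \<and>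
        (\<forall>y\<in>{z \<in> U. cmod (f z) = cmod (f z0)}. y \<in> V \<longrightarrow> Re (g y) = ?h y)"
      using open_U by (intro exI[of _ U] exI[of _ "\<lambda>z. \<phi> z / complex_of_real r"]) auto
  qed
  ultimately show ?thesis unfolding diffeomorphic_def by blast
qed

lemma (in power_chart) locally_interval_level:
  assumes "k = 1" "open W" "z0 \<in> W" "S \<inter> W = {z \<in> W. z \<in> U \<longrightarrow> cmod (f z) = cmod (f z0)}"
  shows "locally_interval S z0"
proof -
  obtain s where s: "0 < s" "s \<le> r" "\<psi> ` ball 0 s \<subseteq> W" using small[OF assms(2,3)] .
  interpret c: power_chart f z0 k s "\<psi> ` ball 0 s" \<phi> \<psi> by (rule restrict[OF s(1,2)])
  have "S \<inter> \<psi> ` ball 0 s = {z \<in> \<psi> ` ball 0 s. cmod (f z) = cmod (f z0)}"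
    using assms(4) s image_ball[OF s(1,2)] by blast
  then show ?thesis unfolding locally_interval_def
    using c.level_arc_diffeomorphic[OF assms(1)] c.open_U c.z0_in by metis
qed

text \<open>An interval to the right of p that accumulates at p contains an initial piece of the
  open half-line beyond p, so two of them overlap.\<close>

lemma connected_real_sharing_endpoint:
  fixes I J :: "real set"
  assumes "connected I" "connected J" "p \<in> closure I" "p \<in> closure J" "I \<noteq> {}" "J \<noteq> {}"
    and "\<And>x. x \<in> I \<union> J \<Longrightarrow> p < x"
  shows "I \<inter> J \<noteq> {}"
proof -
  have *: "a \<in> J'" if J: "connected J'" "p \<in> closure J'" "a' \<in> J'" "a \<le> a'" "p < a" for a a' and J' :: "real set"
  proof -
    obtain b where b: "b \<in> J'" "dist b p < a - p"
      using closure_approachable[THEN iffD1, OF J(2), rule_format, of "a - p"] J(5) by auto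
    then have "b \<le> a" by (auto simp: dist_real_def)
    then show ?thesis using connectedD_interval[OF that(1) b(1) that(3)] that(4) by blast
  qed
  from assms(5,6) obtain a a' where a: "a \<in> I" "a' \<in> J" by blast
  show ?thesis
  proof (cases "a \<le> a'")
    case True
    then show ?thesis using *[OF assms(2,4) a(2)] a assms(7) by blast
  next
    case False
    then show ?thesis using *[OF assms(1,3) a(1), of a'] a assms(7) by force
  qed
qed

text \<open>The reason is topological, and three of the 2k rays suffice. A homeomorphism to an
  interval maps them, without z0, to disjoint connected sets that accumulate at the image of z0; two
  of these lie on the same side of it and would overlap.\<close>

lemma (in power_chart) not_locally_interval_level:
  assumes "k \<ge> 2" "open W" "z0 \<in> W" "S \<inter> W = {z \<in> W. z \<in> U \<longrightarrow> cmod (f z) = cmod (f z0)}"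
  shows "\<not> locally_interval S z0"
proof
  assume "locally_interval S z0"
  then obtain U0 F G where U0: "open U0" "z0 \<in> U0" and FG: "homeomorphism {-1<..<1::real} (S \<inter> U0) F G"
    unfolding locally_interval_def diffeomorphic_def by blast
  obtain s where s: "0 < s" "s \<le> r" "\<psi> ` ball 0 s \<subseteq> W \<inter> U0"
    using small[of "W \<inter> U0"] assms U0 by blast
  \<comment> \<open>The rays with l < 3 are used. Since k >= 2, their angles pi l / k stay in
    [0, pi], where \<open>cis\<close> is injective.\<close>
  define \<omega> where "\<omega> = (\<lambda>l::nat. cis (pi * l / k))"
  define A where "A = (\<lambda>l. (\<lambda>y. \<psi> (\<omega> l * complex_of_real y)) ` {0<..<s})"
  define B where "B = (\<lambda>l. (\<lambda>y. \<psi> (\<omega> l * complex_of_real y)) ` {0..<s})"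
  have n: "cmod (\<omega> l) = 1" for l by (simp add: \<omega>_def)
  have inb: "\<omega> l * complex_of_real y \<in> ball 0 s" if "y \<in> {0..<s}" for l y
    using that n by (simp add: norm_mult)
  have inbr: "\<omega> l * complex_of_real y \<in> ball 0 r" if "y \<in> {0..<s}" for l y
    using that n s by (simp add: norm_mult)
  have pw: "\<omega> l ^ k = cis (pi * l)" for l
    unfolding \<omega>_def Complex.DeMoivre using assms(1) by simp
  have im: "Im (\<omega> l ^ k * (complex_of_real y) ^ k) = 0" for l y
    unfolding pw by (simp flip: of_real_power)
  have sub: "B l \<subseteq> S \<inter> U0" for l
  proof
    fix z assume "z \<in> B l"
    then obtain y where y: "y \<in> {0..<s}" "z = \<psi> (\<omega> l * complex_of_real y)" by (auto simp: B_def)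
    have "z \<in> \<psi> ` ball 0 s" using inb[OF y(1)] y(2) by blast
    moreover have "cmod (f z) = cmod (f z0)"
      using norm_f_\<psi>[OF inbr[OF y(1)]] y(2) im by (simp add: power_mult_distrib)
    ultimately show "z \<in> S \<inter> U0" using s(3) assms(4) by blast
  qed
  have AB: "A l \<subseteq> B l" "z0 \<in> B l" for l
    using s \<psi>_0 by (auto simp: A_def B_def image_iff intro!: bexI[of _ 0])
  have z0S: "z0 \<in> S \<inter> U0" using AB sub by blast
  have contA: "continuous_on {0..<s} (\<lambda>y. \<psi> (\<omega> l * complex_of_real y))" for l
    by (rule continuous_on_compose2[OF holomorphic_on_imp_continuous_on[OF hol_\<psi>]])
       (use inbr in \<open>auto intro!: continuous_intros\<close>)
  have contG: "continuous_on (S \<inter> U0) G" using FG by (simp add: homeomorphism_def)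
  have contGB: "continuous_on (B l) G" for l using contG sub by (blast intro: continuous_on_subset)
  have conA: "connected (A l)" for l unfolding A_def
    by (intro connected_continuous_image continuous_on_subset[OF contA]) auto
  have conGA: "connected (G ` A l)" for l
    by (rule connected_continuous_image[OF continuous_on_subset[OF contGB[of l] AB(1)] conA])
  have injG: "inj_on G (S \<inter> U0)" using FG by (metis homeomorphism_def inj_on_inverseI)
  have np: "x \<noteq> G z0" if "x \<in> G ` A l" for x l
  proof
    assume eq: "x = G z0"
    obtain y where y: "y \<in> {0<..<s}" "x = G (\<psi> (\<omega> l * complex_of_real y))"
      using \<open>x \<in> G ` A l\<close> by (auto simp: A_def)
    have "\<psi> (\<omega> l * complex_of_real y) \<in> S \<inter> U0" using y(1) sub[of l] by (auto simp: B_def)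
    then have "\<psi> (\<omega> l * complex_of_real y) = \<psi> 0" using injG z0S y eq \<psi>_0 by (metis inj_onD)
    then have "\<omega> l * complex_of_real y = 0"
      using inj_\<psi>[OF inbr[of y l], of 0] y(1) r_pos by simp
    then show False using y n[of l] by auto
  qed
  have clos: "G z0 \<in> closure (G ` A l)" for l
  proof -
    \<comment> \<open>Halving keeps the closure of the parameter interval inside the half-open
      one.\<close>
    have sub': "closure {0<..<s/2} \<subseteq> {0..<s}" using s by auto
    have "continuous_on (closure {0<..<s/2}) (\<lambda>y. G (\<psi> (\<omega> l * complex_of_real y)))"
    proof (rule continuous_on_compose2[OF contGB[of l]])
      show "continuous_on (closure {0<..<s/2}) (\<lambda>y. \<psi> (\<omega> l * complex_of_real y))"
        by (rule continuous_on_subset[OF contA sub'])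
      show "(\<lambda>y. \<psi> (\<omega> l * complex_of_real y)) ` closure {0<..<s/2} \<subseteq> B l"
        unfolding B_def by (rule image_mono[OF sub'])
    qed
    then have "(\<lambda>y. G (\<psi> (\<omega> l * complex_of_real y))) ` closure {0<..<s/2} \<subseteq> closure (G ` A l)"
    proof (rule image_closure_subset)
      have "(\<lambda>y. G (\<psi> (\<omega> l * complex_of_real y))) ` {0<..<s/2} \<subseteq> G ` A l"
        using s by (auto simp: A_def)
      then show "(\<lambda>y. G (\<psi> (\<omega> l * complex_of_real y))) ` {0<..<s/2} \<subseteq> closure (G ` A l)"
        using closure_subset by (rule subset_trans)
    qed simp
    moreover have "0 \<in> closure {0<..<s/2}" using s by simp
    ultimately have "G (\<psi> (\<omega> l * complex_of_real 0)) \<in> closure (G ` A l)" by (rule subsetD[OF _ imageI])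
    then show ?thesis using \<psi>_0 by simp
  qed
  have disj: "A l \<inter> A m = {}" if lm: "l < 3" "m < 3" "l \<noteq> m" for l m
  proof (rule ccontr)
    assume "A l \<inter> A m \<noteq> {}"
    then obtain y y' where y: "y \<in> {0<..<s}" "y' \<in> {0<..<s}"
      and eq: "\<psi> (\<omega> l * complex_of_real y) = \<psi> (\<omega> m * complex_of_real y')"
      unfolding A_def by blast
    have yy: "y \<in> {0..<s}" "y' \<in> {0..<s}" using y by auto
    have e: "\<omega> l * complex_of_real y = \<omega> m * complex_of_real y'"
      using inj_\<psi>[OF inbr[OF yy(1)] inbr[OF yy(2)]] eq by blast
    then have "cmod (\<omega> l * complex_of_real y) = cmod (\<omega> m * complex_of_real y')" by simp
    then have "y = y'" using y n by (simp add: norm_mult)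
    then have "\<omega> l = \<omega> m" using e y by simp
    have rng: "- pi < pi * i / k \<and> pi * i / k \<le> pi" if "i < 3" for i :: nat
    proof -
      have "pi * i \<le> pi * k" using that assms(1) by simp
      then have "pi * i / k \<le> pi" using assms(1) by (simp add: divide_le_eq)
      moreover have "0 \<le> pi * i / k" by simp
      ultimately show ?thesis using pi_gt_zero by linarith
    qed
    have "pi * l / k = pi * m / k"
    proof -
      have "Arg (\<omega> i) = pi * i / k" if "i < 3" for i
        unfolding \<omega>_def using rng[OF that] by (intro Arg_cis) simp
      then show ?thesis using \<open>\<omega> l = \<omega> m\<close> lm(1,2) by metis
    qed
    then show False using lm assms(1) by (simp add: field_simps)
  qed
  have dich: "(\<forall>x\<in>G ` A l. G z0 < x) \<or> (\<forall>x\<in>G ` A l. x < G z0)" for l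
    using conGA[of l] np[of _ l] unfolding connected_iff_interval
    by (metis linorder_cases less_imp_le)
  have ne: "G ` A l \<noteq> {}" for l using s by (simp add: A_def)
  have meet: "G ` A l \<inter> G ` A m = {}" if "l < 3" "m < 3" "l \<noteq> m" for l m
    using disj[OF that] AB sub injG by (metis image_empty inj_on_image_Int order_trans)
  have right: False if "l < 3" "m < 3" "l \<noteq> m" "\<forall>x\<in>G ` A l. G z0 < x" "\<forall>x\<in>G ` A m. G z0 < x" for l m
    using connected_real_sharing_endpoint[OF conGA conGA clos clos ne ne, of l m] meet[OF that(1-3)] that(4,5) by blast
  \<comment> \<open>Reflection in 0 reduces the left side to the right side.\<close>
  have nclos: "- G z0 \<in> closure (uminus ` G ` A l)" for l
  proof -
    have "uminus ` closure (G ` A l) \<subseteq> closure (uminus ` G ` A l)"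
      by (rule image_closure_subset[OF _ closed_closure closure_subset]) (intro continuous_intros)
    then show ?thesis using clos[of l] by blast
  qed
  have left: False if "l < 3" "m < 3" "l \<noteq> m" "\<forall>x\<in>G ` A l. x < G z0" "\<forall>x\<in>G ` A m. x < G z0" for l m
  proof -
    have "uminus ` G ` A l \<inter> uminus ` G ` A m \<noteq> {}"
      by (rule connected_real_sharing_endpoint[where p = "- G z0"])
        (use that(4,5) ne in \<open>auto intro!: connected_continuous_image continuous_intros conGA nclos\<close>)
    then show False using meet[OF that(1-3)] by auto
  qed
  show False using dich[of 0] dich[of 1] dich[of 2] left[of 0 1] left[of 0 2] left[of 1 2]
     right[of 0 1] right[of 0 2] right[of 1 2] by force
qed

section \<open>Corners formed by two perpendicular arms\<close>

definition arms :: "complex \<Rightarrow> complex \<Rightarrow> real \<Rightarrow> complex set" where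
  "arms \<alpha> \<beta> r = (\<lambda>y. \<alpha> * complex_of_real y) ` {0..<r} \<union> (\<lambda>y. \<beta> * complex_of_real y) ` {0..<r}"

text \<open>In the chart the arms lie in a closed quarter plane with apex 0. A derivative E of the
  chart image satisfies Re(E cnj \<eta>) >= 0 from the right and <= 0 from the left for both edge
  directions \<eta>, hence E = 0.\<close>

lemma (in power_chart) not_differentiable_arms:
  assumes "cmod \<alpha> = 1" "cmod \<beta> = 1" "Re (\<alpha> * cnj \<beta>) = 0"
    and C: "C \<inter> U = \<psi> ` arms \<alpha> \<beta> r"
  shows "\<not> differentiable_curve_at C z0"
proof
  assume "differentiable_curve_at C z0"
  then obtain U0 \<gamma> \<delta> D where g: "\<gamma> (0::real) = z0" "homeomorphism {-1<..<1} (C \<inter> U0) \<gamma> \<delta>"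
    "D \<noteq> 0" "(\<gamma> has_vector_derivative D) (at 0)"
    unfolding differentiable_curve_at_def by blast
  have armp: "Re (w * cnj \<alpha>) \<ge> 0 \<and> Re (w * cnj \<beta>) \<ge> 0" if "w \<in> arms \<alpha> \<beta> r" for w
  proof -
    have "Re (\<beta> * cnj \<alpha>) = 0" using assms(3) by (simp add: algebra_simps)
    moreover have "Re (\<alpha> * of_real y * cnj \<alpha>) = y" "Re (\<beta> * of_real y * cnj \<beta>) = y" for y
      using assms(1,2) complex_norm_square[of \<alpha>] complex_norm_square[of \<beta>]
      by (metis Re_complex_of_real mult.commute mult.left_commute mult_1_right of_real_1 one_power2)+
    moreover have "Re (\<alpha> * of_real y * cnj \<beta>) = y * Re (\<alpha> * cnj \<beta>)" "Re (\<beta> * of_real y * cnj \<alpha>) = y * Re (\<beta> * cnj \<alpha>)" for y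
      by (simp_all add: algebra_simps)
    ultimately show ?thesis using that assms(3) by (auto simp: arms_def)
  qed
  define w where "w = (\<lambda>s. \<phi> (\<gamma> s))"
  define E where "E = D * deriv \<phi> z0"
  have "(\<phi> has_field_derivative deriv \<phi> z0) (at (\<gamma> 0))"
    unfolding g using hol_\<phi> open_U z0_in by (intro holomorphic_derivI[of _ U]) auto
  then have wd: "(w has_vector_derivative E) (at 0)"
    using field_vector_diff_chain_at[OF g(4)] unfolding w_def E_def o_def by blast
  have w0: "w 0 = 0" by (simp add: w_def g \<phi>_z0)
  have lim: "((\<lambda>s. w s /\<^sub>R s) \<longlongrightarrow> E) (at 0)"
  proof -
    have "((\<lambda>h. norm (w h - h *\<^sub>R E) / norm h) \<longlongrightarrow> 0) (at 0)"
      using wd w0 by (simp add: has_vector_derivative_def has_derivative_at)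
    moreover have "\<forall>\<^sub>F h in at 0. norm (w h - h *\<^sub>R E) / norm h = norm (w h /\<^sub>R h - E)"
    proof -
      have "norm (w h - h *\<^sub>R E) / norm h = norm (w h /\<^sub>R h - E)" if "h \<noteq> 0" for h
      proof -
        have "w h /\<^sub>R h - E = (w h - h *\<^sub>R E) /\<^sub>R h" using that by (simp add: algebra_simps)
        then show ?thesis by (simp add: divide_inverse mult.commute)
      qed
      then show ?thesis by (auto simp: eventually_at_filter)
    qed
    ultimately have "((\<lambda>h. norm (w h /\<^sub>R h - E)) \<longlongrightarrow> 0) (at 0)"
      by (rule Lim_transform_eventually)
    then show ?thesis by (simp add: Lim_null[of _ E] tendsto_norm_zero_iff)
  qed
  have "isCont \<gamma> 0" using g(4) by (rule has_vector_derivative_continuous)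
  then have "\<forall>\<^sub>F s in at 0. \<gamma> s \<in> U"
    using open_U z0_in g(1) by (auto simp: isCont_def intro: topological_tendstoD)
  moreover have "\<forall>\<^sub>F s in at 0. s \<in> {-1<..<1::real}" by (rule eventually_at_in_open') auto
  ultimately have ev: "\<forall>\<^sub>F s in at 0. w s \<in> arms \<alpha> \<beta> r"
  proof eventually_elim
    case (elim s)
    have "\<gamma> s \<in> C \<inter> U" using g(2) elim by (auto simp: homeomorphism_def)
    then obtain x where x: "x \<in> arms \<alpha> \<beta> r" "\<gamma> s = \<psi> x" using C by blast
    have "x \<in> ball 0 r" using x assms by (auto simp: arms_def norm_mult)
    then show ?case using x by (simp add: w_def \<phi>\<psi>)
  qed
  have "Re (E * cnj \<eta>) = 0" if "\<eta> \<in> {\<alpha>, \<beta>}" for \<eta>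
  proof -
    have lim': "((\<lambda>s. Re ((w s /\<^sub>R s) * cnj \<eta>)) \<longlongrightarrow> Re (E * cnj \<eta>)) (at 0)"
      by (intro tendsto_intros lim)
    have nn: "\<forall>\<^sub>F s in at 0. Re (w s * cnj \<eta>) \<ge> 0" using ev by eventually_elim (use armp that in auto)
    have 1: "0 \<le> Re (E * cnj \<eta>)"
    proof (rule tendsto_lowerbound[OF tendsto_within_subset[OF lim', of "{0<..}"]])
      show "\<forall>\<^sub>F s in at_right 0. 0 \<le> Re ((w s /\<^sub>R s) * cnj \<eta>)"
      proof -
        have "\<forall>\<^sub>F s in at_right 0. (0::real) < s" by (rule eventually_at_right_less)
        moreover have "\<forall>\<^sub>F s in at_right 0. Re (w s * cnj \<eta>) \<ge> 0"
          by (rule filter_leD[OF at_le nn]) simp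
        ultimately show ?thesis
        by eventually_elim (auto simp: scaleR_conv_of_real mult.assoc simp flip: of_real_inverse)
      qed
    qed auto
    have 2: "Re (E * cnj \<eta>) \<le> 0"
    proof (rule tendsto_upperbound[OF tendsto_within_subset[OF lim', of "{..<0}"]])
      show "\<forall>\<^sub>F s in at_left 0. Re ((w s /\<^sub>R s) * cnj \<eta>) \<le> 0"
      proof -
        have "\<forall>\<^sub>F s in at_left 0. s < (0::real)" by (simp add: eventually_at_filter)
        moreover have "\<forall>\<^sub>F s in at_left 0. Re (w s * cnj \<eta>) \<ge> 0"
          by (rule filter_leD[OF at_le nn]) simp
        ultimately show ?thesis
        by eventually_elim (auto simp: scaleR_conv_of_real mult.assoc mult_nonpos_nonneg simp flip: of_real_inverse)
      qed
    qed auto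
    show ?thesis using 1 2 by simp
  qed
  then have "Re (E * cnj \<alpha>) = 0" "Re (E * cnj \<beta>) = 0" by auto
  note RE = this
  \<comment> \<open>Both factors are purely imaginary, so the product is real; it is also |E|^2
    times a nonzero imaginary number, which forces E = 0.\<close>
  have "Im ((E * cnj \<alpha>) * cnj (E * cnj \<beta>)) = 0" using RE by simp
  moreover have "(E * cnj \<alpha>) * cnj (E * cnj \<beta>) = complex_of_real ((cmod E)\<^sup>2) * (\<beta> * cnj \<alpha>)"
  proof -
    have "(E * cnj \<alpha>) * cnj (E * cnj \<beta>) = (E * cnj E) * (\<beta> * cnj \<alpha>)" by (simp add: mult_ac)
    then show ?thesis by (simp only: complex_norm_square)
  qed
  moreover have "Im (\<beta> * cnj \<alpha>) \<noteq> 0"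
  proof
    assume "Im (\<beta> * cnj \<alpha>) = 0"
    moreover have "Re (\<beta> * cnj \<alpha>) = 0" using assms(3) by (simp add: algebra_simps)
    ultimately have "\<beta> * cnj \<alpha> = 0" by (simp add: complex_eq_iff)
    then show False using assms(1,2) by auto
  qed
  moreover have "Im (complex_of_real c * Z) = c * Im Z" for c Z by simp
  ultimately have "(cmod E)\<^sup>2 = 0" by (metis mult_eq_0_iff)
  then have "E = 0" by simp
  then show False using g(3) deriv_\<phi>_nonzero by (simp add: E_def)
qed

text \<open>The chart rotates the arms by the argument of \<psi>'(0). A corner asks for one-sided
  derivatives of length 1 on the parameter interval (-1, 1), so speed and length of the
  parametrization have to be adjusted together.\<close>

lemma (in power_chart) corner_arms:
  assumes nab: "cmod \<alpha> = 1" "cmod \<beta> = 1" and orth: "Re (\<alpha> * cnj \<beta>) = 0"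
    and C: "C \<inter> U = \<psi> ` arms \<alpha> \<beta> r"
  shows "corner_at C z0 (\<alpha> * sgn (deriv \<psi> 0)) (\<beta> * sgn (deriv \<psi> 0))"
proof -
  \<comment> \<open>\<kappa> cancels the factor |\<psi>'(0)| in the speed; the bound s < \<kappa>
    makes the constant \<open>M\<close> below positive.\<close>
  define \<kappa> where "\<kappa> = 1 / cmod (deriv \<psi> 0)"
  have \<kappa>: "\<kappa> > 0" by (simp add: \<kappa>_def deriv_\<psi>_nonzero)
  define s where "s = min r (\<kappa> / 2)"
  have s: "0 < s" "s \<le> r" "s < \<kappa>" using r_pos \<kappa> by (auto simp: s_def)
  interpret c: power_chart f z0 k s "\<psi> ` ball 0 s" \<phi> \<psi> by (rule restrict[OF s(1,2)])
  have armsub: "arms \<alpha> \<beta> s \<subseteq> ball 0 s" using nab by (auto simp: arms_def norm_mult)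
  have armmem: "w \<in> arms \<alpha> \<beta> s \<longleftrightarrow> w \<in> ball 0 s \<and> w \<in> arms \<alpha> \<beta> r" for w
    using nab s by (auto simp: arms_def norm_mult)
  have Cs: "C \<inter> \<psi> ` ball 0 s = \<psi> ` arms \<alpha> \<beta> s"
  proof -
    have "arms \<alpha> \<beta> r \<subseteq> ball 0 r" using nab by (auto simp: arms_def norm_mult)
    then have "C \<inter> \<psi> ` ball 0 s = \<psi> ` (arms \<alpha> \<beta> r) \<inter> \<psi> ` ball 0 s"
    proof -
      have "\<psi> ` ball 0 s \<subseteq> U" using image_ball[OF s(1,2)] by blast
      then show ?thesis using C by blast
    qed
    also have "\<dots> = \<psi> ` (arms \<alpha> \<beta> r \<inter> ball 0 s)"
      using \<open>arms \<alpha> \<beta> r \<subseteq> ball 0 r\<close> s inj_\<psi> by (intro inj_on_image_Int[of _ "ball 0 r", symmetric]) (auto simp: inj_on_def)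
    also have "arms \<alpha> \<beta> r \<inter> ball 0 s = arms \<alpha> \<beta> s" using armmem by blast
    finally show ?thesis .
  qed
  \<comment> \<open>A Moebius map on each half: \<open>\<tau>\<close> has slope \<kappa> at 0 and
    reaches s at 1, since \<kappa> / (1 + M) = s; \<open>\<tau>i\<close> is its inverse.\<close>
  define M where "M = \<kappa> / s - 1"
  have M: "M > 0" using s by (simp add: M_def field_simps)
  define \<tau> where "\<tau> = (\<lambda>t::real. \<kappa> * t / (1 + M * \<bar>t\<bar>))"
  define \<tau>i where "\<tau>i = (\<lambda>y::real. y / (\<kappa> - M * \<bar>y\<bar>))"
  have d1: "1 + M * \<bar>t\<bar> > 0" for t using M by (simp add: add_pos_nonneg)
  have Ms: "M * s = \<kappa> - s" using s by (simp add: M_def field_simps)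
  have d2: "\<kappa> - M * \<bar>y\<bar> > 0" if "\<bar>y\<bar> < s" for y
    using mult_strict_left_mono[OF that M] Ms s by linarith
  have \<tau>_less: "\<bar>\<tau> t\<bar> < s" if "\<bar>t\<bar> < 1" for t
  proof -
    have "\<kappa> * \<bar>t\<bar> < s * (1 + M * \<bar>t\<bar>)"
    proof -
      have "s * (1 + M * \<bar>t\<bar>) - \<kappa> * \<bar>t\<bar> = s * (1 - \<bar>t\<bar>)"
        using arg_cong[OF Ms, of "\<lambda>x. x * \<bar>t\<bar>"] by (simp add: algebra_simps)
      moreover have "s * (1 - \<bar>t\<bar>) > 0" using s that by simp
      ultimately show ?thesis by linarith
    qed
    then show ?thesis using d1[of t] \<kappa> by (simp add: \<tau>_def abs_mult field_simps)
  qed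
  have \<tau>i_less: "\<bar>\<tau>i y\<bar> < 1" if "\<bar>y\<bar> < s" for y
  proof -
    have "\<kappa> - M * \<bar>y\<bar> - \<bar>y\<bar> = (s - \<bar>y\<bar>) * \<kappa> / s" using s by (simp add: M_def field_simps)
    moreover have "\<dots> > 0" using s that \<kappa> by simp
    ultimately show ?thesis using d2[OF that] by (simp add: \<tau>i_def field_simps)
  qed
  have inv1: "\<tau>i (\<tau> t) = t" for t
  proof -
    have a: "\<bar>\<tau> t\<bar> = \<kappa> * \<bar>t\<bar> / (1 + M * \<bar>t\<bar>)" using d1[of t] \<kappa> by (simp add: \<tau>_def abs_mult)
    have "\<kappa> - M * \<bar>\<tau> t\<bar> = \<kappa> / (1 + M * \<bar>t\<bar>)"
      unfolding a using d1[of t] by (simp add: field_simps)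
    then show ?thesis using \<kappa> d1[of t] by (simp add: \<tau>i_def \<tau>_def)
  qed
  have inv2: "\<tau> (\<tau>i y) = y" if "\<bar>y\<bar> < s" for y
  proof -
    have a: "\<bar>\<tau>i y\<bar> = \<bar>y\<bar> / (\<kappa> - M * \<bar>y\<bar>)" using d2[OF that] by (simp add: \<tau>i_def)
    have "1 + M * \<bar>\<tau>i y\<bar> = \<kappa> / (\<kappa> - M * \<bar>y\<bar>)"
      unfolding a using d2[OF that] by (simp add: field_simps)
    then show ?thesis using \<kappa> d2[OF that] by (simp add: \<tau>i_def \<tau>_def)
  qed
  \<comment> \<open>Negative parameters run on the arm \<alpha>, positive ones on \<beta>; the
    functional \<open>l\<close> recovers the parameter because the directions are
    orthonormal.\<close>
  define \<eta> where "\<eta> = (\<lambda>y. \<alpha> * complex_of_real (max (- y) 0) + \<beta> * complex_of_real (max y 0))"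
  define l where "l = (\<lambda>w. Re (w * cnj \<beta>) - Re (w * cnj \<alpha>))"
  have l\<eta>: "l (\<eta> y) = y" for y
  proof -
    have 1: "Re (\<alpha> * cnj \<alpha>) = 1" "Re (\<beta> * cnj \<beta>) = 1"
      using nab complex_norm_square[of \<alpha>] complex_norm_square[of \<beta>] by (metis Re_complex_of_real one_power2)+
    have "l (\<eta> y) = max (- y) 0 * Re (\<alpha> * cnj \<beta>) + max y 0 * Re (\<beta> * cnj \<beta>)
        - (max (- y) 0 * Re (\<alpha> * cnj \<alpha>) + max y 0 * Re (\<alpha> * cnj \<beta>))"
      by (simp add: l_def \<eta>_def algebra_simps)
    then show ?thesis unfolding 1 orth by (simp add: max_def)
  qed
  have \<eta>_arms: "\<eta> y \<in> arms \<alpha> \<beta> s" if "\<bar>y\<bar> < s" for y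
  proof (cases "y \<ge> 0")
    case True
    then show ?thesis using that by (auto simp: \<eta>_def arms_def max_def)
  next
    case False
    then have "\<eta> y = \<alpha> * complex_of_real (- y)" "- y \<in> {0..<s}" using that by (auto simp: \<eta>_def max_def)
    then show ?thesis unfolding arms_def by blast
  qed
  have arms_\<eta>: "\<exists>y. \<bar>y\<bar> < s \<and> w = \<eta> y" if "w \<in> arms \<alpha> \<beta> s" for w
  proof -
    obtain y0 where "y0 \<in> {0..<s}" "w = \<alpha> * complex_of_real y0 \<or> w = \<beta> * complex_of_real y0"
      using \<open>w \<in> _\<close> unfolding arms_def by blast
    then consider y where "w = \<alpha> * complex_of_real y" "0 \<le> y" "y < s" | y where "w = \<beta> * complex_of_real y" "0 \<le> y" "y < s"
      by force
    then show ?thesis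
    proof cases
      case (1 y)
      then show ?thesis by (intro exI[of _ "- y"]) (simp add: \<eta>_def max_def)
    next
      case (2 y)
      then show ?thesis by (intro exI[of _ y]) (simp add: \<eta>_def max_def)
    qed
  qed
  define \<gamma> where "\<gamma> = (\<lambda>t. \<psi> (\<eta> (\<tau> t)))"
  define \<delta> where "\<delta> = (\<lambda>z. \<tau>i (l (\<phi> z)))"
  have in_s: "\<eta> (\<tau> t) \<in> ball 0 s" if "\<bar>t\<bar> < 1" for t
    using \<eta>_arms[OF \<tau>_less[OF that]] armsub by blast
  have hom: "homeomorphism {-1<..<1} (C \<inter> \<psi> ` ball 0 s) \<gamma> \<delta>"
  proof (rule homeomorphismI)
    have "continuous_on {-1<..<1} (\<lambda>t. \<eta> (\<tau> t))"
      unfolding \<eta>_def \<tau>_def using d1 by (intro continuous_intros) (metis less_irrefl)+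
    then show "continuous_on {-1<..<1} \<gamma>" unfolding \<gamma>_def
      by (rule continuous_on_compose2[OF holomorphic_on_imp_continuous_on[OF c.hol_\<psi>]])
        (use in_s in \<open>auto simp: abs_less_iff\<close>)
    have lphi: "\<bar>l (\<phi> z)\<bar> < s" if "z \<in> C \<inter> \<psi> ` ball 0 s" for z
    proof -
      obtain w where w: "w \<in> arms \<alpha> \<beta> s" "z = \<psi> w" using \<open>z \<in> _\<close> Cs by blast
      then show ?thesis using arms_\<eta>[OF w(1)] l\<eta> c.\<phi>\<psi> armsub by auto
    qed
    show "continuous_on (C \<inter> \<psi> ` ball 0 s) \<delta>" unfolding \<delta>_def \<tau>i_def l_def
      using d2 lphi unfolding l_def
      by (intro continuous_intros continuous_on_subset[OF holomorphic_on_imp_continuous_on[OF c.hol_\<phi>]])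
         (auto simp: less_irrefl dest: d2)
    show "\<gamma> ` {-1<..<1} \<subseteq> C \<inter> \<psi> ` ball 0 s"
      unfolding Cs \<gamma>_def using \<eta>_arms[OF \<tau>_less] by (auto simp: abs_less_iff)
    show "\<delta> ` (C \<inter> \<psi> ` ball 0 s) \<subseteq> {-1<..<1}"
      using \<tau>i_less[OF lphi] by (auto simp: \<delta>_def abs_less_iff)
    show "\<delta> (\<gamma> t) = t" if "t \<in> {-1<..<1}" for t
      using that c.\<phi>\<psi>[OF in_s] by (simp add: \<delta>_def \<gamma>_def abs_less_iff l\<eta> inv1)
    show "\<gamma> (\<delta> z) = z" if "z \<in> C \<inter> \<psi> ` ball 0 s" for z
    proof -
      obtain w where w: "w \<in> arms \<alpha> \<beta> s" "z = \<psi> w" using \<open>z \<in> _\<close> Cs by blast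
      obtain y where y: "\<bar>y\<bar> < s" "w = \<eta> y" using arms_\<eta>[OF w(1)] by blast
      have "\<phi> z = \<eta> y" using w y c.\<phi>\<psi> armsub by auto
      then show ?thesis using y w by (simp add: \<delta>_def \<gamma>_def l\<eta> inv2)
    qed
  qed
  \<comment> \<open>Holomorphic extensions of the two halves: with -t or t for |t| the formula for
    \<open>\<gamma>\<close> becomes analytic, whence the parameters (-\<alpha>, -M) and (\<beta>,
    M).\<close>
  define H where "H = (\<lambda>\<epsilon> m (\<zeta>::complex). \<psi> (\<epsilon> * complex_of_real \<kappa> * \<zeta> / (1 + complex_of_real m * \<zeta>)))"
  define V where "V = (\<lambda>\<epsilon> m. {\<zeta>. 1 + complex_of_real m * \<zeta> \<noteq> 0} \<inter>
       (\<lambda>\<zeta>. \<epsilon> * complex_of_real \<kappa> * \<zeta> / (1 + complex_of_real m * \<zeta>)) -` ball 0 s)"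
  have oV: "open (V \<epsilon> m)" for \<epsilon> m unfolding V_def
    by (intro continuous_open_preimage continuous_intros open_Collect_neq) auto
  have hH: "H \<epsilon> m holomorphic_on V \<epsilon> m" for \<epsilon> m unfolding H_def V_def
    by (rule holomorphic_on_compose_gen[OF _ c.hol_\<psi>, unfolded o_def]) (auto intro!: holomorphic_intros)
  have argL: "\<eta> (\<tau> t) = (- \<alpha>) * complex_of_real \<kappa> * complex_of_real t / (1 + complex_of_real (- M) * complex_of_real t)"
    if "t \<le> 0" for t
  proof -
    have "\<tau> t \<le> 0" using that \<kappa> d1[of t] by (simp add: \<tau>_def divide_nonpos_pos mult_nonneg_nonpos)
    then have "\<eta> (\<tau> t) = - \<alpha> * complex_of_real (\<tau> t)" by (simp add: \<eta>_def max_def)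
    then show ?thesis using that by (simp add: \<tau>_def)
  qed
  have argR: "\<eta> (\<tau> t) = \<beta> * complex_of_real \<kappa> * complex_of_real t / (1 + complex_of_real M * complex_of_real t)"
    if "t \<ge> 0" for t
  proof -
    have "\<tau> t \<ge> 0" using that \<kappa> d1[of t] by (simp add: \<tau>_def)
    then have "\<eta> (\<tau> t) = \<beta> * complex_of_real (\<tau> t)" by (simp add: \<eta>_def max_def)
    then show ?thesis using that by (simp add: \<tau>_def)
  qed
  have nzL: "1 + complex_of_real (- M) * complex_of_real t \<noteq> 0" if "t \<le> 0" for t
  proof -
    have "1 + complex_of_real (- M) * complex_of_real t = complex_of_real (1 + M * \<bar>t\<bar>)" using that by simp
    then show ?thesis using d1[of t] by (metis less_irrefl of_real_eq_0_iff)
  qed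
  have nzR: "1 + complex_of_real M * complex_of_real t \<noteq> 0" if "t \<ge> 0" for t
  proof -
    have "1 + complex_of_real M * complex_of_real t = complex_of_real (1 + M * \<bar>t\<bar>)" using that by simp
    then show ?thesis using d1[of t] by (metis less_irrefl of_real_eq_0_iff)
  qed
  have gL: "\<gamma> t = H (- \<alpha>) (- M) (complex_of_real t)" if "t \<le> 0" for t
    unfolding \<gamma>_def H_def argL[OF that] by simp
  have gR: "\<gamma> t = H \<beta> M (complex_of_real t)" if "t \<ge> 0" for t
    unfolding \<gamma>_def H_def argR[OF that] by simp
  have smL: "smooth_on {-1<..0} \<gamma>"
  proof (rule smooth_on_realI)
    fix x :: real assume x: "x \<in> {-1<..0}"
    then have "complex_of_real x \<in> V (- \<alpha>) (- M)"
      using in_s[of x] argL[of x] nzL[of x] by (auto simp: V_def)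
    then show "\<exists>V f. open V \<and> complex_of_real x \<in> V \<and> f holomorphic_on V \<and>
       (\<forall>y\<in>{-1<..0}. complex_of_real y \<in> V \<longrightarrow> f (complex_of_real y) = \<gamma> y)"
      using oV hH gL by (intro exI[of _ "V (- \<alpha>) (- M)"] exI[of _ "H (- \<alpha>) (- M)"]) auto
  qed
  have smR: "smooth_on {0..<1} \<gamma>"
  proof (rule smooth_on_realI)
    fix x :: real assume x: "x \<in> {0..<1}"
    then have "complex_of_real x \<in> V \<beta> M"
      using in_s[of x] argR[of x] nzR[of x] by (auto simp: V_def)
    then show "\<exists>V f. open V \<and> complex_of_real x \<in> V \<and> f holomorphic_on V \<and>
       (\<forall>y\<in>{0..<1}. complex_of_real y \<in> V \<longrightarrow> f (complex_of_real y) = \<gamma> y)"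
      using oV hH gR by (intro exI[of _ "V \<beta> M"] exI[of _ "H \<beta> M"]) auto
  qed
  have dH: "((\<lambda>t. H \<epsilon> m (complex_of_real t)) has_vector_derivative \<epsilon> * sgn (deriv \<psi> 0)) (at 0)" for \<epsilon> m
  proof -
    have d: "(\<psi> has_field_derivative deriv \<psi> 0) (at (\<epsilon> * complex_of_real \<kappa> * 0 / (1 + complex_of_real m * 0)))"
      using hol_\<psi> r_pos by (auto intro!: holomorphic_derivI[of _ "ball 0 r"])
    have d': "((\<lambda>\<zeta>. \<epsilon> * complex_of_real \<kappa> * \<zeta> / (1 + complex_of_real m * \<zeta>)) has_field_derivative \<epsilon> * complex_of_real \<kappa>) (at 0)"
      by (auto intro!: derivative_eq_intros)
    have "(H \<epsilon> m has_field_derivative deriv \<psi> 0 * (\<epsilon> * complex_of_real \<kappa>)) (at (complex_of_real 0))"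
      unfolding H_def using DERIV_chain2[OF d d'] by simp
    moreover have "deriv \<psi> 0 * (\<epsilon> * complex_of_real \<kappa>) = \<epsilon> * sgn (deriv \<psi> 0)"
      by (simp add: \<kappa>_def sgn_div_norm scaleR_conv_of_real field_simps)
    ultimately have "(H \<epsilon> m has_field_derivative \<epsilon> * sgn (deriv \<psi> 0)) (at (complex_of_real 0))" by simp
    moreover have "(complex_of_real has_vector_derivative 1) (at 0)"
      using has_vector_derivative_of_real[OF DERIV_ident] by auto
    ultimately show ?thesis
      using field_vector_diff_chain_at[of complex_of_real 1 0] by (simp add: o_def)
  qed
  have "(\<gamma> has_vector_derivative - \<alpha> * sgn (deriv \<psi> 0)) (at 0 within {..0})"
    by (rule has_vector_derivative_transform_within[OF has_vector_derivative_at_within[OF dH, of "- \<alpha>" "- M"] zero_less_one_class.zero_less_one])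
      (simp_all add: gL)
  then have "(\<gamma> has_vector_derivative - (\<alpha> * sgn (deriv \<psi> 0))) (at_left 0)"
    by (intro has_vector_derivative_within_subset[of \<gamma> _ 0 "{..0}" "{..<0}"]) auto
  moreover have "(\<gamma> has_vector_derivative \<beta> * sgn (deriv \<psi> 0)) (at 0 within {0..})"
    by (rule has_vector_derivative_transform_within[OF has_vector_derivative_at_within[OF dH, of "\<beta>" "M"] zero_less_one_class.zero_less_one])
      (simp_all add: gR)
  then have "(\<gamma> has_vector_derivative \<beta> * sgn (deriv \<psi> 0)) (at_right 0)"
    by (intro has_vector_derivative_within_subset[of \<gamma> _ 0 "{0..}" "{0<..}"]) auto
  moreover have "cmod (sgn (deriv \<psi> 0)) = 1" using deriv_\<psi>_nonzero by (simp add: norm_sgn)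
  moreover have "\<gamma> 0 = z0" using gR[of 0] \<psi>_0 by (simp add: H_def)
  ultimately show ?thesis unfolding corner_at_def
    using nab hom smL smR c.open_U c.z0_in by (intro conjI exI[of _ "\<psi> ` ball 0 s"] exI[of _ \<gamma>] exI[of _ \<delta>]) (simp_all add: norm_mult)
qed

section \<open>Cycles of permutations\<close>

definition cycle_of :: "('a \<Rightarrow> 'a) \<Rightarrow> 'a \<Rightarrow> 'a set" where
  "cycle_of \<sigma> j = range (\<lambda>n. (\<sigma> ^^ n) j)"

lemma self_in_cycle_of: "j \<in> cycle_of \<sigma> j"
  unfolding cycle_of_def by (rule image_eqI[of _ _ 0]) simp_all

lemma cycle_of_closed:
  assumes "k \<in> cycle_of \<sigma> j"
  shows "\<sigma> k \<in> cycle_of \<sigma> j"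
proof -
  obtain n where "k = (\<sigma> ^^ n) j" using assms by (auto simp: cycle_of_def)
  then show ?thesis unfolding cycle_of_def by (intro image_eqI[of _ _ "Suc n"]) simp_all
qed

lemma cycle_of_least:
  assumes "j \<in> B" "\<And>k. k \<in> B \<Longrightarrow> \<sigma> k \<in> B"
  shows "cycle_of \<sigma> j \<subseteq> B"
proof -
  have "(\<sigma> ^^ n) j \<in> B" for n by (induction n) (use assms in auto)
  then show ?thesis by (auto simp: cycle_of_def)
qed

lemma cycle_of_subset: "\<sigma> permutes A \<Longrightarrow> j \<in> A \<Longrightarrow> cycle_of \<sigma> j \<subseteq> A"
  by (rule cycle_of_least) (auto simp: permutes_in_image)

lemma permutes_funpow_id:
  assumes "\<sigma> permutes A" "finite A"
  obtains n where "n > 0" "\<sigma> ^^ n = id"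
  using permutation_is_nilpotent[of \<sigma>] assms permutation_permutes by blast

text \<open>Some positive power of a permutation of a finite set is the identity, so backward steps
  are forward powers and belonging to a forward orbit is symmetric.\<close>

lemma cycle_of_eq:
  assumes "\<sigma> permutes A" "finite A" "k \<in> cycle_of \<sigma> j"
  shows "cycle_of \<sigma> k = cycle_of \<sigma> j"
proof
  show "cycle_of \<sigma> k \<subseteq> cycle_of \<sigma> j"
    by (rule cycle_of_least[OF assms(3)]) (rule cycle_of_closed)
  obtain n where n: "n > 0" "\<sigma> ^^ n = id" using permutes_funpow_id[OF assms(1,2)] .
  obtain m where m: "k = (\<sigma> ^^ m) j" using assms(3) by (auto simp: cycle_of_def)
  have "\<sigma> ^^ (n * m) = (\<sigma> ^^ n) ^^ m" by (simp add: funpow_mult mult.commute)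
  then have "(\<sigma> ^^ (n * m)) j = j" by (simp add: n(2) id_funpow)
  moreover have "n * m - m + m = n * m" using n by simp
  ultimately have "(\<sigma> ^^ (n * m - m)) k = j" unfolding m by (metis comp_apply funpow_add)
  then have "j \<in> cycle_of \<sigma> k" unfolding cycle_of_def by auto
  then show "cycle_of \<sigma> j \<subseteq> cycle_of \<sigma> k"
    by (rule cycle_of_least) (rule cycle_of_closed)
qed

lemma cycle_of_period:
  assumes "\<sigma> permutes A" "finite A"
  obtains L where "L > 0" "(\<sigma> ^^ L) j = j" "inj_on (\<lambda>n. (\<sigma> ^^ n) j) {..<L}"
    "cycle_of \<sigma> j = (\<lambda>n. (\<sigma> ^^ n) j) ` {..<L}"
proof -
  obtain n where n: "n > 0" "\<sigma> ^^ n = id" using permutes_funpow_id[OF assms] .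
  define L where "L = (LEAST n. n > 0 \<and> (\<sigma> ^^ n) j = j)"
  have "n > 0 \<and> (\<sigma> ^^ n) j = j" using n by simp
  then have L: "L > 0 \<and> (\<sigma> ^^ L) j = j" unfolding L_def by (rule LeastI)
  have bij: "inj (\<sigma> ^^ m)" for m using permutes_inj[OF assms(1)] by (simp add: inj_fn)
  have no: "(\<sigma> ^^ m) j \<noteq> (\<sigma> ^^ l) j" if "m < l" "l < L" for m l
  proof
    assume "(\<sigma> ^^ m) j = (\<sigma> ^^ l) j"
    also have "\<dots> = (\<sigma> ^^ m) ((\<sigma> ^^ (l - m)) j)"
      using that by (metis add_diff_inverse_nat comp_apply funpow_add less_imp_not_less)
    finally have "(\<sigma> ^^ (l - m)) j = j" using bij[of m] by (metis injD)
    then have "L \<le> l - m" unfolding L_def using that by (intro Least_le) simp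
    then show False using that by simp
  qed
  have "inj_on (\<lambda>n. (\<sigma> ^^ n) j) {..<L}"
  proof (rule inj_onI)
    fix m l assume "m \<in> {..<L}" "l \<in> {..<L}" "(\<sigma> ^^ m) j = (\<sigma> ^^ l) j"
    then show "m = l" using no[of m l] no[of l m] by (cases m l rule: linorder_cases) auto
  qed
  moreover have "cycle_of \<sigma> j = (\<lambda>n. (\<sigma> ^^ n) j) ` {..<L}"
  proof
    show "cycle_of \<sigma> j \<subseteq> (\<lambda>n. (\<sigma> ^^ n) j) ` {..<L}"
    proof (rule cycle_of_least)
      show "j \<in> (\<lambda>n. (\<sigma> ^^ n) j) ` {..<L}" using L by (intro image_eqI[of _ _ 0]) auto
      fix k assume "k \<in> (\<lambda>n. (\<sigma> ^^ n) j) ` {..<L}"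
      then obtain m where m: "m < L" "k = (\<sigma> ^^ m) j" by auto
      show "\<sigma> k \<in> (\<lambda>n. (\<sigma> ^^ n) j) ` {..<L}"
      proof (cases "Suc m = L")
        case True
        then have "\<sigma> k = j" using m L by (metis comp_apply funpow.simps(2))
        then show ?thesis using L by (intro image_eqI[of _ _ 0]) auto
      next
        case False
        then show ?thesis using m by (intro image_eqI[of _ _ "Suc m"]) auto
      qed
    qed
  qed (auto simp: cycle_of_def)
  ultimately show ?thesis using that L by blast
qed

text \<open>Exchanging the images of two members of a cycle cuts it in two. Every new cycle lies in
  an old one, so new cycles map onto old ones, and the cycles of j and k show that this map is not
  injective.\<close>

lemma card_cycles_transpose:
  assumes \<sigma>: "\<sigma> permutes A" and fin: "finite A" and jk: "j \<in> A" "k \<in> cycle_of \<sigma> j" "j \<noteq> k"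
  shows "card (cycle_of \<sigma> ` A) < card (cycle_of (\<sigma> \<circ> Transposition.transpose j k) ` A)"
proof -
  let ?\<tau> = "\<sigma> \<circ> Transposition.transpose j k"
  have kA: "k \<in> A" using cycle_of_subset[OF \<sigma> jk(1)] jk(2) by blast
  have \<tau>: "?\<tau> permutes A"
    by (rule permutes_compose[OF permutes_swap_id[OF jk(1) kA] \<sigma>])
  obtain L where L: "L > 0" "(\<sigma> ^^ L) j = j" "inj_on (\<lambda>n. (\<sigma> ^^ n) j) {..<L}"
    "cycle_of \<sigma> j = (\<lambda>n. (\<sigma> ^^ n) j) ` {..<L}"
    using cycle_of_period[OF \<sigma> fin] .
  obtain a where a: "a < L" "k = (\<sigma> ^^ a) j" using jk(2) L(4) by auto
  have a0: "a > 0" using a jk(3) by (cases a) auto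
  have ne: "(\<sigma> ^^ i) j \<noteq> (\<sigma> ^^ i') j" if "i < L" "i' < L" "i \<noteq> i'" for i i'
    using inj_onD[OF L(3), of i i'] that by auto
  \<comment> \<open>The new cycle of k stays among \<sigma> j, ..., \<sigma>^a j = k and closes up
    there, because k is now sent to \<sigma> j; it misses j.\<close>
  have "cycle_of ?\<tau> k \<subseteq> (\<lambda>n. (\<sigma> ^^ n) j) ` {1..a}"
  proof (rule cycle_of_least)
    show "k \<in> (\<lambda>n. (\<sigma> ^^ n) j) ` {1..a}" using a a0 by auto
    fix x assume "x \<in> (\<lambda>n. (\<sigma> ^^ n) j) ` {1..a}"
    then obtain i where i: "1 \<le> i" "i \<le> a" "x = (\<sigma> ^^ i) j" by auto
    have xj: "x \<noteq> j" using ne[of i 0] i a L(1) by auto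
    show "?\<tau> x \<in> (\<lambda>n. (\<sigma> ^^ n) j) ` {1..a}"
    proof (cases "i = a")
      case True
      then have "?\<tau> x = \<sigma> j" using i a by simp
      then show ?thesis using a0 by (intro image_eqI[of _ _ 1]) auto
    next
      case False
      then have "x \<noteq> k" using ne[of i a] i a by auto
      then have "?\<tau> x = (\<sigma> ^^ Suc i) j" using xj i by simp
      then show ?thesis using False i by (intro image_eqI[of _ _ "Suc i"]) auto
    qed
  qed
  moreover have "j \<notin> (\<lambda>n. (\<sigma> ^^ n) j) ` {1..a}"
  proof
    assume "j \<in> (\<lambda>n. (\<sigma> ^^ n) j) ` {1..a}"
    then obtain i where "1 \<le> i" "i \<le> a" "(\<sigma> ^^ i) j = (\<sigma> ^^ 0) j" by auto
    then show False using ne[of i 0] a L(1) by auto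
  qed
  ultimately have neq: "cycle_of ?\<tau> j \<noteq> cycle_of ?\<tau> k"
    using self_in_cycle_of[of j ?\<tau>] by blast
  have ck: "cycle_of \<sigma> k = cycle_of \<sigma> j" by (rule cycle_of_eq[OF \<sigma> fin jk(2)])
  have sub: "cycle_of ?\<tau> x \<subseteq> cycle_of \<sigma> x" for x
  proof (rule cycle_of_least[OF self_in_cycle_of])
    fix y assume y: "y \<in> cycle_of \<sigma> x"
    have yy: "cycle_of \<sigma> y = cycle_of \<sigma> x" by (rule cycle_of_eq[OF \<sigma> fin y])
    consider "y = j" | "y = k" | "y \<noteq> j" "y \<noteq> k" by blast
    then show "?\<tau> y \<in> cycle_of \<sigma> x"
    proof cases
      case 1
      then show ?thesis using cycle_of_closed[OF self_in_cycle_of[of k \<sigma>]] ck yy by simp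
    next
      case 2
      then show ?thesis using cycle_of_closed[OF self_in_cycle_of[of j \<sigma>]] ck yy by simp
    next
      case 3
      then show ?thesis using cycle_of_closed[OF y] by simp
    qed
  qed
  define F where "F = (\<lambda>C. cycle_of \<sigma> (SOME y. y \<in> C))"
  have F: "F (cycle_of ?\<tau> x) = cycle_of \<sigma> x" for x
  proof -
    have "(SOME y. y \<in> cycle_of ?\<tau> x) \<in> cycle_of ?\<tau> x"
      by (rule someI[of _ x]) (rule self_in_cycle_of)
    then have "(SOME y. y \<in> cycle_of ?\<tau> x) \<in> cycle_of \<sigma> x" using sub by blast
    then show ?thesis unfolding F_def by (rule cycle_of_eq[OF \<sigma> fin])
  qed
  have im: "F ` cycle_of ?\<tau> ` A = cycle_of \<sigma> ` A" by (simp add: image_image F)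
  have finT: "finite (cycle_of ?\<tau> ` A)" using fin by simp
  have "\<not> inj_on F (cycle_of ?\<tau> ` A)"
  proof
    assume "inj_on F (cycle_of ?\<tau> ` A)"
    moreover have "F (cycle_of ?\<tau> j) = F (cycle_of ?\<tau> k)" by (simp add: F ck)
    ultimately show False using neq jk(1) kA by (meson imageI inj_onD)
  qed
  then have "card (F ` cycle_of ?\<tau> ` A) \<noteq> card (cycle_of ?\<tau> ` A)"
    using finT eq_card_imp_inj_on by blast
  then show ?thesis using card_image_le[OF finT, of F] im by simp
qed

section \<open>Continuous selections of roots\<close>

text \<open>Links multiplicities of roots to exponents of charts: only the exponent equal to the
  order leaves a finite nonzero limit.\<close>

lemma order_eqI_limit:
  fixes p :: "complex poly"
  assumes "p \<noteq> 0" and lim: "((\<lambda>y. poly p y / (y - a) ^ k) \<longlongrightarrow> l) (at a)" and "l \<noteq> 0"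
  shows "order a p = k"
proof -
  define n where "n = order a p"
  obtain q where q: "p = [:- a, 1:] ^ n * q" "\<not> [:- a, 1:] dvd q"
    using order_decomp[OF assms(1), of a] by (auto simp: n_def)
  have qa: "poly q a \<noteq> 0" using q(2) by (simp add: poly_eq_0_iff_dvd)
  have py: "poly p y = (y - a) ^ n * poly q y" for y by (simp add: q(1) algebra_simps)
  have ne: "\<forall>\<^sub>F y in at a. y \<noteq> a" by (simp add: eventually_at_filter)
  have qlim: "(poly q \<longlongrightarrow> poly q a) (at a)" by (rule isContD[OF poly_isCont])
  consider "n < k" | "n > k" | "n = k" by linarith
  then show ?thesis
  proof cases
    case 1
    have "((\<lambda>y. poly p y / (y - a) ^ k * (y - a) ^ (k - n)) \<longlongrightarrow> l * (a - a) ^ (k - n)) (at a)"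
      by (intro tendsto_intros lim)
    moreover have "\<forall>\<^sub>F y in at a. poly p y / (y - a) ^ k * (y - a) ^ (k - n) = poly q y"
      using ne
    proof eventually_elim
      case (elim y)
      have "(y - a) ^ k = (y - a) ^ (k - n) * (y - a) ^ n" using 1 by (simp flip: power_add)
      then show ?case using elim by (simp add: py)
    qed
    ultimately have "(poly q \<longlongrightarrow> l * (a - a) ^ (k - n)) (at a)" by (rule Lim_transform_eventually)
    then have "poly q a = l * (a - a) ^ (k - n)" using qlim by (metis LIM_unique)
    then show ?thesis using qa 1 by (simp add: power_0_left)
  next
    case 2
    have "((\<lambda>y. (y - a) ^ (n - k) * poly q y) \<longlongrightarrow> (a - a) ^ (n - k) * poly q a) (at a)"
      by (intro tendsto_intros qlim)
    moreover have "\<forall>\<^sub>F y in at a. (y - a) ^ (n - k) * poly q y = poly p y / (y - a) ^ k"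
      using ne
    proof eventually_elim
      case (elim y)
      have "(y - a) ^ n = (y - a) ^ (n - k) * (y - a) ^ k" using 2 by (simp flip: power_add)
      then show ?case using elim by (simp add: py)
    qed
    ultimately have "((\<lambda>y. poly p y / (y - a) ^ k) \<longlongrightarrow> (a - a) ^ (n - k) * poly q a) (at a)"
      by (rule Lim_transform_eventually)
    then have "l = (a - a) ^ (n - k) * poly q a" using lim by (metis LIM_unique)
    then show ?thesis using assms(3) 2 by (simp add: power_0_left)
  next
    case 3
    then show ?thesis by (simp add: n_def)
  qed
qed

lemma (in power_chart) order_limit:
  "((\<lambda>y. (f z0 - f y) / (y - z0) ^ k) \<longlongrightarrow> - f z0 * \<i> * deriv \<phi> z0 ^ k) (at z0)"
proof -
  have d': "(\<phi> has_field_derivative deriv \<phi> z0) (at z0)"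
    using hol_\<phi> open_U z0_in by (intro holomorphic_derivI[of _ U]) auto
  then have L1: "((\<lambda>y. \<phi> y / (y - z0)) \<longlongrightarrow> deriv \<phi> z0) (at z0)"
    by (simp add: has_field_derivative_iff \<phi>_z0)
  have "((\<lambda>w. exp (\<i> * w)) has_field_derivative \<i>) (at 0)"
    by (auto intro!: derivative_eq_intros)
  then have L2: "((\<lambda>w. (exp (\<i> * w) - 1) / w) \<longlongrightarrow> \<i>) (at 0)"
    by (simp add: has_field_derivative_iff)
  have evU: "\<forall>\<^sub>F y in at z0. y \<in> U \<and> y \<noteq> z0"
    using eventually_at_in_open[OF open_U z0_in] by simp
  have nz: "\<phi> y \<noteq> 0" if "y \<in> U" "y \<noteq> z0" for y
    using \<psi>\<phi>[OF that(1)] \<psi>_0 that(2) by auto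
  have "(\<phi> \<longlongrightarrow> 0) (at z0)" using DERIV_isCont[OF d'] \<phi>_z0 by (simp add: isCont_def)
  then have "((\<lambda>y. \<phi> y ^ k) \<longlongrightarrow> 0) (at z0)"
    using k_pos tendsto_power[of \<phi> 0 "at z0" k] by (simp add: power_0_left)
  moreover have "\<forall>\<^sub>F y in at z0. \<phi> y ^ k \<noteq> 0" using evU by eventually_elim (use nz in auto)
  ultimately have "filterlim (\<lambda>y. \<phi> y ^ k) (at 0) (at z0)" by (simp add: filterlim_at)
  then have L3: "((\<lambda>y. (exp (\<i> * \<phi> y ^ k) - 1) / \<phi> y ^ k) \<longlongrightarrow> \<i>) (at z0)"
    by (rule filterlim_compose[OF L2])
  have "((\<lambda>y. - f z0 * ((exp (\<i> * \<phi> y ^ k) - 1) / \<phi> y ^ k) * (\<phi> y / (y - z0)) ^ k)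
      \<longlongrightarrow> - f z0 * \<i> * deriv \<phi> z0 ^ k) (at z0)"
    by (intro tendsto_intros L1 L3)
  moreover have "\<forall>\<^sub>F y in at z0. - f z0 * ((exp (\<i> * \<phi> y ^ k) - 1) / \<phi> y ^ k) * (\<phi> y / (y - z0)) ^ k
      = (f z0 - f y) / (y - z0) ^ k"
    using evU
  proof eventually_elim
    case (elim y)
    then have "\<phi> y ^ k \<noteq> 0" using nz by auto
    moreover have "f y = f z0 * exp (\<i> * \<phi> y ^ k)" using f_eq elim by blast
    moreover have "- a * ((E - 1) / p) * (p / q) = (a - a * E) / q" if "p \<noteq> 0" for a E p q :: complex
      using that by (simp add: algebra_simps diff_divide_distrib)
    ultimately show ?case by (simp only: power_divide)
  qed
  ultimately show ?thesis by (rule Lim_transform_eventually)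
qed

context coprime_fraction
begin

definition fibre :: "complex \<Rightarrow> complex poly" where
  "fibre w = smult w P - R"

text \<open>For w \<noteq> 0 the leading term of \<open>P\<close> survives, so all fibres have the
  same number of roots with multiplicity and none escapes to infinity.\<close>

lemma degree_fibre: "w \<noteq> 0 \<Longrightarrow> degree (fibre w) = degree P"
  unfolding fibre_def using deg degree_add_eq_left[of "- R" "smult w P"] by auto

lemma fibre_nonzero: "w \<noteq> 0 \<Longrightarrow> fibre w \<noteq> 0"
proof
  assume w: "w \<noteq> 0" "fibre w = 0"
  then have "degree P = 0" using degree_fibre[of w] by simp
  then have "R = 0" using deg by auto
  moreover have "smult w P - R = 0" using w(2) by (simp only: fibre_def)
  ultimately show False using w(1) P_nonzero by simp
qed

lemma poly_fibre_eq_0: "w \<noteq> 0 \<Longrightarrow> poly (fibre w) z = 0 \<longleftrightarrow> poly P z \<noteq> 0 \<and> ratio z = w"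
  using no_common_root[of z] by (cases "poly P z = 0") (auto simp: fibre_def ratio_def field_simps)

lemma nonconst: assumes "ratio z \<noteq> 0" shows "\<not> (\<forall>\<^sub>F y in at z. ratio y = ratio z)"
proof
  assume "\<forall>\<^sub>F y in at z. ratio y = ratio z"
  moreover have "poly P z \<noteq> 0" using assms by (auto simp: ratio_def)
  then have "\<forall>\<^sub>F y in at z. poly P y \<noteq> 0" using P_nonzero by (simp add: eventually_poly_nonzero)
  moreover have "\<forall>\<^sub>F y in at z. poly (fibre (ratio z)) y \<noteq> 0"
    using fibre_nonzero[OF assms] by (rule eventually_poly_nonzero)
  ultimately have "\<forall>\<^sub>F y in at z. False"
    by eventually_elim (use assms in \<open>auto simp: poly_fibre_eq_0\<close>)
  then show False by simp
qed

text \<open>The exponent of the chart is the multiplicity of z in its fibre: near z the fibre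
  polynomial is \<open>P\<close> times ratio z - ratio y, and \<open>order_limit\<close> gives the
  order of this difference.\<close>

lemma chart_exists:
  assumes "ratio z \<noteq> 0" "open W" "z \<in> W"
  obtains r U \<phi> \<psi> where "power_chart ratio z (order z (fibre (ratio z))) r U \<phi> \<psi>"
    "U \<subseteq> W" "U \<subseteq> {z. poly P z \<noteq> 0}"
proof -
  have Pz: "poly P z \<noteq> 0" using assms by (auto simp: ratio_def)
  let ?W = "W \<inter> {z. poly P z \<noteq> 0}"
  have hol: "ratio holomorphic_on ?W" using ratio_holomorphic by (rule holomorphic_on_subset) auto
  have W: "open ?W" "z \<in> ?W" using assms Pz open_nonpoles by auto
  obtain k r U \<phi> \<psi> where c: "power_chart ratio z k r U \<phi> \<psi>" "U \<subseteq> ?W"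
    using power_chart_exists[OF hol W assms(1) nonconst[OF assms(1)]] .
  interpret power_chart ratio z k r U \<phi> \<psi> by (rule c)
  have "order z (fibre (ratio z)) = k"
  proof (rule order_eqI_limit)
    show "fibre (ratio z) \<noteq> 0" using assms by (simp add: fibre_nonzero)
    have "((\<lambda>y. poly P y * ((ratio z - ratio y) / (y - z) ^ k)) \<longlongrightarrow> poly P z * (- ratio z * \<i> * deriv \<phi> z ^ k)) (at z)"
      by (intro tendsto_intros order_limit isContD[OF poly_isCont])
    moreover have "\<forall>\<^sub>F y in at z. poly P y \<noteq> 0" using P_nonzero by (simp add: eventually_poly_nonzero)
    then have "\<forall>\<^sub>F y in at z. poly P y * ((ratio z - ratio y) / (y - z) ^ k) = poly (fibre (ratio z)) y / (y - z) ^ k"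
      by eventually_elim (simp add: fibre_def ratio_def[of "_"] algebra_simps diff_divide_distrib)
    ultimately show "((\<lambda>y. poly (fibre (ratio z)) y / (y - z) ^ k) \<longlongrightarrow> poly P z * (- ratio z * \<i> * deriv \<phi> z ^ k)) (at z)"
      by (rule Lim_transform_eventually)
    show "poly P z * (- ratio z * \<i> * deriv \<phi> z ^ k) \<noteq> 0"
      using Pz assms(1) deriv_\<phi>_nonzero by simp
  qed
  then show ?thesis using that c by blast
qed

lemma order_fibre_eq_1:
  assumes "ratio z \<noteq> 0"
  shows "order z (fibre (ratio z)) = 1 \<longleftrightarrow> z \<notin> crit"
proof -
  obtain r U \<phi> \<psi> where "power_chart ratio z (order z (fibre (ratio z))) r U \<phi> \<psi>"
    using chart_exists[OF assms open_UNIV UNIV_I] by metis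
  then interpret power_chart ratio z "order z (fibre (ratio z))" r U \<phi> \<psi> .
  have "poly P z \<noteq> 0" using assms by (auto simp: ratio_def)
  then show ?thesis using k_eq_1_iff by (simp add: crit_iff)
qed

end

text \<open>The continuous branches of the \<open>k\<close>-th root on the real line, numbered by \<open>e < k\<close>.\<close>

definition root_branch :: "nat \<Rightarrow> nat \<Rightarrow> real \<Rightarrow> complex" where
  "root_branch k e t = cis (2 * pi * e / k) *
     (complex_of_real (root k (max t 0)) + cis (pi / k) * complex_of_real (root k (max (- t) 0)))"

lemma continuous_on_root_branch: "continuous_on A (root_branch k e)"
  unfolding root_branch_def by (intro continuous_intros)

lemma root_branch_0: "root_branch k e 0 = 0"
  by (simp add: root_branch_def)

lemma root_branch_pos: "t \<ge> 0 \<Longrightarrow> root_branch k e t = cis (2 * pi * e / k) * complex_of_real (root k t)"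
  by (simp add: root_branch_def max_def)

lemma root_branch_neg:
  "t \<le> 0 \<Longrightarrow> root_branch k e t = cis (2 * pi * e / k) * (cis (pi / k) * complex_of_real (root k (- t)))"
  by (simp add: root_branch_def max_def)

lemma root_branch_power: "k > 0 \<Longrightarrow> root_branch k e t ^ k = complex_of_real t"
proof -
  assume k: "k > 0"
  have 1: "cis (2 * pi * e / k) ^ k = 1"
  proof -
    have "cis (2 * pi * e / k) ^ k = cis (2 * pi * e)"
      unfolding Complex.DeMoivre using k by simp
    also have "\<dots> = 1" by (metis cis_multiple_2pi Ints_of_nat)
    finally show ?thesis .
  qed
  have 2: "cis (pi / k) ^ k = - 1"
    unfolding Complex.DeMoivre using k by simp
  show ?thesis
  proof (cases "t \<ge> 0")
    case True
    then show ?thesis using k by (simp add: root_branch_pos power_mult_distrib 1 flip: of_real_power)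
  next
    case False
    then show ?thesis using k by (simp add: root_branch_neg power_mult_distrib 1 2 flip: of_real_power)
  qed
qed

lemma norm_root_branch: "k > 0 \<Longrightarrow> cmod (root_branch k e t) = root k \<bar>t\<bar>"
  by (cases "t \<ge> 0") (auto simp: root_branch_pos root_branch_neg norm_mult)

lemma root_branch_inj:
  assumes "e < k" "e' < k" "t \<noteq> 0" "root_branch k e t = root_branch k e' t"
  shows "e = e'"
proof -
  have k: "k > 0" using assms by simp
  have "cis (2 * pi * e / k) = cis (2 * pi * e' / k)"
    using assms k by (cases "t \<ge> 0") (auto simp: root_branch_pos root_branch_neg)
  moreover have "inj_on (\<lambda>e. cis (2 * pi * real e / real k)) {..<k}"
    using Complex.bij_betw_roots_unity[OF k] by (simp add: bij_betw_def)
  ultimately show ?thesis using assms by (auto dest: inj_onD)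
qed

section \<open>Continuous selections over intervals of angles\<close>

context coprime_fraction
begin

text \<open>Multisets instead of sets: where roots collide, exactly as many sheets meet as the
  multiplicity says, and two selections can be matched at a common end by a permutation.\<close>

definition selection :: "real \<Rightarrow> real \<Rightarrow> real \<Rightarrow> (nat \<Rightarrow> real \<Rightarrow> complex) \<Rightarrow> bool" where
  "selection c a b \<rho> \<longleftrightarrow> (\<forall>j<degree P. continuous_on {a..b} (\<rho> j)) \<and>
     (\<forall>s\<in>{a..b}. image_mset (\<lambda>j. \<rho> j s) (mset_set {..<degree P}) = proots (fibre (of_real c * cis s)))"

text \<open>The permutation is a parameter because the same gluing serves to concatenate two
  selections and to exchange colliding sheets of one selection.\<close>

lemma selection_glue:
  assumes "selection c a b \<rho>1" "selection c b d \<rho>2" "a \<le> b" "b \<le> d"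
    and \<pi>: "\<pi> permutes {..<degree P}" "\<And>j. j < degree P \<Longrightarrow> \<rho>1 j b = \<rho>2 (\<pi> j) b"
  shows "selection c a d (\<lambda>j s. if s \<le> b then \<rho>1 j s else \<rho>2 (\<pi> j) s)"
  unfolding selection_def
proof (intro conjI allI impI ballI)
  fix j assume j: "j < degree P"
  have \<pi>j: "\<pi> j < degree P" using permutes_in_image[OF \<pi>(1), of j] j by simp
  have c1: "continuous_on {a..b} (\<rho>1 j)" and c2: "continuous_on {b..d} (\<rho>2 (\<pi> j))"
    using assms(1,2) j \<pi>j by (auto simp: selection_def)
  have "continuous_on ({a..b} \<union> {b..d}) (\<lambda>s. if s \<le> b then \<rho>1 j s else \<rho>2 (\<pi> j) s)"
    by (rule continuous_on_If) (use c1 c2 \<pi>(2)[OF j] in auto)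
  then show "continuous_on {a..d} (\<lambda>s. if s \<le> b then \<rho>1 j s else \<rho>2 (\<pi> j) s)"
    using assms(3,4) by (simp add: ivl_disj_un_two_touch)
next
  fix s assume s: "s \<in> {a..d}"
  show "image_mset (\<lambda>j. if s \<le> b then \<rho>1 j s else \<rho>2 (\<pi> j) s) (mset_set {..<degree P})
      = proots (fibre (of_real c * cis s))"
  proof (cases "s \<le> b")
    case True
    then show ?thesis using assms(1) s by (simp add: selection_def)
  next
    case False
    have "image_mset (\<lambda>j. \<rho>2 (\<pi> j) s) (mset_set {..<degree P})
       = image_mset (\<lambda>j. \<rho>2 j s) (image_mset \<pi> (mset_set {..<degree P}))"
      by (simp add: multiset.map_comp o_def)
    also have "\<dots> = image_mset (\<lambda>j. \<rho>2 j s) (mset_set {..<degree P})"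
      by (simp only: permutes_image_mset[OF \<pi>(1)])
    finally show ?thesis using False assms(2) s by (simp add: selection_def)
  qed
qed

lemma selection_trans:
  assumes "selection c a b \<rho>1" "selection c b d \<rho>2" "a \<le> b" "b \<le> d"
  shows "\<exists>\<rho>. selection c a d \<rho>"
proof -
  have "image_mset (\<lambda>j. \<rho>1 j b) (mset_set {..<degree P}) = image_mset (\<lambda>j. \<rho>2 j b) (mset_set {..<degree P})"
    using assms by (simp add: selection_def)
  then obtain \<pi> where "\<pi> permutes {..<degree P}" "\<forall>j\<in>{..<degree P}. \<rho>1 j b = \<rho>2 (\<pi> j) b"
    by (rule image_mset_eq_implies_permutes[OF finite_lessThan])
  then show ?thesis using selection_glue[OF assms, of \<pi>] by blast
qed

text \<open>Over angles s near x, a root of multiplicity k carries k sheets, the chart inverse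
  applied to the branches of the k-th root of s - x. There are as many sheets as the degree, so it
  remains to see that they are distinct roots for s \<noteq> x and have the right multiplicities for
  s = x.\<close>

lemma local_selection:
  assumes c: "c > 0"
  shows "\<exists>d>0. \<exists>\<rho>. \<forall>a b. x - d < a \<longrightarrow> b < x + d \<longrightarrow> selection c a b \<rho>"
proof -
  define w where "w = complex_of_real c * cis x"
  have w: "w \<noteq> 0" using c by (simp add: w_def)
  define Z where "Z = {z. poly (fibre w) z = 0}"
  define k where "k = (\<lambda>z. order z (fibre w))"
  have finZ: "finite Z" unfolding Z_def by (rule poly_roots_finite[OF fibre_nonzero[OF w]])
  have Zr: "ratio z = w" "poly P z \<noteq> 0" if "z \<in> Z" for z
    using that w by (auto simp: Z_def poly_fibre_eq_0)
  have kpos: "k z > 0" if "z \<in> Z" for z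
    using that fibre_nonzero[OF w] by (simp add: k_def Z_def order_root)
  \<comment> \<open>Balls of radius e z / 2 around the roots are disjoint, so sheets that start at
    different roots stay apart.\<close>
  have "\<forall>z. \<exists>e>0. \<forall>y\<in>Z. y \<noteq> z \<longrightarrow> e \<le> dist z y"
    using finite_set_avoid[OF finZ] by blast
  then obtain e where e: "\<And>z. e z > 0" "\<And>z y. y \<in> Z \<Longrightarrow> y \<noteq> z \<Longrightarrow> e z \<le> dist z y" by metis
  let ?chart = "\<lambda>z r \<psi>. r > (0::real) \<and> continuous_on (ball 0 r) \<psi> \<and> \<psi> 0 = z \<and>
      (\<forall>y\<in>ball 0 r. \<psi> y \<in> ball z (e z / 2) \<and> poly P (\<psi> y) \<noteq> 0 \<and> ratio (\<psi> y) = w * exp (\<i> * y ^ k z)) \<and>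
      inj_on \<psi> (ball 0 r)"
  have "\<forall>z\<in>Z. \<exists>r \<psi>. ?chart z r \<psi>"
  proof
    fix z assume z: "z \<in> Z"
    have rz: "ratio z \<noteq> 0" using Zr[OF z] w by simp
    have ze: "z \<in> ball z (e z / 2)" using e(1)[of z] by simp
    obtain r U \<phi> \<psi> where ch: "power_chart ratio z (order z (fibre (ratio z))) r U \<phi> \<psi>"
      and U: "U \<subseteq> ball z (e z / 2)" "U \<subseteq> {z. poly P z \<noteq> 0}"
      using chart_exists[OF rz open_ball ze] .
    interpret power_chart ratio z "order z (fibre (ratio z))" r U \<phi> \<psi> by (rule ch)
    have "\<forall>y\<in>ball 0 r. \<psi> y \<in> ball z (e z / 2) \<and> poly P (\<psi> y) \<noteq> 0 \<and> ratio (\<psi> y) = w * exp (\<i> * y ^ k z)"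
    proof
      fix y :: complex assume y: "y \<in> ball 0 r"
      show "\<psi> y \<in> ball z (e z / 2) \<and> poly P (\<psi> y) \<noteq> 0 \<and> ratio (\<psi> y) = w * exp (\<i> * y ^ k z)"
        using \<psi>_in[OF y] U f_\<psi>[OF y] by (auto simp: k_def Zr[OF z])
    qed
    moreover have "inj_on \<psi> (ball 0 r)" by (rule inj_onI) (use inj_\<psi> in blast)
    ultimately show "\<exists>r \<psi>. ?chart z r \<psi>"
      using r_pos holomorphic_on_imp_continuous_on[OF hol_\<psi>] \<psi>_0 by (intro exI[of _ r] exI[of _ \<psi>]) simp
  qed
  then obtain r where "\<forall>z\<in>Z. \<exists>\<psi>. ?chart z (r z) \<psi>" using bchoice by metis
  then obtain \<psi> where ch: "\<forall>z\<in>Z. ?chart z (r z) (\<psi> z)" using bchoice by metis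
  have r: "r z > 0" and cont\<psi>: "continuous_on (ball 0 (r z)) (\<psi> z)" and \<psi>0: "\<psi> z 0 = z"
    and inj\<psi>: "inj_on (\<psi> z) (ball 0 (r z))" if "z \<in> Z" for z using ch that by blast+
  have \<psi>in: "\<psi> z y \<in> ball z (e z / 2)" "poly P (\<psi> z y) \<noteq> 0" "ratio (\<psi> z y) = w * exp (\<i> * y ^ k z)"
    if "z \<in> Z" "y \<in> ball 0 (r z)" for z y using ch that by blast+
  \<comment> \<open>A k-th root of t has modulus |t|^(1/k), hence the k-th powers of the radii; the
    1 keeps the minimum defined when there is no root.\<close>
  define d where "d = Min (insert 1 ((\<lambda>z. r z ^ k z) ` Z))"
  have d: "d > 0" unfolding d_def using finZ r by (subst Min_gr_iff) auto
  have dle: "d \<le> r z ^ k z" if "z \<in> Z" for z unfolding d_def using finZ that by (intro Min_le) auto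
  have inb: "root_branch (k z) i t \<in> ball 0 (r z)" if "z \<in> Z" "\<bar>t\<bar> < d" for z i t
  proof -
    have "root (k z) \<bar>t\<bar> < root (k z) (r z ^ k z)"
      using dle[OF that(1)] that kpos[OF that(1)] by (simp add: real_root_less_iff)
    also have "\<dots> = r z" using r[OF that(1)] kpos[OF that(1)] by (simp add: real_root_power_cancel)
    finally show ?thesis by (simp add: norm_root_branch kpos[OF that(1)])
  qed
  define I where "I = Sigma Z (\<lambda>z. {..<k z})"
  have finI: "finite I" using finZ by (simp add: I_def)
  have "card I = (\<Sum>z\<in>Z. k z)" using finZ by (simp add: I_def)
  also have "\<dots> = size (proots (fibre w))"
    using fibre_nonzero[OF w] by (simp add: size_multiset_overloaded_eq Z_def k_def)
  also have "\<dots> = degree P" by (simp add: size_proots_complex degree_fibre[OF w])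
  finally have cardI: "card I = degree P" .
  obtain h where h: "bij_betw h {..<degree P} I"
    using ex_bij_betw_nat_finite[OF finI] cardI by (auto simp: atLeast0LessThan)
  have hZ: "fst (h j) \<in> Z" "snd (h j) < k (fst (h j))" if "j < degree P" for j
  proof -
    have "h j \<in> I" using bij_betwE[OF h] that by blast
    then show "fst (h j) \<in> Z" "snd (h j) < k (fst (h j))" by (cases "h j"; simp add: I_def)+
  qed
  define \<rho> where "\<rho> = (\<lambda>j s. \<psi> (fst (h j)) (root_branch (k (fst (h j))) (snd (h j)) (s - x)))"
  have cont: "continuous_on {a..b} (\<rho> j)" if "x - d < a" "b < x + d" "j < degree P" for a b j
    unfolding \<rho>_def
    by (rule continuous_on_compose2[OF cont\<psi>[OF hZ(1)[OF that(3)]]])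
      (use that inb[OF hZ(1)[OF that(3)]] in
        \<open>auto intro!: continuous_on_compose2[OF continuous_on_root_branch] continuous_intros simp: subset_iff abs_less_iff\<close>)
  have ms: "image_mset (\<lambda>j. \<rho> j s) (mset_set {..<degree P}) = proots (fibre (of_real c * cis s))"
    if s: "\<bar>s - x\<bar> < d" for s
  proof -
    let ?w = "complex_of_real c * cis s"
    have w': "?w \<noteq> 0" using c by simp
    have inb': "root_branch (k (fst (h j))) (snd (h j)) (s - x) \<in> ball 0 (r (fst (h j)))" if "j < degree P" for j
      by (rule inb[OF hZ(1)[OF that] s])
    have root: "poly (fibre ?w) (\<rho> j s) = 0" if "j < degree P" for j
    proof -
      have "ratio (\<rho> j s) = w * exp (\<i> * complex_of_real (s - x))"
        unfolding \<rho>_def \<psi>in(3)[OF hZ(1)[OF that] inb'[OF that]] root_branch_power[OF kpos[OF hZ(1)[OF that]]] ..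
      also have "\<dots> = ?w" by (simp add: w_def cis_conv_exp algebra_simps flip: exp_add)
      finally show ?thesis
        using \<psi>in(2)[OF hZ(1)[OF that] inb'[OF that]] unfolding poly_fibre_eq_0[OF w'] by (simp add: \<rho>_def)
    qed
    show ?thesis
    proof (cases "s = x")
      case True
      have "count (image_mset (\<lambda>j. \<rho> j s) (mset_set {..<degree P})) z = count (proots (fibre ?w)) z" for z
      proof -
        have \<rho>x: "\<rho> j s = fst (h j)" if "j < degree P" for j
          using \<psi>0[OF hZ(1)[OF that]] by (simp add: \<rho>_def True root_branch_0)
        have "image_mset (\<lambda>j. \<rho> j s) (mset_set {..<degree P}) = image_mset (\<lambda>j. fst (h j)) (mset_set {..<degree P})"
          by (rule image_mset_cong) (simp add: \<rho>x)
        also have "\<dots> = image_mset fst (image_mset h (mset_set {..<degree P}))"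
          by (simp add: multiset.map_comp o_def)
        also have "image_mset h (mset_set {..<degree P}) = mset_set I"
          using h by (metis bij_betw_def image_mset_mset_set)
        finally have "count (image_mset (\<lambda>j. \<rho> j s) (mset_set {..<degree P})) z = card {i \<in> I. fst i = z}"
          using finI by (simp add: count_image_mset_eq_card_vimage)
        also have "{i \<in> I. fst i = z} = (if z \<in> Z then {z} \<times> {..<k z} else {})" by (auto simp: I_def)
        also have "card \<dots> = k z"
          using fibre_nonzero[OF w] by (auto simp: Z_def k_def order_root)
        finally show ?thesis using fibre_nonzero[OF w] by (simp add: k_def True w_def)
      qed
      then show ?thesis by (rule multiset_eqI)
    next
      case False
      have inj: "inj_on (\<lambda>j. \<rho> j s) {..<degree P}"
      proof (rule inj_onI)
        fix j j' assume j: "j \<in> {..<degree P}" "j' \<in> {..<degree P}" "\<rho> j s = \<rho> j' s"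
        let ?z = "fst (h j)" and ?z' = "fst (h j')"
        have zz: "?z \<in> Z" "?z' \<in> Z" using j hZ by auto
        have b1: "\<rho> j s \<in> ball ?z (e ?z / 2)" and b2: "\<rho> j' s \<in> ball ?z' (e ?z' / 2)"
          using \<psi>in(1)[OF zz(1) inb'] \<psi>in(1)[OF zz(2) inb'] j by (auto simp: \<rho>_def)
        have eqz: "?z = ?z'"
        proof (rule ccontr)
          assume ne: "?z \<noteq> ?z'"
          have "dist ?z ?z' \<le> dist ?z (\<rho> j s) + dist ?z' (\<rho> j s)" by (rule dist_triangle2)
          also have "\<dots> < e ?z / 2 + e ?z' / 2" using b1 b2 j(3) by simp
          also have "\<dots> \<le> dist ?z ?z'"
            using e(2)[OF zz(2), of ?z] e(2)[OF zz(1), of ?z'] ne by (simp add: dist_commute)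
          finally show False by simp
        qed
        have "root_branch (k ?z) (snd (h j)) (s - x) = root_branch (k ?z) (snd (h j')) (s - x)"
          using inj_onD[OF inj\<psi>[OF zz(1)], of "root_branch (k ?z) (snd (h j)) (s - x)" "root_branch (k ?z) (snd (h j')) (s - x)"]
            j(3) inb'[of j] inb'[of j'] j(1,2) eqz by (simp add: \<rho>_def)
        then have "snd (h j) = snd (h j')"
          using root_branch_inj[of "snd (h j)" "k ?z" "snd (h j')" "s - x"] hZ(2)[of j] hZ(2)[of j'] j(1,2) eqz False by simp
        then have "h j = h j'" using eqz by (rule prod_eqI[rotated])
        then show "j = j'" using h j(1,2) by (auto simp: bij_betw_def dest: inj_onD)
      qed
      \<comment> \<open>The sheets are distinct roots, as many as the fibre has roots with
        multiplicity; inclusion and equal size give equality of the multisets.\<close>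
      let ?M = "image_mset (\<lambda>j. \<rho> j s) (mset_set {..<degree P})"
      have M: "?M = mset_set ((\<lambda>j. \<rho> j s) ` {..<degree P})" by (rule image_mset_mset_set[OF inj])
      have "?M \<subseteq># proots (fibre ?w)"
      proof (rule mset_subset_eqI)
        fix z
        show "count ?M z \<le> count (proots (fibre ?w)) z"
        proof (cases "z \<in> (\<lambda>j. \<rho> j s) ` {..<degree P}")
          case True
          then have "poly (fibre ?w) z = 0" using root by auto
          then have "order z (fibre ?w) > 0" using fibre_nonzero[OF w'] by (simp add: order_root)
          then show ?thesis unfolding M using True fibre_nonzero[OF w'] by simp
        next
          case False
          then show ?thesis unfolding M by simp
        qed
      qed
      moreover have "size ?M = size (proots (fibre ?w))"
        by (simp add: size_proots_complex degree_fibre[OF w'])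
      ultimately show ?thesis by (metis mset_subset_size nat_neq_iff subset_mset.le_imp_less_or_eq)
    qed
  qed
  have "selection c a b \<rho>" if "x - d < a" "b < x + d" for a b
    unfolding selection_def using cont[OF that] ms that by (auto simp: abs_less_iff)
  then show ?thesis using d by blast
qed

text \<open>Local selections concatenate, so compactness of the interval, in the form of Bolzano's
  bisection, gives a selection over all of it.\<close>

lemma selection_exists:
  assumes "c > 0" "a \<le> b"
  shows "\<exists>\<rho>. selection c a b \<rho>"
  using assms(2)
proof (induction rule: Bolzano)
  case (trans a b d)
  then show ?case using selection_trans by blast
next
  case (local x)
  obtain d \<rho> where d: "d > 0" "\<forall>a b. x - d < a \<longrightarrow> b < x + d \<longrightarrow> selection c a b \<rho>"
    using local_selection[OF assms(1)] by blast
  have "\<exists>\<rho>. selection c a b \<rho>" if "a \<le> x" "x \<le> b" "b - a < d" for a b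
    using d(2)[rule_format, of a b] that by (intro exI[of _ \<rho>]) linarith
  then show ?case using d(1) by blast
qed

end

section \<open>Collisions of sheets and monodromy\<close>

context coprime_fraction
begin

text \<open>A nonzero \<open>R\<close> forces \<open>P\<close> to have a root a. There R' P vanishes
  at least to the order of \<open>P\<close>, but R P' to exactly one order less, since R(a) \<noteq>
  0.\<close>

lemma finite_crit:
  assumes "R \<noteq> 0"
  shows "finite crit"
proof -
  have "pderiv R * P - R * pderiv P \<noteq> 0"
  proof
    assume "pderiv R * P - R * pderiv P = 0"
    then have eq: "pderiv R * P = R * pderiv P" by simp
    have dP: "degree P > 0" using deg assms by auto
    then have P': "pderiv P \<noteq> 0" by (simp add: pderiv_eq_0_iff)
    have "\<not> constant (poly P)" using dP by (simp add: constant_degree)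
    then have "\<exists>a. poly P a = 0" by (rule Fundamental_Theorem_Algebra.fundamental_theorem_of_algebra)
    then obtain a where a: "poly P a = 0" ..
    have R': "pderiv R \<noteq> 0" using eq P' assms by auto
    have "order a P > 0" using a P_nonzero by (simp add: order_root)
    have "order a R = 0" using no_common_root[OF a] by (simp add: order_0I)
    have "order a (pderiv R * P) = order a (pderiv R) + order a P"
      using R' P_nonzero by (intro order_mult) simp
    moreover have "order a (R * pderiv P) = order a R + order a (pderiv P)"
      using assms P' by (intro order_mult) simp
    moreover have "order a P = Suc (order a (pderiv P))"
      using a P_nonzero P' \<open>order a P > 0\<close> order_pderiv[of P a] by simp
    ultimately show False using eq \<open>order a R = 0\<close> by simp
  qed
  then have "finite {z. poly (pderiv R * P - R * pderiv P) z = 0}" by (rule poly_roots_finite)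
  then show ?thesis by (rule finite_subset[rotated]) (auto simp: crit_def)
qed

lemma fibre_value_nonzero: "c > 0 \<Longrightarrow> complex_of_real c * cis s \<noteq> 0"
  by simp

text \<open>No two sheets collide at such a base angle. All collisions then lie strictly inside one
  turn, where continuations can be exchanged without touching the starting values.\<close>

lemma regular_angle:
  assumes c: "c > 0"
  obtains \<beta> where "\<And>z. ratio z = of_real c * cis \<beta> \<Longrightarrow> z \<notin> crit"
proof (cases "R = 0")
  case True
  then have R0: "poly R z = 0" for z by simp
  have "ratio z = 0" for z by (simp add: ratio_def R0)
  then have "ratio z \<noteq> of_real c * cis 0" for z using fibre_value_nonzero[OF c] by metis
  then show ?thesis using that by blast
next
  case False
  have "finite ((\<lambda>z. Arg (ratio z)) ` crit)" using finite_crit[OF False] by simp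
  moreover have "infinite {-pi<..pi}" using pi_gt_zero by (simp add: infinite_Ioc)
  ultimately obtain \<beta> where \<beta>: "\<beta> \<in> {-pi<..pi}" "\<beta> \<notin> (\<lambda>z. Arg (ratio z)) ` crit"
    by (meson finite_subset subsetI)
  have "Arg (of_real c * cis \<beta>) = \<beta>" using c \<beta>(1) by (simp add: Arg_cis)
  then show ?thesis using that \<beta>(2) by (metis imageI)
qed

lemma selection_card:
  assumes "c > 0" "selection c a b \<rho>" "s \<in> {a..b}"
  shows "card {j. j < degree P \<and> \<rho> j s = z} = order z (fibre (of_real c * cis s))"
proof -
  have "count (image_mset (\<lambda>j. \<rho> j s) (mset_set {..<degree P})) z = card {j \<in> {..<degree P}. \<rho> j s = z}"
    by (rule count_image_mset_eq_card_vimage) simp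
  moreover have "{j \<in> {..<degree P}. \<rho> j s = z} = {j. j < degree P \<and> \<rho> j s = z}" by auto
  moreover have "image_mset (\<lambda>j. \<rho> j s) (mset_set {..<degree P}) = proots (fibre (of_real c * cis s))"
    using assms by (simp add: selection_def)
  ultimately show ?thesis using fibre_nonzero[OF fibre_value_nonzero[OF assms(1)]] by simp
qed

lemma selection_root:
  assumes "c > 0" "selection c a b \<rho>" "s \<in> {a..b}" "j < degree P"
  shows "poly P (\<rho> j s) \<noteq> 0" "ratio (\<rho> j s) = of_real c * cis s"
proof -
  have "j \<in> {i. i < degree P \<and> \<rho> i s = \<rho> j s}" using assms(4) by simp
  then have "card {i. i < degree P \<and> \<rho> i s = \<rho> j s} \<noteq> 0" by (auto simp: card_eq_0_iff)
  then have "poly (fibre (of_real c * cis s)) (\<rho> j s) = 0"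
    unfolding selection_card[OF assms(1-3)] by (simp add: order_root)
  then show "poly P (\<rho> j s) \<noteq> 0" "ratio (\<rho> j s) = of_real c * cis s"
    using poly_fibre_eq_0[OF fibre_value_nonzero[OF assms(1)]] by auto
qed

lemma selection_covers:
  assumes "c > 0" "selection c a b \<rho>" "s \<in> {a..b}" "poly P z \<noteq> 0" "ratio z = of_real c * cis s"
  obtains j where "j < degree P" "\<rho> j s = z"
proof -
  have "poly (fibre (of_real c * cis s)) z = 0"
    using assms poly_fibre_eq_0[OF fibre_value_nonzero[OF assms(1)]] by blast
  then have "card {j. j < degree P \<and> \<rho> j s = z} \<noteq> 0"
    unfolding selection_card[OF assms(1-3)] using fibre_nonzero[OF fibre_value_nonzero[OF assms(1)]]
    by (simp add: order_root)
  then show ?thesis using that by (auto simp: card_eq_0_iff)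
qed

text \<open>Outside the critical points a root is simple, so only one sheet passes through
  it.\<close>

lemma selection_regular:
  assumes "c > 0" "selection c a b \<rho>" "s \<in> {a..b}" "i < degree P" "j < degree P"
    "\<rho> i s = \<rho> j s" "\<rho> i s \<notin> crit"
  shows "i = j"
proof -
  have r: "ratio (\<rho> i s) = of_real c * cis s" by (rule selection_root[OF assms(1-4)])
  then have "ratio (\<rho> i s) \<noteq> 0" using fibre_value_nonzero[OF assms(1)] by simp
  then have "card {k. k < degree P \<and> \<rho> k s = \<rho> i s} = 1"
    unfolding selection_card[OF assms(1-3)] using order_fibre_eq_1 assms(7) r by metis
  then obtain m where "{k. k < degree P \<and> \<rho> k s = \<rho> i s} = {m}" by (rule card_1_singletonE)
  moreover have "i \<in> {k. k < degree P \<and> \<rho> k s = \<rho> i s}" "j \<in> {k. k < degree P \<and> \<rho> k s = \<rho> i s}"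
    using assms by auto
  ultimately show ?thesis by (metis singletonD)
qed

definition monodromy :: "real \<Rightarrow> (nat \<Rightarrow> real \<Rightarrow> complex) \<Rightarrow> (nat \<Rightarrow> nat) \<Rightarrow> bool" where
  "monodromy \<beta> \<rho> \<sigma> \<longleftrightarrow> \<sigma> permutes {..<degree P} \<and> (\<forall>j<degree P. \<rho> j (\<beta> + 2 * pi) = \<rho> (\<sigma> j) \<beta>)"

lemma cis_add_2pi: "cis (\<beta> + 2 * pi) = cis \<beta>"
  by (simp flip: cis_mult)

lemma monodromy_exists:
  assumes "selection c \<beta> (\<beta> + 2 * pi) \<rho>"
  obtains \<sigma> where "monodromy \<beta> \<rho> \<sigma>"
proof -
  have "image_mset (\<lambda>j. \<rho> j (\<beta> + 2 * pi)) (mset_set {..<degree P}) = image_mset (\<lambda>j. \<rho> j \<beta>) (mset_set {..<degree P})"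
    using assms by (simp add: selection_def cis_add_2pi)
  then obtain \<sigma> where "\<sigma> permutes {..<degree P}" "\<forall>j\<in>{..<degree P}. \<rho> j (\<beta> + 2 * pi) = \<rho> (\<sigma> j) \<beta>"
    by (rule image_mset_eq_implies_permutes[OF finite_lessThan])
  then show ?thesis using that by (auto simp: monodromy_def)
qed

lemma selection_subinterval:
  "selection c a b \<rho> \<Longrightarrow> a \<le> a' \<Longrightarrow> b' \<le> b \<Longrightarrow> selection c a' b' \<rho>"
  unfolding selection_def by (auto intro: continuous_on_subset)

text \<open>
  Where two sheets of the same cycle meet, exchanging their continuations splits the cycle. A
  selection with the largest number of cycles therefore has no such sheets.
\<close>

lemma separated_selection:
  assumes c: "c > 0" and \<beta>: "\<And>z. ratio z = of_real c * cis \<beta> \<Longrightarrow> z \<notin> crit"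
  obtains \<rho> \<sigma> where "selection c \<beta> (\<beta> + 2 * pi) \<rho>" "monodromy \<beta> \<rho> \<sigma>"
    "\<And>j k s. j < degree P \<Longrightarrow> k < degree P \<Longrightarrow> s \<in> {\<beta>..\<beta> + 2 * pi} \<Longrightarrow> \<rho> j s = \<rho> k s \<Longrightarrow>
       cycle_of \<sigma> j = cycle_of \<sigma> k \<Longrightarrow> j = k"
proof -
  let ?A = "{..<degree P}"
  let ?good = "\<lambda>(\<rho>, \<sigma>). selection c \<beta> (\<beta> + 2 * pi) \<rho> \<and> monodromy \<beta> \<rho> \<sigma>"
  let ?m = "\<lambda>(\<rho>, \<sigma>). card (cycle_of \<sigma> ` ?A)"
  obtain \<rho>0 where "selection c \<beta> (\<beta> + 2 * pi) \<rho>0" using selection_exists[OF c, of \<beta> "\<beta> + 2 * pi"] by auto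
  moreover then obtain \<sigma>0 where "monodromy \<beta> \<rho>0 \<sigma>0" using monodromy_exists by blast
  ultimately have ex: "?good (\<rho>0, \<sigma>0)" by simp
  have "?m x < Suc (degree P)" for x :: "(nat \<Rightarrow> real \<Rightarrow> complex) \<times> (nat \<Rightarrow> nat)"
    using card_image_le[of ?A "cycle_of (snd x)"] by (simp add: case_prod_beta less_Suc_eq_le)
  then obtain x where x: "?good x" "\<And>y. ?good y \<Longrightarrow> ?m y \<le> ?m x"
    using ex_has_greatest_nat[of ?good "(\<rho>0, \<sigma>0)" ?m "Suc (degree P)"] ex by blast
  obtain \<rho> \<sigma> where x_eq: "x = (\<rho>, \<sigma>)" by (cases x)
  have sel: "selection c \<beta> (\<beta> + 2 * pi) \<rho>" and mon: "monodromy \<beta> \<rho> \<sigma>" using x(1) by (auto simp: x_eq)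
  have max: "card (cycle_of \<sigma>' ` ?A) \<le> card (cycle_of \<sigma> ` ?A)"
    if "selection c \<beta> (\<beta> + 2 * pi) \<rho>'" "monodromy \<beta> \<rho>' \<sigma>'" for \<rho>' \<sigma>'
    using x(2)[of "(\<rho>', \<sigma>')"] that by (simp add: x_eq)
  have \<sigma>: "\<sigma> permutes ?A" and mon': "\<And>j. j < degree P \<Longrightarrow> \<rho> j (\<beta> + 2 * pi) = \<rho> (\<sigma> j) \<beta>"
    using mon by (auto simp: monodromy_def)
  have "j = k" if jk: "j < degree P" "k < degree P" "s \<in> {\<beta>..\<beta> + 2 * pi}" "\<rho> j s = \<rho> k s"
    "cycle_of \<sigma> j = cycle_of \<sigma> k" for j k s
  proof (rule ccontr)
    assume ne: "j \<noteq> k"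
    \<comment> \<open>Only critical points admit collisions, and the base angle has none; so s lies
      strictly between the ends of the turn.\<close>
    have cr: "\<rho> j s \<in> crit" using selection_regular[OF c sel jk(3,1,2,4)] ne by blast
    have "ratio (\<rho> j s) = of_real c * cis s" by (rule selection_root[OF c sel jk(3,1)])
    then have s: "\<beta> < s" "s < \<beta> + 2 * pi"
      using \<beta>[of "\<rho> j s"] cr jk(3) cis_add_2pi[of \<beta>] by (force simp: less_le)+
    let ?\<tau> = "Transposition.transpose j k"
    have \<tau>: "?\<tau> permutes ?A" using jk by (intro permutes_swap_id) auto
    \<comment> \<open>The values at \<beta> stay and those at \<beta> + 2 pi are permuted by the
      transposition, so the new monodromy is \<open>\<sigma> \<circ> ?\<tau>\<close>.\<close>
    define \<rho>' where "\<rho>' = (\<lambda>i x. if x \<le> s then \<rho> i x else \<rho> (?\<tau> i) x)"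
    have "selection c \<beta> (\<beta> + 2 * pi) \<rho>'" unfolding \<rho>'_def
    proof (rule selection_glue[OF _ _ _ _ \<tau>])
      show "\<rho> i s = \<rho> (?\<tau> i) s" for i
        by (cases "i = j"; cases "i = k") (use jk(4) in simp_all)
    qed (use selection_subinterval[OF sel] s in auto)
    moreover have "monodromy \<beta> \<rho>' (\<sigma> \<circ> ?\<tau>)"
      unfolding monodromy_def
    proof (intro conjI allI impI)
      show "\<sigma> \<circ> ?\<tau> permutes ?A" by (rule permutes_compose[OF \<tau> \<sigma>])
      fix i assume "i < degree P"
      then have "?\<tau> i < degree P" using permutes_in_image[OF \<tau>, of i] by simp
      then show "\<rho>' i (\<beta> + 2 * pi) = \<rho>' ((\<sigma> \<circ> ?\<tau>) i) \<beta>"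
        using s mon' by (simp add: \<rho>'_def)
    qed
    ultimately have "card (cycle_of (\<sigma> \<circ> ?\<tau>) ` ?A) \<le> card (cycle_of \<sigma> ` ?A)" by (rule max)
    moreover have "k \<in> cycle_of \<sigma> j" unfolding jk(5) by (rule self_in_cycle_of)
    then have "card (cycle_of \<sigma> ` ?A) < card (cycle_of (\<sigma> \<circ> ?\<tau>) ` ?A)"
      using jk ne by (intro card_cycles_transpose[OF \<sigma>]) auto
    ultimately show False by simp
  qed
  then show ?thesis using that sel mon by blast
qed

end

section \<open>The closed curves of a level set\<close>

text \<open>The two exponentials agree, and both \<phi>^k and x - x0 are kept at modulus below pi,
  which leaves no ambiguity by a multiple of 2 pi.\<close>

lemma (in power_chart) lift_power:
  assumes cont: "continuous (at x0 within T) h" and h0: "h x0 = z0"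
    and fh: "\<And>x. x \<in> T \<Longrightarrow> f (h x) = f z0 * exp (\<i> * complex_of_real (x - x0))"
  obtains d where "d > 0" "\<And>x. x \<in> T \<Longrightarrow> \<bar>x - x0\<bar> < d \<Longrightarrow> h x \<in> U \<and> \<phi> (h x) ^ k = complex_of_real (x - x0)"
proof -
  have "open (U \<inter> (\<lambda>z. \<phi> z ^ k) -` ball 0 pi)"
    using hol_\<phi> open_U by (intro continuous_open_preimage continuous_intros holomorphic_on_imp_continuous_on) auto
  moreover have "h x0 \<in> U \<inter> (\<lambda>z. \<phi> z ^ k) -` ball 0 pi"
    using z0_in k_pos by (simp add: h0 \<phi>_z0 power_0_left)
  ultimately have "\<forall>\<^sub>F x in at x0 within T. h x \<in> U \<inter> (\<lambda>z. \<phi> z ^ k) -` ball 0 pi"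
    using cont unfolding continuous_within by (intro topological_tendstoD)
  then obtain d where d: "d > 0" "\<And>x. x \<in> T \<Longrightarrow> x \<noteq> x0 \<Longrightarrow> dist x x0 < d \<Longrightarrow> h x \<in> U \<inter> (\<lambda>z. \<phi> z ^ k) -` ball 0 pi"
    unfolding eventually_at by blast
  have "h x \<in> U \<and> \<phi> (h x) ^ k = complex_of_real (x - x0)" if x: "x \<in> T" "\<bar>x - x0\<bar> < min d pi" for x
  proof -
    have hx: "h x \<in> U \<inter> (\<lambda>z. \<phi> z ^ k) -` ball 0 pi"
      using d(2)[OF x(1)] x(2) \<open>h x0 \<in> _\<close> by (cases "x = x0") (auto simp: dist_real_def)
    then have "f z0 * exp (\<i> * \<phi> (h x) ^ k) = f z0 * exp (\<i> * complex_of_real (x - x0))"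
      using f_eq[of "h x"] fh[OF x(1)] by (metis IntD1)
    then have "exp (\<i> * \<phi> (h x) ^ k) = exp (\<i> * complex_of_real (x - x0))" using f_nonzero by simp
    moreover have "\<bar>Im (\<i> * \<phi> (h x) ^ k) - Im (\<i> * complex_of_real (x - x0))\<bar> < 2 * pi"
    proof -
      have "\<bar>Re (\<phi> (h x) ^ k)\<bar> < pi"
        using hx abs_Re_le_cmod[of "\<phi> (h x) ^ k"] by simp
      moreover have "Im (\<i> * \<phi> (h x) ^ k) - Im (\<i> * complex_of_real (x - x0)) = Re (\<phi> (h x) ^ k) - (x - x0)"
        by simp
      moreover have "\<bar>x - x0\<bar> < pi" using x(2) by simp
      ultimately show ?thesis by linarith
    qed
    ultimately have "\<i> * \<phi> (h x) ^ k = \<i> * complex_of_real (x - x0)" by (rule exp_complex_eqI[rotated])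
    then show ?thesis using hx by simp
  qed
  then show ?thesis using that[of "min d pi"] d(1) pi_gt_zero by simp
qed

lemma smooth_on_imp_continuous_on:
  assumes "smooth_on X f"
  shows "continuous_on X f"
proof -
  have "continuous (at x within X) f" if x: "x \<in> X" for x
  proof -
    obtain U F where U: "open U" "x \<in> U" "\<forall>k. Ck_on k U F" "\<forall>y\<in>U \<inter> X. F y = f y"
      using assms x unfolding smooth_on_def by metis
    have "continuous_on U F" using U(3) Ck_on.simps(1) by blast
    then have "continuous (at x) F" using U(1,2) by (simp add: continuous_on_eq_continuous_at)
    then have cF: "continuous (at x within X) F" by (rule continuous_at_imp_continuous_at_within)
    obtain e where e: "e > 0" "ball x e \<subseteq> U" using U(1,2) by (meson openE)
    show ?thesis
      by (rule continuous_transform_within[OF cF e(1) x]) (use e U(4) x in \<open>auto simp: subset_iff dist_commute\<close>)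
  qed
  then show ?thesis by (simp add: continuous_on_eq_continuous_within)
qed

locale sheets = coprime_fraction +
  fixes c \<beta> :: real and \<rho> :: "nat \<Rightarrow> real \<Rightarrow> complex" and \<sigma> :: "nat \<Rightarrow> nat"
  assumes c_pos: "c > 0"
    and regular: "\<And>z. ratio z = of_real c * cis \<beta> \<Longrightarrow> z \<notin> crit"
    and sel: "selection c \<beta> (\<beta> + 2 * pi) \<rho>"
    and mon: "monodromy \<beta> \<rho> \<sigma>"
    and sep: "\<And>j k s. j < degree P \<Longrightarrow> k < degree P \<Longrightarrow> s \<in> {\<beta>..\<beta> + 2 * pi} \<Longrightarrow> \<rho> j s = \<rho> k s \<Longrightarrow>
       cycle_of \<sigma> j = cycle_of \<sigma> k \<Longrightarrow> j = k"
begin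

lemma \<sigma>_permutes: "\<sigma> permutes {..<degree P}"
  using mon by (simp add: monodromy_def)

lemma \<rho>_end: "j < degree P \<Longrightarrow> \<rho> j (\<beta> + 2 * pi) = \<rho> (\<sigma> j) \<beta>"
  using mon by (simp add: monodromy_def)

lemma ratio_\<rho>: "s \<in> {\<beta>..\<beta> + 2 * pi} \<Longrightarrow> j < degree P \<Longrightarrow> ratio (\<rho> j s) = of_real c * cis s"
  using selection_root[OF c_pos sel] by blast

lemma cycle_less: "j < degree P \<Longrightarrow> i \<in> cycle_of \<sigma> j \<Longrightarrow> i < degree P"
  using cycle_of_subset[OF \<sigma>_permutes, of j] by auto

lemma cycle_eq: "i \<in> cycle_of \<sigma> j \<Longrightarrow> cycle_of \<sigma> i = cycle_of \<sigma> j"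
  by (rule cycle_of_eq[OF \<sigma>_permutes finite_lessThan])

text \<open>The arcs are taken over the closed turn because the end of sheet i is the beginning of
  sheet \<sigma> i; the union over a cycle closes up.\<close>

definition curve :: "nat \<Rightarrow> complex set" where
  "curve j = (\<Union>i\<in>cycle_of \<sigma> j. \<rho> i ` {\<beta>..\<beta> + 2 * pi})"

lemma curve_cong: "cycle_of \<sigma> i = cycle_of \<sigma> j \<Longrightarrow> curve i = curve j"
  by (simp add: curve_def)

text \<open>The end of a sheet is the start of the next one in its cycle. On the half-open turn the
  angle is determined by the value of \<open>ratio\<close>.\<close>

lemma curve_halfopen:
  assumes j: "j < degree P" and "z \<in> curve j"
  obtains i s where "i \<in> cycle_of \<sigma> j" "s \<in> {\<beta>..<\<beta> + 2 * pi}" "z = \<rho> i s"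
proof -
  obtain i s where i: "i \<in> cycle_of \<sigma> j" "s \<in> {\<beta>..\<beta> + 2 * pi}" "z = \<rho> i s"
    using assms(2) by (auto simp: curve_def)
  show ?thesis
  proof (cases "s = \<beta> + 2 * pi")
    case True
    then have "z = \<rho> (\<sigma> i) \<beta>" using \<rho>_end[OF cycle_less[OF j i(1)]] i(3) by simp
    then show ?thesis using that[of "\<sigma> i" \<beta>] cycle_of_closed[OF i(1)] by simp
  next
    case False
    then have "s \<in> {\<beta>..<\<beta> + 2 * pi}" using i(2) by auto
    then show ?thesis using that i(1,3) by blast
  qed
qed

lemma cis_eq_imp_eq:
  assumes "cis s = cis s'" "s \<in> {\<beta>..<\<beta> + 2 * pi}" "s' \<in> {\<beta>..<\<beta> + 2 * pi}"
  shows "s = s'"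
proof -
  have "\<bar>Im (\<i> * complex_of_real s) - Im (\<i> * complex_of_real s')\<bar> < 2 * pi" using assms by auto
  moreover have "exp (\<i> * complex_of_real s) = exp (\<i> * complex_of_real s')"
    using assms(1) by (simp only: cis_conv_exp)
  ultimately have "\<i> * complex_of_real s = \<i> * complex_of_real s'" by (rule exp_complex_eqI)
  then show ?thesis by simp
qed

lemma level_eq: "level c = (\<Union>j<degree P. curve j)"
proof (intro equalityI subsetI)
  fix z assume "z \<in> level c"
  then have z: "poly P z \<noteq> 0" "cmod (ratio z) = c" using level_iff[OF c_pos] by auto
  \<comment> \<open>Division by \<open>cis \<beta>\<close> measures the angle from \<beta>, so that
    it falls into the chosen turn.\<close>
  let ?t = "Arg2pi (ratio z / cis \<beta>)"
  have "ratio z / cis \<beta> = of_real (cmod (ratio z / cis \<beta>)) * exp (\<i> * of_real ?t)" by (rule Arg2pi_eq)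
  then have "ratio z = of_real c * cis (\<beta> + ?t)"
    using z(2) by (simp add: norm_divide cis_conv_exp[symmetric] field_simps flip: cis_mult)
  moreover have t: "\<beta> + ?t \<in> {\<beta>..\<beta> + 2 * pi}" using Arg2pi_ge_0[of "ratio z / cis \<beta>"] Arg2pi_lt_2pi[of "ratio z / cis \<beta>"] by simp
  ultimately obtain j where j: "j < degree P" "\<rho> j (\<beta> + ?t) = z"
    using selection_covers[OF c_pos sel _ z(1)] by blast
  have "\<rho> j (\<beta> + ?t) \<in> \<rho> j ` {\<beta>..\<beta> + 2 * pi}" by (rule imageI[OF t])
  then have "z \<in> \<rho> j ` {\<beta>..\<beta> + 2 * pi}" by (simp only: j(2))
  then have "z \<in> curve j" unfolding curve_def by (rule UN_I[OF self_in_cycle_of])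
  then show "z \<in> (\<Union>j<degree P. curve j)" using j(1) by blast
next
  fix z assume "z \<in> (\<Union>j<degree P. curve j)"
  then obtain j i s where j: "j < degree P" "i \<in> cycle_of \<sigma> j" "s \<in> {\<beta>..\<beta> + 2 * pi}" "z = \<rho> i s"
    by (auto simp: curve_def)
  have i: "i < degree P" using cycle_less j by blast
  show "z \<in> level c"
    using selection_root[OF c_pos sel j(3) i] c_pos j(4) by (simp add: level_iff norm_mult)
qed

lemma curve_subset_level: "j < degree P \<Longrightarrow> curve j \<subseteq> level c"
  using level_eq by blast

lemma compact_arc: "j < degree P \<Longrightarrow> compact (\<rho> j ` {\<beta>..\<beta> + 2 * pi})"
  using sel by (intro compact_continuous_image) (auto simp: selection_def)

lemma compact_curve:
  assumes "j < degree P" shows "compact (curve j)"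
proof -
  have "finite (cycle_of \<sigma> j)"
    using cycle_of_subset[OF \<sigma>_permutes, of j] assms by (auto intro: finite_subset[OF _ finite_lessThan])
  then show ?thesis unfolding curve_def
    using compact_arc cycle_less[OF assms] by (intro compact_UN) auto
qed

text \<open>The point fixes its angle in the half-open turn, and a simple root lies on one sheet
  only.\<close>

lemma curve_meet:
  assumes "i < degree P" "j < degree P" "z \<in> curve i" "z \<in> curve j" "z \<notin> crit"
  shows "cycle_of \<sigma> i = cycle_of \<sigma> j"
proof -
  obtain i' s where i': "i' \<in> cycle_of \<sigma> i" "s \<in> {\<beta>..<\<beta> + 2 * pi}" "z = \<rho> i' s"
    using curve_halfopen[OF assms(1,3)] .
  obtain j' s' where j': "j' \<in> cycle_of \<sigma> j" "s' \<in> {\<beta>..<\<beta> + 2 * pi}" "z = \<rho> j' s'"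
    using curve_halfopen[OF assms(2,4)] .
  have less: "i' < degree P" "j' < degree P" using cycle_less assms i' j' by blast+
  have "of_real c * cis s = of_real c * cis s'"
    using ratio_\<rho>[of s i'] ratio_\<rho>[of s' j'] i' j' less by auto
  then have "s = s'" using c_pos i'(2) j'(2) by (intro cis_eq_imp_eq) auto
  then have "i' = j'"
    using selection_regular[OF c_pos sel _ less, of s] i' j' assms(5) by auto
  then show ?thesis using cycle_eq i'(1) j'(1) by metis
qed

text \<open>The curves of the other cycles form a closed set, and a noncritical point of this curve
  avoids it.\<close>

lemma curve_eq_level_near:
  assumes j: "j < degree P" and z: "z \<in> curve j" "z \<notin> crit"
  obtains W where "open W" "z \<in> W" "curve j \<inter> W = level c \<inter> W"
proof -
  let ?K = "\<Union>i\<in>{i. i < degree P \<and> cycle_of \<sigma> i \<noteq> cycle_of \<sigma> j}. curve i"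
  have "closed ?K" by (intro closed_UN) (auto intro: compact_imp_closed compact_curve)
  moreover have "z \<notin> ?K"
  proof
    assume "z \<in> ?K"
    then obtain i where i: "i < degree P" "cycle_of \<sigma> i \<noteq> cycle_of \<sigma> j" "z \<in> curve i" by blast
    show False using curve_meet[OF i(1) j i(3) z] i(2) by blast
  qed
  moreover have "curve j \<inter> - ?K = level c \<inter> - ?K"
  proof (intro equalityI subsetI)
    fix y assume "y \<in> curve j \<inter> - ?K"
    then show "y \<in> level c \<inter> - ?K" using curve_subset_level[OF j] by blast
  next
    fix y assume y: "y \<in> level c \<inter> - ?K"
    then obtain i where i: "i < degree P" "y \<in> curve i" unfolding level_eq by blast
    then have "cycle_of \<sigma> i = cycle_of \<sigma> j" using y by blast
    then show "y \<in> curve j \<inter> - ?K" using curve_cong i(2) y by blast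
  qed
  ultimately show ?thesis using that[of "- ?K"] open_Compl by blast
qed

text \<open>The curve through sheet \<open>j\<close>, run through by all of the real line; one turn around the circle per unit.\<close>

definition \<gamma> :: "nat \<Rightarrow> nat \<Rightarrow> real \<Rightarrow> complex" where
  "\<gamma> L j x = \<rho> ((\<sigma> ^^ nat (\<lfloor>x\<rfloor> mod int L)) j) (\<beta> + 2 * pi * (x - of_int \<lfloor>x\<rfloor>))"

section \<open>The periodic parametrization of one curve\<close>

context
  fixes j L :: nat
  assumes j: "j < degree P" and L: "L > 0" "(\<sigma> ^^ L) j = j" "inj_on (\<lambda>n. (\<sigma> ^^ n) j) {..<L}"
    "cycle_of \<sigma> j = (\<lambda>n. (\<sigma> ^^ n) j) ` {..<L}"
begin

definition sheet :: "int \<Rightarrow> nat" where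
  "sheet i = (\<sigma> ^^ nat (i mod int L)) j"

lemma sheet_in_cycle: "sheet i \<in> cycle_of \<sigma> j"
  by (auto simp: sheet_def cycle_of_def)

lemma sheet_less: "sheet i < degree P"
  using sheet_in_cycle cycle_less[OF j] by blast

lemma sheet_Suc: "sheet (i + 1) = \<sigma> (sheet i)"
proof -
  let ?m = "nat (i mod int L)"
  have m: "int ?m = i mod int L" "?m < L" using L(1) by (auto simp: nat_less_iff)
  have e: "(i + 1) mod int L = (int ?m + 1) mod int L" unfolding m(1) by (simp add: mod_add_left_eq)
  show ?thesis
  proof (cases "Suc ?m = L")
    case True
    then have "int ?m + 1 = int L" by linarith
    then have "sheet (i + 1) = j" unfolding sheet_def e by simp
    moreover have "\<sigma> (sheet i) = (\<sigma> ^^ Suc ?m) j" by (simp add: sheet_def)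
    ultimately show ?thesis using True L(2) by simp
  next
    case False
    then have "(int ?m + 1) mod int L = int (Suc ?m)" using m(2) by simp
    with e have "(i + 1) mod int L = int (Suc ?m)" by (rule trans)
    then have "nat ((i + 1) mod int L) = Suc ?m" by (simp only: nat_int)
    then show ?thesis by (simp add: sheet_def)
  qed
qed

lemma sheet_inj: "sheet i = sheet i' \<Longrightarrow> i mod int L = i' mod int L"
  using inj_onD[OF L(3), of "nat (i mod int L)" "nat (i' mod int L)"] L(1)
  by (auto simp: sheet_def nat_less_iff nat_eq_iff)

lemma \<gamma>_eq: "\<gamma> L j x = \<rho> (sheet \<lfloor>x\<rfloor>) (\<beta> + 2 * pi * (x - of_int \<lfloor>x\<rfloor>))"
  by (simp add: \<gamma>_def sheet_def)

lemma frac_in: "\<beta> + 2 * pi * (x - of_int \<lfloor>x\<rfloor>) \<in> {\<beta>..<\<beta> + 2 * pi}"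
proof -
  have "0 \<le> x - of_int \<lfloor>x\<rfloor>" "x - of_int \<lfloor>x\<rfloor> < 1" by linarith+
  then show ?thesis using mult_strict_left_mono[of "x - of_int \<lfloor>x\<rfloor>" 1 "2 * pi"] by simp
qed

text \<open>The formula holds at both ends of the unit interval, at the right end by passing to the
  next sheet; the pieces therefore fit together continuously.\<close>

lemma \<gamma>_piece:
  assumes "of_int i \<le> x" "x \<le> of_int i + 1"
  shows "\<gamma> L j x = \<rho> (sheet i) (\<beta> + 2 * pi * (x - of_int i))"
proof (cases "x = of_int i + 1")
  case True
  then have "\<lfloor>x\<rfloor> = i + 1" by simp
  then show ?thesis using True \<rho>_end[OF sheet_less[of i]] by (simp add: \<gamma>_eq sheet_Suc)
next
  case False
  then have "\<lfloor>x\<rfloor> = i" using assms by (simp add: floor_eq_iff)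
  then show ?thesis by (simp add: \<gamma>_eq)
qed

lemma continuous_\<gamma>: "continuous_on UNIV (\<gamma> L j)"
proof -
  have piece: "continuous_on {of_int i..of_int i + 1} (\<gamma> L j)" for i
  proof -
    have "continuous_on {of_int i..of_int i + 1} (\<lambda>x. \<rho> (sheet i) (\<beta> + 2 * pi * (x - of_int i)))"
    proof (rule continuous_on_compose2[of "{\<beta>..\<beta> + 2 * pi}" "\<rho> (sheet i)"])
      show "continuous_on {\<beta>..\<beta> + 2 * pi} (\<rho> (sheet i))"
        using sel sheet_less by (simp add: selection_def)
      show "(\<lambda>x. \<beta> + 2 * pi * (x - of_int i)) ` {of_int i..of_int i + 1} \<subseteq> {\<beta>..\<beta> + 2 * pi}"
      proof clarify
        fix x :: real assume "x \<in> {of_int i..of_int i + 1}"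
        then have "0 \<le> x - of_int i" "x - of_int i \<le> 1" by auto
        then show "\<beta> + 2 * pi * (x - of_int i) \<in> {\<beta>..\<beta> + 2 * pi}"
          using mult_left_mono[of "x - of_int i" 1 "2 * pi"] by simp
      qed
    qed (intro continuous_intros)
    then show ?thesis by (rule continuous_on_eq) (simp add: \<gamma>_piece[of i])
  qed
  have "isCont (\<gamma> L j) x" for x
  proof -
    let ?i = "\<lfloor>x\<rfloor>"
    have "continuous_on ({of_int (?i - 1)..of_int (?i - 1) + 1} \<union> {of_int ?i..of_int ?i + 1}) (\<gamma> L j)"
      by (intro continuous_on_closed_Un piece) auto
    then have "continuous_on {of_int ?i - 1<..<of_int ?i + 1} (\<gamma> L j)"
      by (rule continuous_on_subset) auto
    moreover have "x \<in> {of_int ?i - 1<..<of_int ?i + 1}" by simp linarith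
    ultimately show ?thesis by (simp add: continuous_on_eq_continuous_at)
  qed
  then show ?thesis by (simp add: continuous_on_eq_continuous_at)
qed

lemma ratio_\<gamma>: "ratio (\<gamma> L j x) = of_real c * cis (\<beta> + 2 * pi * x)"
proof -
  have "ratio (\<gamma> L j x) = of_real c * cis (\<beta> + 2 * pi * (x - of_int \<lfloor>x\<rfloor>))"
    unfolding \<gamma>_eq using frac_in[of x] sheet_less by (intro ratio_\<rho>) auto
  also have "cis (\<beta> + 2 * pi * (x - of_int \<lfloor>x\<rfloor>)) = cis (\<beta> + 2 * pi * x) / cis (2 * pi * of_int \<lfloor>x\<rfloor>)"
    by (simp add: cis_divide algebra_simps)
  also have "cis (2 * pi * of_int \<lfloor>x\<rfloor>) = 1" by (rule cis_multiple_2pi) simp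
  finally show ?thesis by simp
qed

text \<open>The value of \<open>ratio\<close> fixes the fractional part of the parameter; separation
  of the sheets inside a cycle then fixes the sheet, that is, the integer part modulo L.\<close>

lemma \<gamma>_inj:
  assumes "\<gamma> L j x = \<gamma> L j y"
  obtains m :: int where "x - y = of_int m * real L"
proof -
  let ?s = "\<lambda>x. \<beta> + 2 * pi * (x - of_int \<lfloor>x\<rfloor>)"
  have "of_real c * cis (?s x) = of_real c * cis (?s y)"
    using ratio_\<rho>[of "?s x" "sheet \<lfloor>x\<rfloor>"] ratio_\<rho>[of "?s y" "sheet \<lfloor>y\<rfloor>"] frac_in[of x] frac_in[of y]
      sheet_less assms unfolding \<gamma>_eq by auto
  then have s: "?s x = ?s y" using c_pos frac_in by (intro cis_eq_imp_eq) auto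
  then have fr: "x - of_int \<lfloor>x\<rfloor> = y - of_int \<lfloor>y\<rfloor>" using pi_gt_zero by auto
  have "sheet \<lfloor>x\<rfloor> = sheet \<lfloor>y\<rfloor>"
  proof (rule sep[of _ _ "?s x"])
    show "\<rho> (sheet \<lfloor>x\<rfloor>) (?s x) = \<rho> (sheet \<lfloor>y\<rfloor>) (?s x)" using assms s unfolding \<gamma>_eq by simp
    show "cycle_of \<sigma> (sheet \<lfloor>x\<rfloor>) = cycle_of \<sigma> (sheet \<lfloor>y\<rfloor>)" using cycle_eq[OF sheet_in_cycle] by metis
    show "?s x \<in> {\<beta>..\<beta> + 2 * pi}" using frac_in[of x] by auto
  qed (rule sheet_less)+
  then have "\<lfloor>x\<rfloor> mod int L = \<lfloor>y\<rfloor> mod int L" by (rule sheet_inj)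
  then obtain m where "\<lfloor>x\<rfloor> - \<lfloor>y\<rfloor> = int L * m" by (metis dvdE mod_eq_dvd_iff)
  then have "real_of_int \<lfloor>x\<rfloor> - real_of_int \<lfloor>y\<rfloor> = of_int m * real L"
    by (metis mult.commute of_int_diff of_int_mult of_int_of_nat_eq)
  then have "x - y = of_int m * real L" using fr by linarith
  then show ?thesis by (rule that)
qed

lemma \<gamma>_periodic: "\<gamma> L j (x + of_int m * real L) = \<gamma> L j x"
proof -
  have "x + of_int m * real L = x + of_int (m * int L)" by simp
  then have "\<lfloor>x + of_int m * real L\<rfloor> = \<lfloor>x\<rfloor> + m * int L" by (simp only: floor_add_int)
  moreover have "sheet (\<lfloor>x\<rfloor> + m * int L) = sheet \<lfloor>x\<rfloor>" by (simp add: sheet_def)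
  ultimately show ?thesis by (simp add: \<gamma>_eq)
qed

lemma range_\<gamma>: "range (\<gamma> L j) = curve j"
proof
  show "range (\<gamma> L j) \<subseteq> curve j"
  proof clarify
    fix x show "\<gamma> L j x \<in> curve j"
      unfolding \<gamma>_eq curve_def using sheet_in_cycle frac_in[of x] by (auto intro!: bexI[of _ "sheet \<lfloor>x\<rfloor>"])
  qed
  show "curve j \<subseteq> range (\<gamma> L j)"
  proof
    fix z assume "z \<in> curve j"
    then obtain i s where i: "i \<in> cycle_of \<sigma> j" "s \<in> {\<beta>..\<beta> + 2 * pi}" "z = \<rho> i s" by (auto simp: curve_def)
    obtain n where n: "n < L" "i = (\<sigma> ^^ n) j" using i(1) L(4) by auto
    have "sheet (int n) = i" using n by (simp add: sheet_def)
    then have "\<gamma> L j (of_int (int n) + (s - \<beta>) / (2 * pi)) = \<rho> i (\<beta> + 2 * pi * ((s - \<beta>) / (2 * pi)))"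
      using i(2) \<gamma>_piece[of "int n" "of_int (int n) + (s - \<beta>) / (2 * pi)"] by simp
    also have "\<dots> = z" using i(3) by simp
    finally show "z \<in> range (\<gamma> L j)" by blast
  qed
qed

text \<open>By injectivity modulo the period, one period rescaled to [0, 1] is a simple closed path,
  also when it runs through critical points.\<close>

lemma curve_homeomorphic_circle: "curve j homeomorphic sphere (0::complex) 1"
proof -
  let ?p = "\<lambda>t::real. \<gamma> L j (t * real L)"
  have per: "?p 1 = ?p 0" using \<gamma>_periodic[of 0 1] by simp
  have "simple_path ?p"
    unfolding simple_path_def loop_free_def
  proof (intro conjI ballI impI)
    show "path ?p" unfolding path_def
      by (rule continuous_on_compose2[OF continuous_\<gamma>]) (auto intro!: continuous_intros)
    fix x y :: real assume xy: "x \<in> {0..1}" "y \<in> {0..1}" "?p x = ?p y"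
    obtain m :: int where "x * real L - y * real L = of_int m * real L" using \<gamma>_inj[OF xy(3)] by auto
    then have "(x - y) * real L = of_int m * real L" by (simp add: algebra_simps)
    then have m: "x - y = of_int m" using L(1) by simp
    then have "of_int m \<le> (1::real)" "of_int m \<ge> (- 1 :: real)" using xy by auto
    then have "m \<in> {-1, 0, 1}" by auto
    then show "x = y \<or> x = 0 \<and> y = 1 \<or> x = 1 \<and> y = 0" using m xy(1,2) by auto
  qed
  then have "path_image ?p homeomorphic sphere (0::complex) 1"
    by (rule homeomorphic_simple_path_image_circle) (use per in \<open>auto simp: pathfinish_def pathstart_def\<close>)
  moreover have "path_image ?p = curve j"
  proof
    show "path_image ?p \<subseteq> curve j" unfolding path_image_def range_\<gamma>[symmetric] by auto
    show "curve j \<subseteq> path_image ?p"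
    proof
      fix z assume "z \<in> curve j"
      then obtain x where x: "z = \<gamma> L j x" using range_\<gamma> by blast
      let ?m = "\<lfloor>x / real L\<rfloor>" and ?t = "x / real L - of_int \<lfloor>x / real L\<rfloor>"
      have "0 \<le> ?t" "?t < 1" by linarith+
      then have "?t \<in> {0..1}" by simp
      moreover have "?p ?t = z"
        using \<gamma>_periodic[of "?t * real L" "?m"] L(1) x by (simp add: algebra_simps)
      ultimately show "z \<in> path_image ?p" unfolding path_image_def by blast
    qed
  qed
  ultimately show ?thesis by simp
qed

end

end

section \<open>Smoothness of curves without critical points\<close>

context sheets
begin

lemma finite_crit_level:
  assumes "z \<in> level c"
  shows "finite crit"
proof (rule finite_crit)
  have "ratio z \<noteq> 0" using assms level_iff[OF c_pos, of z] c_pos by auto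
  then have "poly R z \<noteq> 0" by (auto simp: ratio_def)
  then show "R \<noteq> 0" by auto
qed

context
  fixes j L :: nat
  assumes j: "j < degree P" and L: "L > 0" "(\<sigma> ^^ L) j = j" "inj_on (\<lambda>n. (\<sigma> ^^ n) j) {..<L}"
    "cycle_of \<sigma> j = (\<lambda>n. (\<sigma> ^^ n) j) ` {..<L}"
begin

text \<open>At a noncritical point the exponent is 1, and \<phi> turns the curve into an affine
  function of the parameter; 2 pi is the angle covered per unit.\<close>

lemma \<gamma>_chart:
  assumes nc: "\<gamma> L j x0 \<notin> crit"
  obtains r U \<phi> \<psi> d where "power_chart ratio (\<gamma> L j x0) 1 r U \<phi> \<psi>" "d > 0"
    "\<And>x. \<bar>x - x0\<bar> < d \<Longrightarrow> \<gamma> L j x \<in> U \<and> \<phi> (\<gamma> L j x) = complex_of_real (2 * pi * (x - x0))"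
proof -
  let ?z = "\<gamma> L j x0"
  have rz: "ratio ?z = of_real c * cis (\<beta> + 2 * pi * x0)" by (rule ratio_\<gamma>[OF j L])
  have nz: "ratio ?z \<noteq> 0" unfolding rz by (rule fibre_value_nonzero[OF c_pos])
  have o: "order ?z (fibre (ratio ?z)) = 1" using order_fibre_eq_1[OF nz] nc by blast
  obtain r U \<phi> \<psi> where ch: "power_chart ratio ?z (order ?z (fibre (ratio ?z))) r U \<phi> \<psi>"
    using chart_exists[OF nz open_UNIV UNIV_I] by metis
  have ch1: "power_chart ratio ?z 1 r U \<phi> \<psi>" using ch unfolding o .
  interpret power_chart ratio ?z 1 r U \<phi> \<psi> by (rule ch1)
  let ?h = "\<lambda>y. \<gamma> L j (y / (2 * pi))"
  have "continuous_on UNIV ?h"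
    by (rule continuous_on_compose2[OF continuous_\<gamma>[OF j L]]) (auto intro!: continuous_intros)
  then have cont: "continuous (at (2 * pi * x0) within UNIV) ?h"
    by (simp add: continuous_on_eq_continuous_at)
  have h0: "?h (2 * pi * x0) = ?z" by simp
  have rh: "ratio (?h y) = ratio ?z * exp (\<i> * complex_of_real (y - 2 * pi * x0))" for y
    unfolding rz ratio_\<gamma>[OF j L] by (simp add: cis_conv_exp mult.assoc algebra_simps flip: exp_add)
  obtain d where d: "d > 0" "\<And>y. y \<in> UNIV \<Longrightarrow> \<bar>y - 2 * pi * x0\<bar> < d \<Longrightarrow> ?h y \<in> U \<and> \<phi> (?h y) ^ 1 = complex_of_real (y - 2 * pi * x0)"
    using lift_power[OF cont h0 rh] by blast
  show ?thesis
  proof (rule that[OF ch1])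
    show "d / (2 * pi) > 0" using d(1) by simp
    fix x assume x: "\<bar>x - x0\<bar> < d / (2 * pi)"
    have "\<bar>2 * pi * x - 2 * pi * x0\<bar> = 2 * pi * \<bar>x - x0\<bar>"
      by (simp add: abs_mult flip: right_diff_distrib)
    also have "\<dots> < d" using x by (simp add: field_simps)
    finally have "?h (2 * pi * x) \<in> U \<and> \<phi> (?h (2 * pi * x)) ^ 1 = complex_of_real (2 * pi * x - 2 * pi * x0)"
      by (rule d(2)[OF UNIV_I])
    then show "\<gamma> L j x \<in> U \<and> \<phi> (\<gamma> L j x) = complex_of_real (2 * pi * (x - x0))"
      by (simp add: right_diff_distrib)
  qed
qed

definition circle_map :: "complex \<Rightarrow> complex" where
  "circle_map \<zeta> = \<gamma> L j (L * Arg2pi \<zeta> / (2 * pi))"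

text \<open>Any preimage may be chosen: two of them differ by a multiple of L, which is a whole
  number of turns of the circle.\<close>

definition circle_inv :: "complex \<Rightarrow> complex" where
  "circle_inv z = cis (2 * pi * (SOME x. \<gamma> L j x = z) / L)"

lemma circle_map_cis:
  fixes y :: real
  shows "circle_map (cis y) = \<gamma> L j (real L * y / (2 * pi))"
proof -
  let ?t = "Arg2pi (cis y)"
  have "cis y = of_real (cmod (cis y)) * exp (\<i> * of_real ?t)" by (rule Arg2pi_eq)
  then have "exp (\<i> * of_real y) = exp (\<i> * of_real ?t)" by (simp add: cis_conv_exp)
  then obtain n :: int where "\<i> * complex_of_real y = \<i> * of_real ?t + (of_int (2 * n) * pi) * \<i>"
    unfolding exp_eq by blast
  then have "Im (\<i> * complex_of_real y) = Im (\<i> * of_real ?t + (of_int (2 * n) * pi) * \<i>)" by simp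
  then have "y = ?t + 2 * pi * n" by (simp add: mult_ac)
  then have "real L * y / (2 * pi) = real L * (?t + 2 * pi * n) / (2 * pi)" by (rule arg_cong)
  also have "\<dots> = real L * ?t / (2 * pi) + of_int n * real L" by (simp add: field_simps)
  finally have "real L * y / (2 * pi) = real L * ?t / (2 * pi) + of_int n * real L" .
  then show ?thesis unfolding circle_map_def using \<gamma>_periodic[OF j L] by metis
qed

lemma circle_inv_\<gamma>: "circle_inv (\<gamma> L j x) = cis (2 * pi * x / L)"
proof -
  let ?y = "SOME y. \<gamma> L j y = \<gamma> L j x"
  have "\<gamma> L j ?y = \<gamma> L j x" by (rule someI[of _ x]) simp
  then obtain m :: int where "?y - x = of_int m * real L" by (rule \<gamma>_inj[OF j L])
  then have "?y = x + of_int m * real L" by simp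
  then have "2 * pi * ?y / L = 2 * pi * x / L + 2 * pi * of_int m" using L(1) by (simp add: field_simps)
  then have "cis (2 * pi * ?y / L) = cis (2 * pi * x / L) * cis (2 * pi * of_int m)" by (simp only: cis_mult)
  also have "cis (2 * pi * of_int m) = 1" by (rule cis_multiple_2pi) simp
  finally show ?thesis by (simp add: circle_inv_def)
qed

lemma sphere_eq_cis: "\<zeta> \<in> sphere 0 1 \<Longrightarrow> \<exists>y. \<zeta> = cis y"
  using Arg2pi_eq[of \<zeta>] by (auto simp: cis_conv_exp)

text \<open>On the circle near \<zeta>0 the angle from \<zeta>0 is -i Ln(\<zeta> / \<zeta>0). The
  map is therefore the restriction of the holomorphic function \<psi>(-i L Ln(\<zeta> /
  \<zeta>0)).\<close>

lemma smooth_circle_map: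
  assumes nc: "curve j \<inter> crit = {}"
  shows "smooth_on (sphere 0 1) circle_map"
proof (rule smooth_on_complexI)
  fix \<zeta>0 :: complex assume z0: "\<zeta>0 \<in> sphere 0 1"
  then obtain y0 where y0: "\<zeta>0 = cis y0" using sphere_eq_cis by blast
  let ?x0 = "L * y0 / (2 * pi)"
  have "\<gamma> L j ?x0 \<notin> crit" using nc range_\<gamma>[OF j L] by blast
  then obtain r U \<phi> \<psi> d where ch: "power_chart ratio (\<gamma> L j ?x0) 1 r U \<phi> \<psi>" and d: "d > 0"
    "\<And>x. \<bar>x - ?x0\<bar> < d \<Longrightarrow> \<gamma> L j x \<in> U \<and> \<phi> (\<gamma> L j x) = complex_of_real (2 * pi * (x - ?x0))"
    using \<gamma>_chart by metis
  interpret power_chart ratio "\<gamma> L j ?x0" 1 r U \<phi> \<psi> by (rule ch)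
  define s where "s = min r (2 * pi * d)"
  have s: "s > 0" "s \<le> r" "s \<le> 2 * pi * d" using r_pos d by (auto simp: s_def)
  \<comment> \<open>This half-plane keeps \<zeta> / \<zeta>0 off the branch cut of
    \<open>Ln\<close>.\<close>
  define D where "D = {\<zeta>. 0 < Re (\<zeta> / \<zeta>0)}"
  have D: "open D" unfolding D_def by (intro open_Collect_less continuous_intros)
     (use z0 in auto)
  have holq: "(\<lambda>\<zeta>. - \<i> * of_nat L * Ln (\<zeta> / \<zeta>0)) holomorphic_on D"
    using z0 by (intro holomorphic_intros) (auto simp: D_def complex_nonpos_Reals_iff)
  define V where "V = D \<inter> (\<lambda>\<zeta>. - \<i> * of_nat L * Ln (\<zeta> / \<zeta>0)) -` ball 0 s"
  have "open V" unfolding V_def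
    by (rule continuous_open_preimage[OF holomorphic_on_imp_continuous_on[OF holq] D open_ball])
  moreover have "\<zeta>0 \<in> V" using z0 s by (auto simp: V_def D_def)
  moreover have "(\<lambda>\<zeta>. \<psi> (- \<i> * of_nat L * Ln (\<zeta> / \<zeta>0))) holomorphic_on V"
  proof (rule holomorphic_on_compose_gen[OF _ hol_\<psi>, unfolded o_def])
    show "(\<lambda>\<zeta>. - \<i> * of_nat L * Ln (\<zeta> / \<zeta>0)) holomorphic_on V"
      using holq by (rule holomorphic_on_subset) (auto simp: V_def)
    show "(\<lambda>\<zeta>. - \<i> * of_nat L * Ln (\<zeta> / \<zeta>0)) ` V \<subseteq> ball 0 r" using s by (auto simp: V_def)
  qed
  moreover have "\<psi> (- \<i> * of_nat L * Ln (\<zeta> / \<zeta>0)) = circle_map \<zeta>" if \<zeta>: "\<zeta> \<in> sphere 0 1" "\<zeta> \<in> V" for \<zeta>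
  proof -
    let ?\<theta> = "Im (Ln (\<zeta> / \<zeta>0))"
    have ne: "\<zeta> / \<zeta>0 \<noteq> 0" "cmod (\<zeta> / \<zeta>0) = 1" using \<zeta> z0 by (auto simp: norm_divide)
    have "Re (Ln (\<zeta> / \<zeta>0)) = 0" using ne by (simp add: Re_Ln)
    then have Ln_eq: "Ln (\<zeta> / \<zeta>0) = \<i> * complex_of_real ?\<theta>" by (simp add: complex_eq_iff)
    have a: "- \<i> * of_nat L * Ln (\<zeta> / \<zeta>0) = complex_of_real (L * ?\<theta>)"
      by (subst Ln_eq) (simp add: algebra_simps)
    have "\<zeta> / \<zeta>0 = exp (Ln (\<zeta> / \<zeta>0))" using ne by simp
    also have "\<dots> = cis ?\<theta>" by (subst Ln_eq) (simp add: cis_conv_exp)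
    finally have "\<zeta> = cis (y0 + ?\<theta>)" using z0 unfolding y0 by (simp add: field_simps flip: cis_mult)
    then have cm: "circle_map \<zeta> = \<gamma> L j (L * (y0 + ?\<theta>) / (2 * pi))" using circle_map_cis by metis
    have "- \<i> * of_nat L * Ln (\<zeta> / \<zeta>0) \<in> ball 0 s" using \<zeta>(2) unfolding V_def by blast
    then have "complex_of_real (L * ?\<theta>) \<in> ball 0 s" unfolding a .
    then have small: "\<bar>L * ?\<theta>\<bar> < s" by (simp del: of_real_mult)
    have diff: "L * (y0 + ?\<theta>) / (2 * pi) - ?x0 = L * ?\<theta> / (2 * pi)" by (simp add: field_simps)
    have "\<bar>L * (y0 + ?\<theta>) / (2 * pi) - ?x0\<bar> < d"
      unfolding diff using small s(3) by (simp add: abs_divide field_simps)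
    then have "circle_map \<zeta> \<in> U \<and> \<phi> (circle_map \<zeta>) = complex_of_real (2 * pi * (L * ?\<theta> / (2 * pi)))"
      using d(2) unfolding cm diff[symmetric] by blast
    then have "circle_map \<zeta> \<in> U" "\<phi> (circle_map \<zeta>) = complex_of_real (L * ?\<theta>)" by auto
    then show ?thesis unfolding a using \<psi>\<phi> by metis
  qed
  ultimately show "\<exists>V f. open V \<and> \<zeta>0 \<in> V \<and> f holomorphic_on V \<and> (\<forall>y\<in>sphere 0 1. y \<in> V \<longrightarrow> f y = circle_map y)"
    by (intro exI[of _ V] exI[of _ "\<lambda>\<zeta>. \<psi> (- \<i> * of_nat L * Ln (\<zeta> / \<zeta>0))"] conjI ballI impI)
qed

text \<open>On the curve \<phi> is real and the parameter is x0 + \<phi> / (2 pi); so the inverse is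
  the restriction of an exponential of \<phi>.\<close>

lemma smooth_circle_inv:
  assumes nc: "curve j \<inter> crit = {}"
  shows "smooth_on (curve j) circle_inv"
proof (rule smooth_on_complexI)
  fix z0 assume z0: "z0 \<in> curve j"
  then obtain x0 where x0: "z0 = \<gamma> L j x0" using range_\<gamma>[OF j L] by blast
  have "\<gamma> L j x0 \<notin> crit" using nc z0 x0 by blast
  then obtain r U \<phi> \<psi> d where ch: "power_chart ratio (\<gamma> L j x0) 1 r U \<phi> \<psi>" and d: "d > 0"
    "\<And>x. \<bar>x - x0\<bar> < d \<Longrightarrow> \<gamma> L j x \<in> U \<and> \<phi> (\<gamma> L j x) = complex_of_real (2 * pi * (x - x0))"
    using \<gamma>_chart by metis
  interpret power_chart ratio "\<gamma> L j x0" 1 r U \<phi> \<psi> by (rule ch)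
  define s where "s = min r (2 * pi * d)"
  have s: "s > 0" "s \<le> r" "s \<le> 2 * pi * d" using r_pos d by (auto simp: s_def)
  let ?V = "\<psi> ` ball 0 s" and ?G = "\<lambda>z. cis (2 * pi * x0 / L) * exp (\<i> * \<phi> z / of_nat L)"
  interpret c: power_chart ratio "\<gamma> L j x0" 1 s ?V \<phi> \<psi> by (rule restrict[OF s(1,2)])
  have "?G holomorphic_on ?V" using L(1) by (intro holomorphic_intros c.hol_\<phi>) auto
  moreover have "?G y = circle_inv y" if y: "y \<in> curve j" "y \<in> ?V" for y
  proof -
    have "cmod (ratio y) = c" "cmod (ratio (\<gamma> L j x0)) = c"
      using curve_subset_level[OF j] y(1) z0 x0 level_iff[OF c_pos] by auto
    then have "Im (\<phi> y) = 0" using c.norm_f[OF y(2)] by simp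
    then have w: "\<phi> y = complex_of_real (Re (\<phi> y))" by (simp add: complex_eq_iff)
    have "\<phi> y \<in> ball 0 s" by (rule c.\<phi>_in[OF y(2)])
    then have "\<bar>Re (\<phi> y)\<bar> < s" using abs_Re_le_cmod[of "\<phi> y"] by simp
    then have "\<bar>Re (\<phi> y) / (2 * pi)\<bar> < d" using s(3) by (simp add: abs_divide field_simps)
    then have g: "\<gamma> L j (x0 + Re (\<phi> y) / (2 * pi)) \<in> U"
      "\<phi> (\<gamma> L j (x0 + Re (\<phi> y) / (2 * pi))) = complex_of_real (Re (\<phi> y))"
      using d(2)[of "x0 + Re (\<phi> y) / (2 * pi)"] by auto
    have yU: "y \<in> U" using y(2) image_ball[OF s(1,2)] by blast
    have "\<phi> (\<gamma> L j (x0 + Re (\<phi> y) / (2 * pi))) = \<phi> y" unfolding g(2) by (rule w[symmetric])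
    then have "\<psi> (\<phi> (\<gamma> L j (x0 + Re (\<phi> y) / (2 * pi)))) = \<psi> (\<phi> y)" by (rule arg_cong)
    then have ye: "\<gamma> L j (x0 + Re (\<phi> y) / (2 * pi)) = y" unfolding \<psi>\<phi>[OF g(1)] \<psi>\<phi>[OF yU] .
    have "circle_inv y = cis (2 * pi * (x0 + Re (\<phi> y) / (2 * pi)) / L)"
      using circle_inv_\<gamma>[of "x0 + Re (\<phi> y) / (2 * pi)"] unfolding ye .
    also have "2 * pi * (x0 + Re (\<phi> y) / (2 * pi)) / L = 2 * pi * x0 / L + Re (\<phi> y) / L"
      using L(1) by (simp add: field_simps)
    also have "cis \<dots> = cis (2 * pi * x0 / L) * cis (Re (\<phi> y) / L)" by (simp add: cis_mult)
    also have "cis (Re (\<phi> y) / L) = exp (\<i> * \<phi> y / of_nat L)"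
      by (subst w) (simp add: cis_conv_exp)
    finally show ?thesis by simp
  qed
  ultimately show "\<exists>V f. open V \<and> z0 \<in> V \<and> f holomorphic_on V \<and> (\<forall>y\<in>curve j. y \<in> V \<longrightarrow> f y = circle_inv y)"
    using c.open_U c.z0_in x0 by (intro exI[of _ ?V] exI[of _ ?G] conjI ballI impI) simp_all
qed

lemma smooth_closed_curve_aux:
  assumes nc: "curve j \<inter> crit = {}"
  shows "smooth_closed_curve (curve j)"
proof -
  have Lr: "real L > 0" using L(1) by simp
  have fg: "circle_map (circle_inv z) = z" if "z \<in> curve j" for z
  proof -
    obtain x where x: "z = \<gamma> L j x" using \<open>z \<in> _\<close> range_\<gamma>[OF j L] by blast
    have "circle_map (cis (2 * pi * x / L)) = \<gamma> L j (L * (2 * pi * x / L) / (2 * pi))" by (rule circle_map_cis)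
    also have "L * (2 * pi * x / L) / (2 * pi) = x" using Lr by simp
    finally show ?thesis unfolding x circle_inv_\<gamma> .
  qed
  have gf: "circle_inv (circle_map \<zeta>) = \<zeta>" if "\<zeta> \<in> sphere 0 1" for \<zeta>
  proof -
    obtain y where y: "\<zeta> = cis y" using \<open>\<zeta> \<in> _\<close> sphere_eq_cis by blast
    have "2 * pi * (L * y / (2 * pi)) / L = y" using Lr by simp
    then show ?thesis unfolding y circle_map_cis circle_inv_\<gamma> by simp
  qed
  have "homeomorphism (sphere 0 1) (curve j) circle_map circle_inv"
  proof (rule homeomorphismI)
    show "circle_map ` sphere 0 1 \<subseteq> curve j" unfolding circle_map_def range_\<gamma>[OF j L, symmetric] by auto
    show "circle_inv ` curve j \<subseteq> sphere 0 1" by (auto simp: circle_inv_def)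
  qed (use smooth_on_imp_continuous_on smooth_circle_map[OF nc] smooth_circle_inv[OF nc] fg gf in blast)+
  then show ?thesis unfolding smooth_closed_curve_def diffeomorphic_def
    using smooth_circle_map[OF nc] smooth_circle_inv[OF nc] by blast
qed

end

lemma curve_closed_curve:
  assumes j: "j < degree P"
  shows "curve j homeomorphic sphere (0::complex) 1"
    and "curve j \<inter> crit = {} \<Longrightarrow> smooth_closed_curve (curve j)"
proof -
  obtain L where L: "L > 0" "(\<sigma> ^^ L) j = j" "inj_on (\<lambda>n. (\<sigma> ^^ n) j) {..<L}"
    "cycle_of \<sigma> j = (\<lambda>n. (\<sigma> ^^ n) j) ` {..<L}"
    using cycle_of_period[OF \<sigma>_permutes finite_lessThan] .
  show "curve j homeomorphic sphere (0::complex) 1" by (rule curve_homeomorphic_circle[OF j L])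
  show "smooth_closed_curve (curve j)" if "curve j \<inter> crit = {}" by (rule smooth_closed_curve_aux[OF j L that])
qed

lemma regular_point: "j < degree P \<Longrightarrow> \<rho> j \<beta> \<in> curve j \<and> \<rho> j \<beta> \<notin> crit"
proof
  assume j: "j < degree P"
  have b: "\<beta> \<in> {\<beta>..\<beta> + 2 * pi}" by simp
  then have "\<rho> j \<beta> \<in> \<rho> j ` {\<beta>..\<beta> + 2 * pi}" by (rule imageI)
  then show "\<rho> j \<beta> \<in> curve j" unfolding curve_def by (rule UN_I[OF self_in_cycle_of])
  show "\<rho> j \<beta> \<notin> crit" by (rule regular[OF ratio_\<rho>[OF b j]])
qed

end

section \<open>Double points\<close>

lemma continuous_sign_const:
  fixes q :: "real \<Rightarrow> complex"
  assumes "continuous_on S q" "connected S" "\<And>x. x \<in> S \<Longrightarrow> q x \<in> {1, -1}"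
  obtains e where "e \<in> {1, -1}" "\<And>x. x \<in> S \<Longrightarrow> q x = e"
proof (cases "S = {}")
  case False
  have "finite (q ` S)" using assms(3) by (intro finite_subset[of "q ` S" "{1, -1}"]) auto
  then have "q constant_on S" using continuous_finite_range_constant[OF assms(2,1)] by blast
  then obtain e where e: "\<And>x. x \<in> S \<Longrightarrow> q x = e" by (auto simp: constant_on_def)
  then show ?thesis using that[of e] False assms(3) by (metis all_not_in_conv)
qed (use that[of 1] in auto)

context sheets
begin

text \<open>The chart image of the sheet squares to s - s0: before the collision it is on the
  imaginary axis, afterwards on the real axis, and on either side its sign is constant by
  continuity. This is the turn by a right angle.\<close>

lemma sheet_rays:
  assumes ch: "power_chart ratio z 2 r U \<phi> \<psi>" and j: "j < degree P" and s0: "\<beta> < s0" "s0 < \<beta> + 2 * pi"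
    and z: "\<rho> j s0 = z"
  obtains d e e' where "d > 0" "\<beta> < s0 - d" "s0 + d < \<beta> + 2 * pi" "e \<in> {1, -1}" "e' \<in> {1, -1}"
    "\<And>s. \<bar>s - s0\<bar> < d \<Longrightarrow> \<rho> j s \<in> U"
    "\<And>s. s0 \<le> s \<Longrightarrow> s - s0 < d \<Longrightarrow> \<phi> (\<rho> j s) = e * complex_of_real (sqrt (s - s0))"
    "\<And>s. s \<le> s0 \<Longrightarrow> s0 - s < d \<Longrightarrow> \<phi> (\<rho> j s) = e' * (\<i> * complex_of_real (sqrt (s0 - s)))"
proof -
  interpret power_chart ratio z 2 r U \<phi> \<psi> by (rule ch)
  let ?T = "{\<beta>..\<beta> + 2 * pi}"
  have s0T: "s0 \<in> ?T" using s0 by simp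
  have contT: "continuous_on ?T (\<rho> j)" using sel j by (simp add: selection_def)
  then have cont: "continuous (at s0 within ?T) (\<rho> j)" using s0T by (simp add: continuous_on_eq_continuous_within)
  have rz: "ratio z = of_real c * cis s0" using ratio_\<rho>[OF s0T j] z by simp
  have rh: "ratio (\<rho> j s) = ratio z * exp (\<i> * complex_of_real (s - s0))" if "s \<in> ?T" for s
    unfolding rz ratio_\<rho>[OF that j] by (simp add: cis_conv_exp mult.assoc algebra_simps flip: exp_add)
  obtain d0 where d0: "d0 > 0" "\<And>s. s \<in> ?T \<Longrightarrow> \<bar>s - s0\<bar> < d0 \<Longrightarrow> \<rho> j s \<in> U \<and> \<phi> (\<rho> j s) ^ 2 = complex_of_real (s - s0)"
    using lift_power[OF cont z rh] by blast
  \<comment> \<open>Half the distances to the ends of the turn leave room on both sides of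
    s0.\<close>
  define d where "d = min d0 (min ((s0 - \<beta>) / 2) ((\<beta> + 2 * pi - s0) / 2))"
  have le: "d \<le> d0" "d \<le> (s0 - \<beta>) / 2" "d \<le> (\<beta> + 2 * pi - s0) / 2" unfolding d_def by linarith+
  have "d > 0" using d0(1) s0 by (simp add: d_def)
  moreover have "\<beta> < s0 - d" using le(2) s0(1) by (simp add: field_simps)
  moreover have "s0 + d < \<beta> + 2 * pi" using le(3) s0(2) by (simp add: field_simps)
  ultimately have d: "d > 0" "d \<le> d0" "\<beta> < s0 - d" "s0 + d < \<beta> + 2 * pi"
    using le(1) by blast+
  have inT: "s \<in> ?T" if "\<bar>s - s0\<bar> < d" for s using that d(3,4) by (auto simp: abs_less_iff)
  have inU: "\<rho> j s \<in> U" and sq: "\<phi> (\<rho> j s) ^ 2 = complex_of_real (s - s0)" if "\<bar>s - s0\<bar> < d" for s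
    using d0(2)[OF inT[OF that]] that d(2) by auto
  have cont\<phi>: "continuous_on {s. \<bar>s - s0\<bar> < d} (\<lambda>s. \<phi> (\<rho> j s))"
    by (rule continuous_on_compose2[OF holomorphic_on_imp_continuous_on[OF hol_\<phi>]])
      (use inU inT in \<open>auto intro!: continuous_on_subset[OF contT]\<close>)
  have pm: "x / y \<in> {1, -1}" if "x\<^sup>2 = y\<^sup>2" "y \<noteq> 0" for x y :: complex
    using that by (auto simp: power2_eq_iff)
  obtain e where e: "e \<in> {1, -1}" "\<And>s. s \<in> {s0<..<s0 + d} \<Longrightarrow> \<phi> (\<rho> j s) / complex_of_real (sqrt (s - s0)) = e"
  proof (rule continuous_sign_const)
    show "continuous_on {s0<..<s0 + d} (\<lambda>s. \<phi> (\<rho> j s) / complex_of_real (sqrt (s - s0)))"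
      by (intro continuous_intros continuous_on_subset[OF cont\<phi>]) auto
    fix s assume s: "s \<in> {s0<..<s0 + d}"
    have "(complex_of_real (sqrt (s - s0)))\<^sup>2 = complex_of_real (s - s0)"
      using s by (simp flip: of_real_power)
    then show "\<phi> (\<rho> j s) / complex_of_real (sqrt (s - s0)) \<in> {1, -1}"
      using s sq[of s] by (intro pm) auto
  qed (simp, blast)
  obtain e' where e': "e' \<in> {1, -1}" "\<And>s. s \<in> {s0 - d<..<s0} \<Longrightarrow> \<phi> (\<rho> j s) / (\<i> * complex_of_real (sqrt (s0 - s))) = e'"
  proof (rule continuous_sign_const)
    show "continuous_on {s0 - d<..<s0} (\<lambda>s. \<phi> (\<rho> j s) / (\<i> * complex_of_real (sqrt (s0 - s))))"
      by (intro continuous_intros continuous_on_subset[OF cont\<phi>]) auto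
    fix s assume s: "s \<in> {s0 - d<..<s0}"
    have "(\<i> * complex_of_real (sqrt (s0 - s)))\<^sup>2 = complex_of_real (s - s0)"
      using s by (simp add: power_mult_distrib flip: of_real_power)
    then show "\<phi> (\<rho> j s) / (\<i> * complex_of_real (sqrt (s0 - s))) \<in> {1, -1}"
      using s sq[of s] by (intro pm) auto
  qed (simp, blast)
  show ?thesis
  proof (rule that[OF d(1,3,4) e(1) e'(1) inU])
    fix s assume s: "s0 \<le> s" "s - s0 < d"
    show "\<phi> (\<rho> j s) = e * complex_of_real (sqrt (s - s0))"
    proof (cases "s = s0")
      case True
      then show ?thesis by (simp add: z \<phi>_z0)
    next
      case False
      then show ?thesis using e(2)[of s] s by (auto simp: field_simps)
    qed
  next
    fix s assume s: "s \<le> s0" "s0 - s < d"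
    show "\<phi> (\<rho> j s) = e' * (\<i> * complex_of_real (sqrt (s0 - s)))"
    proof (cases "s = s0")
      case True
      then show ?thesis by (simp add: z \<phi>_z0)
    next
      case False
      then show ?thesis using e'(2)[of s] s by (auto simp: field_simps)
    qed
  qed auto
qed

text \<open>The sheets j and k share the four rays, with opposite signs. A point of the curve near z
  lies on one of them at its own angle, and not on k, which belongs to another cycle; so the curve
  has just two perpendicular arms.\<close>

lemma ray_arms:
  assumes ch: "power_chart ratio z 2 r U \<phi> \<psi>" and U: "U \<subseteq> {z. poly P z \<noteq> 0} - (crit - {z})"
    and jk: "j < degree P" "k < degree P" "cycle_of \<sigma> j \<noteq> cycle_of \<sigma> k"
    and s0: "\<beta> < s0" "s0 < \<beta> + 2 * pi" and d: "d > 0" "\<beta> < s0 - d" "s0 + d < \<beta> + 2 * pi"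
    and q: "0 < q" "q \<le> r" "q\<^sup>2 < d"
    and inU: "\<And>s. \<bar>s - s0\<bar> < d \<Longrightarrow> \<rho> j s \<in> U" "\<And>s. \<bar>s - s0\<bar> < d \<Longrightarrow> \<rho> k s \<in> U"
    and ee: "e \<in> {1, -1}" "e' \<in> {1, -1}"
    and z: "\<rho> j s0 = z" "z \<in> crit" "ratio z = of_real c * cis s0"
    and out: "\<And>s. s0 \<le> s \<Longrightarrow> s - s0 < d \<Longrightarrow> \<phi> (\<rho> j s) = e * complex_of_real (sqrt (s - s0))"
      "\<And>s. s0 \<le> s \<Longrightarrow> s - s0 < d \<Longrightarrow> \<phi> (\<rho> k s) = - e * complex_of_real (sqrt (s - s0))"
    and inn: "\<And>s. s \<le> s0 \<Longrightarrow> s0 - s < d \<Longrightarrow> \<phi> (\<rho> j s) = e' * (\<i> * complex_of_real (sqrt (s0 - s)))"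
      "\<And>s. s \<le> s0 \<Longrightarrow> s0 - s < d \<Longrightarrow> \<phi> (\<rho> k s) = - e' * (\<i> * complex_of_real (sqrt (s0 - s)))"
  shows "curve j \<inter> \<psi> ` ball 0 q = \<psi> ` arms (e' * \<i>) e q"
proof (intro equalityI subsetI)
  interpret power_chart ratio z 2 r U \<phi> \<psi> by (rule ch)
  have sub: "curve j \<subseteq> level c" by (rule curve_subset_level[OF jk(1)])
  have cz: "cmod (ratio z) = c" using z(3) c_pos by (simp add: norm_mult)
  have in_curve: "\<rho> j s \<in> curve j" if "\<bar>s - s0\<bar> < d" for s
  proof -
    have "s \<in> {\<beta>..\<beta> + 2 * pi}" using that d by (auto simp: abs_less_iff)
    then show ?thesis unfolding curve_def by (intro UN_I[OF self_in_cycle_of] imageI)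
  qed
  fix u assume "u \<in> curve j \<inter> \<psi> ` ball 0 q"
  then have u: "u \<in> curve j" "u \<in> U" "\<phi> u \<in> ball 0 q" unfolding image_ball[OF q(1,2)] by auto
  obtain i s where i: "i \<in> cycle_of \<sigma> j" "s \<in> {\<beta>..<\<beta> + 2 * pi}" "u = \<rho> i s"
    using curve_halfopen[OF jk(1) u(1)] .
  have iP: "i < degree P" using cycle_less[OF jk(1) i(1)] .
  have sT: "s \<in> {\<beta>..\<beta> + 2 * pi}" using i(2) by auto
  define w where "w = \<phi> u"
  have wr: "cmod w < q" using u(3) by (simp add: w_def)
  have "cmod (ratio u) = cmod (ratio z)" using u(1) sub level_iff[OF c_pos] cz by auto
  then have im: "Im (w\<^sup>2) = 0" using norm_f[OF u(2)] by (simp add: w_def)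
  define t where "t = Re (w\<^sup>2)"
  have w2: "w\<^sup>2 = complex_of_real t" using im by (simp add: t_def complex_eq_iff)
  have td: "\<bar>t\<bar> < d"
  proof -
    have "\<bar>t\<bar> = (cmod w)\<^sup>2" using w2 by (metis norm_of_real norm_power)
    also have "\<dots> < q\<^sup>2" using wr by (intro power_strict_mono) auto
    finally show ?thesis using q by simp
  qed
  have "of_real c * cis s = ratio u" using ratio_\<rho>[OF sT iP] i(3) by simp
  also have "\<dots> = of_real c * cis s0 * exp (\<i> * of_real t)"
    using f_eq[OF u(2)] w2 unfolding w_def by (simp add: z(3))
  also have "\<dots> = of_real c * cis (s0 + t)" by (simp add: cis_conv_exp algebra_simps flip: exp_add)
  finally have "cis s = cis (s0 + t)" using c_pos by simp
  then have s: "s = s0 + t" using i(2) td d by (intro cis_eq_imp_eq) (auto simp: abs_less_iff)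
  have s_near: "\<bar>s - s0\<bar> < d" using s td by simp
  show "u \<in> \<psi> ` arms (e' * \<i>) e q"
  proof (cases "u = z")
    case True
    have "0 \<in> arms (e' * \<i>) e q" using q by (auto simp: arms_def image_iff intro!: bexI[of _ 0])
    then have "\<psi> 0 \<in> \<psi> ` arms (e' * \<i>) e q" by (rule imageI)
    then show ?thesis using True \<psi>_0 by simp
  next
    case False
    \<comment> \<open>The chart domain contains no critical point besides z, so a single sheet
      passes through u.\<close>
    then have nc: "u \<notin> crit" using U u(2) by blast
    have unique: "l = i" if "l < degree P" "\<rho> l s = u" for l
      using selection_regular[OF c_pos sel sT iP that(1)] that(2) i(3) nc by simp
    have notk: "\<rho> k s \<noteq> u" using unique[OF jk(2)] jk(3) cycle_eq[OF i(1)] by auto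
    have eqj: "\<rho> j s = u \<or> \<rho> k s = u"
    proof -
      have "w\<^sup>2 = (\<phi> (\<rho> j s))\<^sup>2 \<and> \<phi> (\<rho> k s) = - \<phi> (\<rho> j s)"
      proof (cases "s0 \<le> s")
        case True
        have "e\<^sup>2 = 1" using ee by auto
        then have "(\<phi> (\<rho> j s))\<^sup>2 = complex_of_real (s - s0)"
          using out(1)[of s] True s_near by (simp add: power_mult_distrib flip: of_real_power)
        then show ?thesis using out[of s] True s_near s w2 by simp
      next
        case False
        have "e'\<^sup>2 = 1" using ee by auto
        then have "(\<phi> (\<rho> j s))\<^sup>2 = complex_of_real (s - s0)"
          using inn(1)[of s] False s_near by (simp add: power_mult_distrib flip: of_real_power)
        then show ?thesis using inn[of s] False s_near s w2 by simp
      qed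
      then have "\<phi> u = \<phi> (\<rho> j s) \<or> \<phi> u = \<phi> (\<rho> k s)" unfolding w_def by (metis power2_eq_iff)
      then show ?thesis using \<psi>\<phi>[OF u(2)] \<psi>\<phi>[OF inU(1)[OF s_near]] \<psi>\<phi>[OF inU(2)[OF s_near]] by metis
    qed
    then have uj: "u = \<rho> j s" using notk by blast
    have "w \<in> arms (e' * \<i>) e q"
    proof (cases "s0 \<le> s")
      case True
      let ?y = "sqrt (s - s0)"
      have "w = e * complex_of_real ?y" using out(1)[of s] True s_near uj by (simp add: w_def)
      moreover then have "cmod w = ?y" using ee True by (auto simp: norm_mult)
      then have "?y \<in> {0..<q}" using wr True by simp
      ultimately show ?thesis unfolding arms_def by blast
    next
      case False
      let ?y = "sqrt (s0 - s)"
      have "w = (e' * \<i>) * complex_of_real ?y" using inn(1)[of s] False s_near uj by (simp add: w_def)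
      moreover then have "cmod w = ?y" using ee False by (auto simp: norm_mult)
      then have "?y \<in> {0..<q}" using wr False by simp
      ultimately show ?thesis unfolding arms_def by blast
    qed
    then have "\<psi> w \<in> \<psi> ` arms (e' * \<i>) e q" by (rule imageI)
    then show ?thesis using \<psi>\<phi>[OF u(2)] by (simp add: w_def)
  qed
next
  interpret power_chart ratio z 2 r U \<phi> \<psi> by (rule ch)
  have in_curve: "\<rho> j s \<in> curve j" if "\<bar>s - s0\<bar> < d" for s
  proof -
    have "s \<in> {\<beta>..\<beta> + 2 * pi}" using that d by (auto simp: abs_less_iff)
    then show ?thesis unfolding curve_def by (intro UN_I[OF self_in_cycle_of] imageI)
  qed
  fix u assume "u \<in> \<psi> ` arms (e' * \<i>) e q"
  then obtain w where w: "w \<in> arms (e' * \<i>) e q" "u = \<psi> w" by blast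
  then consider y where "y \<in> {0..<q}" "w = e * complex_of_real y" | y where "y \<in> {0..<q}" "w = e' * \<i> * complex_of_real y"
    unfolding arms_def by blast
  then have "u \<in> curve j"
  proof cases
    case (1 y)
    have "y\<^sup>2 < q\<^sup>2" using 1 by (intro power_strict_mono) auto
    then have y: "y\<^sup>2 < d" using q by simp
    have n: "\<bar>s0 + y\<^sup>2 - s0\<bar> < d" using y by simp
    have "\<phi> (\<rho> j (s0 + y\<^sup>2)) = w" using out(1)[of "s0 + y\<^sup>2"] 1 y by simp
    then have "\<rho> j (s0 + y\<^sup>2) = u" using \<psi>\<phi>[OF inU(1)[OF n]] w(2) by simp
    then show ?thesis using in_curve[OF n] by simp
  next
    case (2 y)
    have "y\<^sup>2 < q\<^sup>2" using 2 by (intro power_strict_mono) auto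
    then have y: "y\<^sup>2 < d" using q by simp
    have n: "\<bar>s0 - y\<^sup>2 - s0\<bar> < d" using y by simp
    have "\<phi> (\<rho> j (s0 - y\<^sup>2)) = w" using inn(1)[of "s0 - y\<^sup>2"] 2 y by simp
    then have "\<rho> j (s0 - y\<^sup>2) = u" using \<psi>\<phi>[OF inU(1)[OF n]] w(2) by simp
    then show ?thesis using in_curve[OF n] by simp
  qed
moreover have "w \<in> ball 0 q" using w(1) ee by (auto simp: arms_def norm_mult)
  then have "u \<in> \<psi> ` ball 0 q" using w(2) by blast
  ultimately show "u \<in> curve j \<inter> \<psi> ` ball 0 q" by blast
qed

text \<open>Multiplicity two means that exactly two sheets pass through z; separation puts them into
  different cycles, so two curves meet. Off z the sheets differ, which forces opposite signs both
  before and after the collision.\<close>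

lemma double_point:
  assumes z: "z \<in> crit" "z \<in> level c" and ord: "order z (fibre (ratio z)) = 2"
  shows "\<exists>C D. C \<noteq> D \<and> {B \<in> curve ` {..<degree P}. z \<in> B} = {C, D} \<and>
     \<not> differentiable_curve_at C z \<and> \<not> differentiable_curve_at D z \<and> right_angle_contact C D z"
proof -
  have cz: "cmod (ratio z) = c" and Pz: "poly P z \<noteq> 0" using z(2) level_iff[OF c_pos] by auto
  then have nz: "ratio z \<noteq> 0" using c_pos by auto
  obtain j0 where j0: "j0 < degree P" "z \<in> curve j0" using z(2) unfolding level_eq by blast
  obtain i0 s0 where i0: "i0 \<in> cycle_of \<sigma> j0" "s0 \<in> {\<beta>..<\<beta> + 2 * pi}" "z = \<rho> i0 s0"
    using curve_halfopen[OF j0] .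
  have i0P: "i0 < degree P" using cycle_less[OF j0(1) i0(1)] .
  have s0T: "s0 \<in> {\<beta>..\<beta> + 2 * pi}" using i0(2) by auto
  have rz: "ratio z = of_real c * cis s0" using ratio_\<rho>[OF s0T i0P] i0(3) by simp
  have "s0 \<noteq> \<beta>" using regular[of z] z(1) rz by auto
  then have s0: "\<beta> < s0" "s0 < \<beta> + 2 * pi" using i0(2) by auto
  have "card {j. j < degree P \<and> \<rho> j s0 = z} = 2"
    using selection_card[OF c_pos sel s0T, of z] ord rz by simp
  then obtain j k where jk: "{j. j < degree P \<and> \<rho> j s0 = z} = {j, k}" "j \<noteq> k" by (metis card_2_iff)
  have "j \<in> {j. j < degree P \<and> \<rho> j s0 = z}" "k \<in> {j. j < degree P \<and> \<rho> j s0 = z}" unfolding jk by auto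
  then have j: "j < degree P" "\<rho> j s0 = z" and k: "k < degree P" "\<rho> k s0 = z" by auto
  have cyc: "cycle_of \<sigma> j \<noteq> cycle_of \<sigma> k" using sep[OF j(1) k(1) s0T] j k jk(2) by auto
  have "open (- (crit - {z}))" using finite_crit_level[OF z(2)] by (intro open_Compl finite_imp_closed finite_Diff)
  moreover have "z \<in> - (crit - {z})" by simp
  ultimately obtain r U \<phi> \<psi> where "power_chart ratio z (order z (fibre (ratio z))) r U \<phi> \<psi>"
     and U: "U \<subseteq> - (crit - {z})" "U \<subseteq> {z. poly P z \<noteq> 0}"
    using chart_exists[OF nz] by metis
  then have ch: "power_chart ratio z 2 r U \<phi> \<psi>" by (simp only: ord)
  interpret power_chart ratio z 2 r U \<phi> \<psi> by (rule ch)
  obtain d1 e1 e1' where 1: "d1 > 0" "\<beta> < s0 - d1" "s0 + d1 < \<beta> + 2 * pi" "e1 \<in> {1, -1}" "e1' \<in> {1, -1}"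
    "\<And>s. \<bar>s - s0\<bar> < d1 \<Longrightarrow> \<rho> j s \<in> U"
    "\<And>s. s0 \<le> s \<Longrightarrow> s - s0 < d1 \<Longrightarrow> \<phi> (\<rho> j s) = e1 * complex_of_real (sqrt (s - s0))"
    "\<And>s. s \<le> s0 \<Longrightarrow> s0 - s < d1 \<Longrightarrow> \<phi> (\<rho> j s) = e1' * (\<i> * complex_of_real (sqrt (s0 - s)))"
    using sheet_rays[OF ch j(1) s0 j(2)] by metis
  obtain d2 e2 e2' where 2: "d2 > 0" "\<beta> < s0 - d2" "s0 + d2 < \<beta> + 2 * pi" "e2 \<in> {1, -1}" "e2' \<in> {1, -1}"
    "\<And>s. \<bar>s - s0\<bar> < d2 \<Longrightarrow> \<rho> k s \<in> U"
    "\<And>s. s0 \<le> s \<Longrightarrow> s - s0 < d2 \<Longrightarrow> \<phi> (\<rho> k s) = e2 * complex_of_real (sqrt (s - s0))"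
    "\<And>s. s \<le> s0 \<Longrightarrow> s0 - s < d2 \<Longrightarrow> \<phi> (\<rho> k s) = e2' * (\<i> * complex_of_real (sqrt (s0 - s)))"
    using sheet_rays[OF ch k(1) s0 k(2)] by metis
  define d where "d = min d1 d2"
  have d: "d > 0" "d \<le> d1" "d \<le> d2" "\<beta> < s0 - d" "s0 + d < \<beta> + 2 * pi" using 1 2 by (auto simp: d_def)
  have differ: "\<phi> (\<rho> j s) \<noteq> \<phi> (\<rho> k s)" if s: "\<bar>s - s0\<bar> < d" "\<phi> (\<rho> j s) \<noteq> 0" for s
  proof
    assume eq: "\<phi> (\<rho> j s) = \<phi> (\<rho> k s)"
    have inU: "\<rho> j s \<in> U" "\<rho> k s \<in> U" using 1(6) 2(6) s(1) d by auto
    then have eq': "\<rho> j s = \<rho> k s" using \<psi>\<phi> eq by metis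
    have "\<rho> j s \<noteq> z" using s(2) \<phi>_z0 by auto
    then have "\<rho> j s \<notin> crit" using U(1) inU(1) by blast
    moreover have "s \<in> {\<beta>..\<beta> + 2 * pi}" using s(1) d by (auto simp: abs_less_iff)
    ultimately show False using selection_regular[OF c_pos sel _ j(1) k(1) eq'] jk(2) by blast
  qed
  have e2: "e2 = - e1"
  proof -
    have "e2 \<noteq> e1" using differ[of "s0 + d / 2"] 1(7)[of "s0 + d / 2"] 2(7)[of "s0 + d / 2"] 1(4) d by auto
    then show ?thesis using 1(4) 2(4) by auto
  qed
  have e2': "e2' = - e1'"
  proof -
    have "e2' \<noteq> e1'" using differ[of "s0 - d / 2"] 1(8)[of "s0 - d / 2"] 2(8)[of "s0 - d / 2"] 1(5) d by auto
    then show ?thesis using 1(5) 2(5) by auto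
  qed
  \<comment> \<open>The square of a chart radius is a difference of angles, so this square has to
    stay below \<open>d\<close>.\<close>
  define s where "s = min r (sqrt (d / 2))"
  have s: "s > 0" "s \<le> r" using r_pos d by (auto simp: s_def)
  have s2: "s\<^sup>2 < d"
  proof -
    have "s\<^sup>2 \<le> (sqrt (d / 2))\<^sup>2" using s by (intro power_mono) (auto simp: s_def)
    then show ?thesis using d by simp
  qed
  let ?U = "\<psi> ` ball 0 s"
  have ch': "power_chart ratio z 2 s ?U \<phi> \<psi>" by (rule restrict[OF s])
  have U': "?U \<subseteq> {z. poly P z \<noteq> 0} - (crit - {z})" using U image_ball[OF s] by blast
  interpret c: power_chart ratio z 2 s ?U \<phi> \<psi> by (rule ch')
  have cyc': "cycle_of \<sigma> k \<noteq> cycle_of \<sigma> j" using cyc by metis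
  have inUd: "\<rho> j x \<in> U" "\<rho> k x \<in> U" if "\<bar>x - s0\<bar> < d" for x using that 1(6) 2(6) d by auto
  have outd: "\<phi> (\<rho> j x) = e1 * complex_of_real (sqrt (x - s0))" "\<phi> (\<rho> k x) = - e1 * complex_of_real (sqrt (x - s0))"
    if "s0 \<le> x" "x - s0 < d" for x using that 1(7)[of x] 2(7)[of x] d e2 by auto
  have innd: "\<phi> (\<rho> j x) = e1' * (\<i> * complex_of_real (sqrt (s0 - x)))" "\<phi> (\<rho> k x) = - e1' * (\<i> * complex_of_real (sqrt (s0 - x)))"
    if "x \<le> s0" "s0 - x < d" for x using that 1(8)[of x] 2(8)[of x] d e2' by auto
  have U0: "U \<subseteq> {z. poly P z \<noteq> 0} - (crit - {z})" using U by blast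
  have m: "- e1 \<in> {1, -1}" "- e1' \<in> {1, -1}" using 1(4,5) by auto
  have Cj: "curve j \<inter> ?U = \<psi> ` arms (e1' * \<i>) e1 s"
    by (rule ray_arms[OF ch U0 j(1) k(1) cyc s0 d(1,4,5) s s2 inUd 1(4,5) j(2) z(1) rz outd innd])
  have Ck: "curve k \<inter> ?U = \<psi> ` arms (- e1' * \<i>) (- e1) s"
    by (rule ray_arms[OF ch U0 k(1) j(1) cyc' s0 d(1,4,5) s s2 inUd(2,1) m k(2) z(1) rz])
      (use outd innd in auto)
  have n: "cmod (e1' * \<i>) = 1" "cmod e1 = 1" "cmod (- e1' * \<i>) = 1" "cmod (- e1) = 1"
    "Re (e1' * \<i> * cnj e1) = 0" "Re (- e1' * \<i> * cnj (- e1)) = 0"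
    using 1(4,5) by auto
  let ?D = "sgn (deriv \<psi> 0)"
  have cj: "corner_at (curve j) z (e1' * \<i> * ?D) (e1 * ?D)" by (rule c.corner_arms[OF n(1,2,5) Cj])
  have "corner_at (curve k) z (- e1' * \<i> * ?D) (- e1 * ?D)" by (rule c.corner_arms[OF n(3,4,6) Ck])
  then have ck: "corner_at (curve k) z (- (e1' * \<i> * ?D)) (- (e1 * ?D))" by simp
  have "orthogonal (e1' * \<i> * ?D) (e1 * ?D)"
    using 1(4,5) by (auto simp: orthogonal_def inner_complex_def)
  then have "right_angle_contact (curve j) (curve k) z" unfolding right_angle_contact_def using cj ck by blast
  moreover have "\<not> differentiable_curve_at (curve j) z" by (rule c.not_differentiable_arms[OF n(1,2,5) Cj])
  moreover have "\<not> differentiable_curve_at (curve k) z" by (rule c.not_differentiable_arms[OF n(3,4,6) Ck])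
  moreover have "curve j \<noteq> curve k"
    using curve_meet[OF j(1) k(1), of "\<rho> j \<beta>"] regular_point[OF j(1)] cyc by auto
  moreover have "{B \<in> curve ` {..<degree P}. z \<in> B} = {curve j, curve k}"
  proof (intro equalityI subsetI)
    fix B assume "B \<in> {B \<in> curve ` {..<degree P}. z \<in> B}"
    then obtain l where l: "l < degree P" "B = curve l" "z \<in> curve l" by blast
    obtain i x where i: "i \<in> cycle_of \<sigma> l" "x \<in> {\<beta>..<\<beta> + 2 * pi}" "z = \<rho> i x"
      using curve_halfopen[OF l(1,3)] .
    have iP: "i < degree P" using cycle_less[OF l(1) i(1)] .
    have "of_real c * cis x = of_real c * cis s0" using ratio_\<rho>[of x i] i iP rz by auto
    then have "x = s0" using c_pos i(2) i0(2) by (intro cis_eq_imp_eq) auto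
    then have "i \<in> {j. j < degree P \<and> \<rho> j s0 = z}" using i(3) iP by simp
    then have "i = j \<or> i = k" unfolding jk by simp
    then show "B \<in> {curve j, curve k}" using l(2) curve_cong[OF cycle_eq[OF i(1)]] by auto
  next
    have "\<rho> j s0 \<in> curve j" "\<rho> k s0 \<in> curve k"
      unfolding curve_def by (intro UN_I[OF self_in_cycle_of] imageI s0T)+
    then show "B \<in> {B \<in> curve ` {..<degree P}. z \<in> B}" if "B \<in> {curve j, curve k}" for B
      using that j k by auto
  qed
  ultimately show ?thesis by blast
qed

end

section \<open>Hausdorff convergence\<close>

lemma poly_eq_prod_roots:
  fixes F :: "complex poly"
  obtains z where "\<And>i. i < degree F \<Longrightarrow> poly F (z i) = 0"
    "\<And>y. cmod (poly F y) = cmod (lead_coeff F) * (\<Prod>i<degree F. dist y (z i))"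
proof -
  obtain z where z: "smult (lead_coeff F) (\<Prod>i<degree F. [:- z i, 1:]) = F"
    using complex_poly_decompose'[of F] by blast
  have ev: "poly F y = lead_coeff F * (\<Prod>i<degree F. (y - z i))" for y
    by (subst z [symmetric]) (simp add: poly_prod)
  show ?thesis
  proof (rule that)
    fix i assume "i < degree F"
    then have "(\<Prod>k<degree F. (z i - z k)) = 0" by (intro prod_zero) auto
    then show "poly F (z i) = 0" by (simp add: ev)
  next
    fix y show "cmod (poly F y) = cmod (lead_coeff F) * (\<Prod>i<degree F. dist y (z i))"
      by (simp add: ev norm_mult prod_norm dist_norm)
  qed
qed

text \<open>The distance to the nearest root is at most the geometric mean of the distances to all
  roots. A small value thus means a near root, with a bound depending only on leading coefficient
  and degree.\<close>

lemma root_near: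
  fixes F :: "complex poly"
  assumes "degree F > 0"
  obtains r where "poly F r = 0" "cmod (lead_coeff F) * dist y r ^ degree F \<le> cmod (poly F y)"
proof -
  obtain z where z: "\<And>i. i < degree F \<Longrightarrow> poly F (z i) = 0"
    "\<And>y. cmod (poly F y) = cmod (lead_coeff F) * (\<Prod>i<degree F. dist y (z i))"
    using poly_eq_prod_roots[of F] by blast
  let ?S = "(\<lambda>i. dist y (z i)) ` {..<degree F}"
  have S: "finite ?S" "?S \<noteq> {}" using assms by auto
  have "Min ?S \<in> ?S" by (rule Min_in[OF S])
  then obtain k where k: "k < degree F" "Min ?S = dist y (z k)" by auto
  have "(\<Prod>i<degree F. dist y (z k)) \<le> (\<Prod>i<degree F. dist y (z i))"
  proof (rule prod_mono)
    fix i assume "i \<in> {..<degree F}"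
    then have "Min ?S \<le> dist y (z i)" by (intro Min_le[OF S(1)]) auto
    then show "0 \<le> dist y (z k) \<and> dist y (z k) \<le> dist y (z i)" using k by simp
  qed
  then have "cmod (lead_coeff F) * dist y (z k) ^ degree F \<le> cmod (poly F y)"
    unfolding z(2) by (intro mult_left_mono) auto
  then show ?thesis using that z(1)[OF k(1)] by blast
qed

text \<open>Counterpart of \<open>root_near\<close> with the farthest root: a large value forces a
  remote root.\<close>

lemma root_far:
  fixes F :: "complex poly"
  assumes "degree F > 0"
  obtains r where "poly F r = 0" "cmod (poly F y) \<le> cmod (lead_coeff F) * dist y r ^ degree F"
proof -
  obtain z where z: "\<And>i. i < degree F \<Longrightarrow> poly F (z i) = 0"
    "\<And>y. cmod (poly F y) = cmod (lead_coeff F) * (\<Prod>i<degree F. dist y (z i))"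
    using poly_eq_prod_roots[of F] by blast
  let ?S = "(\<lambda>i. dist y (z i)) ` {..<degree F}"
  have S: "finite ?S" "?S \<noteq> {}" using assms by auto
  have "Max ?S \<in> ?S" by (rule Max_in[OF S])
  then obtain k where k: "k < degree F" "Max ?S = dist y (z k)" by auto
  have "(\<Prod>i<degree F. dist y (z i)) \<le> (\<Prod>i<degree F. dist y (z k))"
  proof (rule prod_mono)
    fix i assume "i \<in> {..<degree F}"
    then have "dist y (z i) \<le> Max ?S" by (intro Max_ge[OF S(1)]) auto
    then show "0 \<le> dist y (z i) \<and> dist y (z i) \<le> dist y (z k)" using k by simp
  qed
  then have "cmod (poly F y) \<le> cmod (lead_coeff F) * dist y (z k) ^ degree F"
    unfolding z(2) by (intro mult_left_mono) auto
  then show ?thesis using that z(1)[OF k(1)] by blast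
qed

text \<open>Cauchy's bound: for |z| > 1 compare z^n with the lower terms, each power of which is at
  most |z|^(n-1).\<close>

lemma monic_root_bound:
  fixes F :: "complex poly"
  assumes "lead_coeff F = 1" "poly F z = 0"
  shows "cmod z \<le> 1 + (\<Sum>i<degree F. cmod (coeff F i))"
proof (cases "cmod z \<le> 1")
  case True
  then show ?thesis using sum_nonneg[of "{..<degree F}" "\<lambda>i. cmod (coeff F i)"] by simp
next
  case False
  let ?n = "degree F"
  have n: "?n > 0"
  proof (rule ccontr)
    assume "\<not> ?n > 0"
    then obtain a where "F = [:a:]" by (metis degree_eq_zeroE gr0I)
    then show False using assms by simp
  qed
  have "0 = (\<Sum>i\<le>?n. coeff F i * z ^ i)" using assms(2) by (simp add: poly_altdef)
  also have "{..?n} = insert ?n {..<?n}" by auto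
  finally have "z ^ ?n = - (\<Sum>i<?n. coeff F i * z ^ i)" using assms(1) by (simp add: eq_neg_iff_add_eq_0)
  then have "cmod z ^ ?n = cmod (\<Sum>i<?n. coeff F i * z ^ i)" by (metis norm_minus_cancel norm_power)
  also have "\<dots> \<le> (\<Sum>i<?n. cmod (coeff F i) * cmod z ^ (?n - 1))"
  proof (rule sum_norm_le)
    fix i assume "i \<in> {..<?n}"
    then have "cmod z ^ i \<le> cmod z ^ (?n - 1)" using False by (intro power_increasing) auto
    then show "cmod (coeff F i * z ^ i) \<le> cmod (coeff F i) * cmod z ^ (?n - 1)"
      by (simp add: norm_mult norm_power mult_left_mono)
  qed
  also have "\<dots> = (\<Sum>i<?n. cmod (coeff F i)) * cmod z ^ (?n - 1)" by (simp add: sum_distrib_right)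
  finally have "cmod z * cmod z ^ (?n - 1) \<le> (\<Sum>i<?n. cmod (coeff F i)) * cmod z ^ (?n - 1)"
    using n by (simp add: power_eq_if split: if_splits)
  moreover have "0 < cmod z ^ (?n - 1)" using False by (intro zero_less_power) linarith
  ultimately have "cmod z \<le> (\<Sum>i<?n. cmod (coeff F i))" by (rule mult_right_le_imp_le)
  then show ?thesis by simp
qed

text \<open>Suprema of unbounded sets of reals are arbitrary; the assumed nearness bounds the
  distances, and their nonnegativity gives the lower bound.\<close>

lemma hausdorff_dist_bound:
  assumes "X \<noteq> {}" "Y \<noteq> {}"
    and "\<And>x. x \<in> X \<Longrightarrow> \<exists>y\<in>Y. dist x y \<le> e" "\<And>y. y \<in> Y \<Longrightarrow> \<exists>x\<in>X. dist y x \<le> e"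
  shows "\<bar>hausdorff_dist X Y\<bar> \<le> e"
proof -
  have 1: "infdist x Y \<le> e" if "x \<in> X" for x using assms(3)[OF that] infdist_le2 by blast
  have 2: "infdist y X \<le> e" if "y \<in> Y" for y using assms(4)[OF that] infdist_le2 by blast
  have le: "hausdorff_dist X Y \<le> e"
    unfolding hausdorff_dist_def using 1 2 assms(1,2) by (auto intro!: cSUP_least)
  obtain x where x: "x \<in> X" using assms(1) by blast
  have "bdd_above ((\<lambda>x. infdist x Y) ` X)" by (rule bdd_aboveI2[of _ _ e]) (rule 1)
  then have "infdist x Y \<le> (SUP x\<in>X. infdist x Y)" by (rule cSUP_upper[OF x])
  then have "0 \<le> hausdorff_dist X Y" using infdist_nonneg[of x Y] unfolding hausdorff_dist_def by linarith
  then show ?thesis using le by simp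
qed

lemma poly_bounded_on_cball:
  fixes p :: "complex poly"
  obtains M where "M > 0" "\<And>z. cmod z \<le> B \<Longrightarrow> cmod (poly p z) \<le> M"
proof -
  have "compact (poly p ` cball 0 B)" by (intro compact_continuous_image continuous_intros) auto
  then have "bounded (poly p ` cball 0 B)" by (rule compact_imp_bounded)
  then obtain M where "M > 0" "\<forall>x\<in>poly p ` cball 0 B. norm x \<le> M" unfolding bounded_pos by blast
  then show ?thesis using that by auto
qed

section \<open>Continuity of the spectrum in t\<close>

context perturbation
begin

abbreviation p where "p \<equiv> charpoly A"
abbreviation q where "q \<equiv> num_poly A u v"

lemma lead_coeff_pq: "lead_coeff (p - smult \<tau> q) = 1" and degree_pq: "degree (p - smult \<tau> q) = CARD('n)"
  using lead_coeff_charpoly[of "perturb A u v \<tau>"] degree_charpoly[of "perturb A u v \<tau>"] by (simp_all add: charpoly_perturb)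

lemma root_in_spectrum:
  assumes "cmod \<tau> = t" "t > 0" "poly (p - smult \<tau> q) z = 0"
  shows "z \<in> perturbed_spectrum A u v t"
  using assms unfolding perturbed_spectrum_charpoly[OF assms(2)] by (simp add: norm_mult)

lemma spectrum_root:
  assumes "t > 0" "z \<in> perturbed_spectrum A u v t"
  obtains \<tau> where "cmod \<tau> = t" "poly p z = \<tau> * poly q z"
proof -
  have eq: "cmod (poly p z) = t * cmod (poly q z)" using assms perturbed_spectrum_charpoly by auto
  show ?thesis
  proof (cases "poly q z = 0")
    case True
    then show ?thesis using eq assms(1) that[of "of_real t"] by simp
  next
    case False
    then show ?thesis using eq that[of "poly p z / poly q z"] by (simp add: norm_divide)
  qed
qed

lemma spectrum_nonempty: "t > 0 \<Longrightarrow> perturbed_spectrum A u v t \<noteq> {}"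
  using root_near[of "p - smult (of_real t) q"] root_in_spectrum[of "of_real t" t]
  by (metis degree_pq empty_iff norm_of_real abs_of_pos zero_less_card_finite)

lemma spectrum_bounded:
  obtains B where "\<And>t z. 0 < t \<Longrightarrow> t \<le> T \<Longrightarrow> z \<in> perturbed_spectrum A u v t \<Longrightarrow> cmod z \<le> B"
proof -
  let ?B = "1 + (\<Sum>i<CARD('n). cmod (coeff p i) + T * cmod (coeff q i))"
  have "cmod z \<le> ?B" if t: "0 < t" "t \<le> T" "z \<in> perturbed_spectrum A u v t" for t z
  proof -
    obtain \<tau> where \<tau>: "cmod \<tau> = t" "poly p z = \<tau> * poly q z" using spectrum_root[OF t(1,3)] .
    have "poly (p - smult \<tau> q) z = 0" using \<tau>(2) by simp
    from monic_root_bound[OF lead_coeff_pq this]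
    have "cmod z \<le> 1 + (\<Sum>i<CARD('n). cmod (coeff (p - smult \<tau> q) i))" by (simp only: degree_pq)
    also have "\<dots> \<le> ?B"
    proof (intro add_left_mono sum_mono)
      fix i
      have "cmod (coeff (p - smult \<tau> q) i) \<le> cmod (coeff p i) + t * cmod (coeff q i)"
        using norm_triangle_ineq4[of "coeff p i" "\<tau> * coeff q i"] by (simp add: norm_mult \<tau>(1))
      also have "\<dots> \<le> cmod (coeff p i) + T * cmod (coeff q i)" using t by (simp add: mult_right_mono)
      finally show "cmod (coeff (p - smult \<tau> q) i) \<le> cmod (coeff p i) + T * cmod (coeff q i)" .
    qed
    finally show ?thesis .
  qed
  then show ?thesis by (rule that)
qed

text \<open>Scale \<tau> to modulus s. At y the new characteristic polynomial has the value \<tau>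
  (1 - s / t) q(y), of modulus |s - t| |q(y)|, and being monic it has a root within the n-th root of
  this modulus.\<close>

lemma spectrum_move:
  assumes "t > 0" "s > 0" "y \<in> perturbed_spectrum A u v t"
  obtains x where "x \<in> perturbed_spectrum A u v s" "dist y x ^ CARD('n) \<le> \<bar>s - t\<bar> * cmod (poly q y)"
proof -
  obtain \<tau> where \<tau>: "cmod \<tau> = t" "poly p y = \<tau> * poly q y" using spectrum_root[OF assms(1,3)] .
  let ?\<tau> = "\<tau> * of_real (s / t)"
  let ?F = "p - smult ?\<tau> q"
  have n: "cmod ?\<tau> = s" using \<tau>(1) assms by (simp add: norm_mult norm_divide)
  have "degree ?F > 0" by (simp only: degree_pq zero_less_card_finite)
  then obtain r where r: "poly ?F r = 0" "cmod (lead_coeff ?F) * dist y r ^ degree ?F \<le> cmod (poly ?F y)"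
    by (rule root_near)
  have "poly ?F y = \<tau> * of_real (1 - s / t) * poly q y" using \<tau>(2) by (simp add: algebra_simps)
  then have "cmod (poly ?F y) = t * \<bar>1 - s / t\<bar> * cmod (poly q y)" by (simp only: norm_mult \<tau>(1) norm_of_real)
  also have "t * \<bar>1 - s / t\<bar> = \<bar>s - t\<bar>"
  proof -
    have "t * \<bar>1 - s / t\<bar> = \<bar>t * (1 - s / t)\<bar>" using assms(1) by (simp add: abs_mult)
    also have "t * (1 - s / t) = t - s" using assms(1) by (simp add: field_simps)
    finally show ?thesis by simp
  qed
  finally have "dist y r ^ CARD('n) \<le> \<bar>s - t\<bar> * cmod (poly q y)" using r(2)[unfolded lead_coeff_pq, unfolded degree_pq norm_one mult_1_left] by (simp only:)
  then show ?thesis using that root_in_spectrum[OF n assms(2) r(1)] by blast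
qed

lemma spectrum_continuous:
  assumes t: "t > 0"
  shows "((\<lambda>s. hausdorff_dist (perturbed_spectrum A u v s) (perturbed_spectrum A u v t)) \<longlongrightarrow> 0) (at t)"
proof (rule LIM_I)
  fix e :: real assume e: "e > 0"
  obtain B where B: "\<And>s z. 0 < s \<Longrightarrow> s \<le> t + 1 \<Longrightarrow> z \<in> perturbed_spectrum A u v s \<Longrightarrow> cmod z \<le> B"
    using spectrum_bounded[of "t + 1"] by blast
  obtain M where M: "M > 0" "\<And>z. cmod z \<le> B \<Longrightarrow> cmod (poly q z) \<le> M" using poly_bounded_on_cball[of B q] by blast
  \<comment> \<open>The first two bounds keep s positive and at most t + 1, where \<open>B\<close>
    applies; the third makes d M at most (e / 2)^n, with n the dimension.\<close>
  define d where "d = min (min 1 (t / 2)) ((e / 2) ^ CARD('n) / M)"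
  have d: "d \<le> 1" "d \<le> t / 2" "d \<le> (e / 2) ^ CARD('n) / M" unfolding d_def by linarith+
  have d0: "d > 0" using e t M(1) by (simp add: d_def)
  have "norm (hausdorff_dist (perturbed_spectrum A u v s) (perturbed_spectrum A u v t) - 0) < e"
    if s: "\<bar>s - t\<bar> < d" for s
  proof -
    have s': "s > 0" "s \<le> t + 1" using s d(1,2) t by auto
    have close: "\<exists>x\<in>perturbed_spectrum A u v b. dist y x \<le> e / 2"
      if ab: "0 < a" "a \<le> t + 1" "0 < b" "\<bar>b - a\<bar> = \<bar>s - t\<bar>" "y \<in> perturbed_spectrum A u v a" for a b y
    proof -
      obtain x where x: "x \<in> perturbed_spectrum A u v b" "dist y x ^ CARD('n) \<le> \<bar>b - a\<bar> * cmod (poly q y)"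
        using spectrum_move[OF ab(1,3,5)] .
      have "\<bar>b - a\<bar> * cmod (poly q y) \<le> d * M"
        using ab(4) s M(2)[OF B[OF ab(1,2,5)]] d0 by (intro mult_mono) auto
      also have "\<dots> \<le> (e / 2) ^ CARD('n)" using d(3) M(1) by (simp add: pos_le_divide_eq)
      finally have "dist y x ^ CARD('n) \<le> (e / 2) ^ CARD('n)" using x(2) by simp
      then have "dist y x \<le> e / 2" using e by (subst (asm) power_mono_iff) auto
      then show ?thesis using x(1) by blast
    qed
    have "\<bar>hausdorff_dist (perturbed_spectrum A u v s) (perturbed_spectrum A u v t)\<bar> \<le> e / 2"
    proof (rule hausdorff_dist_bound)
      show "\<exists>y\<in>perturbed_spectrum A u v t. dist x y \<le> e / 2" if "x \<in> perturbed_spectrum A u v s" for x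
        using close[OF s' t _ that] by (simp add: abs_minus_commute)
      show "\<exists>y\<in>perturbed_spectrum A u v s. dist x y \<le> e / 2" if "x \<in> perturbed_spectrum A u v t" for x
        using close[OF t _ s'(1) _ that] by simp
    qed (use spectrum_nonempty t s' in auto)
    then show ?thesis using e by simp
  qed
  then show "\<exists>d>0. \<forall>x. x \<noteq> t \<and> norm (x - t) < d \<longrightarrow>
      norm (hausdorff_dist (perturbed_spectrum A u v x) (perturbed_spectrum A u v t) - 0) < e"
    using d0 by auto
qed

text \<open>Every point that is not a pole is then critical. With \<open>finite_crit\<close>,
  finiteness of the critical set excludes exactly the case in which \<open>Q\<close> vanishes and
  the spectrum does not depend on t.\<close>

lemma crit_infinite: "R = 0 \<Longrightarrow> infinite crit"
proof
  assume R: "R = 0" and fin: "finite crit"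
  have "poly (pderiv R * P - R * pderiv P) z = 0" for z by (simp add: R)
  then have "{z. poly P z \<noteq> 0} \<subseteq> crit" unfolding crit_def by blast
  then have "finite {z. poly P z \<noteq> 0}" using fin by (rule finite_subset)
  moreover have "finite {z. poly P z = 0}" using P_nonzero by (rule poly_roots_finite)
  ultimately have "finite ({z. poly P z \<noteq> 0} \<union> {z. poly P z = 0})" by simp
  moreover have "{z. poly P z \<noteq> 0} \<union> {z. poly P z = 0} = UNIV" by auto
  ultimately show False using infinite_UNIV_char_0 by metis
qed

end

section \<open>The limit for t to infinity on the Riemann sphere\<close>

lemma continuous_riemann_sphere: "continuous_on S riemann_sphere"
proof -
  have "1 + (cmod z)\<^sup>2 \<noteq> 0" "(cmod z)\<^sup>2 + 1 \<noteq> 0" for z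
    by (metis add.commute add_pos_nonneg less_irrefl zero_le_power2 zero_less_one_class.zero_less_one)+
  then show ?thesis unfolding riemann_sphere_def by (intro continuous_intros) auto
qed

lemma dist_riemann_sphere_infinity: "(dist (riemann_sphere z) sphere_infinity)\<^sup>2 = 4 / (1 + (cmod z)\<^sup>2)"
proof -
  let ?a = "(cmod z)\<^sup>2"
  have a: "1 + ?a > 0" by (simp add: add_pos_nonneg)
  have "(norm ((2 / (1 + ?a)) *\<^sub>R z))\<^sup>2 = 4 * ?a / (1 + ?a)\<^sup>2"
    using a by (simp add: power_mult_distrib power_divide)
  moreover have "(?a - 1) / (?a + 1) - 1 = - 2 / (1 + ?a)" using a by (simp add: field_simps)
  then have "(dist ((?a - 1) / (?a + 1)) 1)\<^sup>2 = 4 / (1 + ?a)\<^sup>2" by (simp add: dist_real_def power_divide)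
  ultimately have "(dist (riemann_sphere z) sphere_infinity)\<^sup>2 = 4 * ?a / (1 + ?a)\<^sup>2 + 4 / (1 + ?a)\<^sup>2"
    by (simp add: riemann_sphere_def sphere_infinity_def dist_Pair_Pair)
  also have "\<dots> = 4 * (1 + ?a) / (1 + ?a)\<^sup>2" by (simp add: add_divide_distrib algebra_simps)
  also have "\<dots> = 4 / (1 + ?a)"
  proof -
    have "4 * x / x\<^sup>2 = 4 / x" if "x > 0" for x :: real using that by (simp add: power2_eq_square)
    then show ?thesis using a by blast
  qed
  finally show ?thesis .
qed

lemma riemann_sphere_near_infinity:
  assumes "e > 0" "2 / e \<le> cmod z"
  shows "dist (riemann_sphere z) sphere_infinity \<le> e"
proof -
  have "4 / e\<^sup>2 = (2 / e)\<^sup>2" by (simp add: power_divide)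
  also have "\<dots> \<le> (cmod z)\<^sup>2" using assms by (intro power_mono) auto
  finally have "4 \<le> e\<^sup>2 * (cmod z)\<^sup>2" using assms(1) by (simp add: field_simps)
  then have "4 \<le> e\<^sup>2 * (1 + (cmod z)\<^sup>2)" using zero_le_power2[of e] by (simp only: distrib_left)
  moreover have "1 + (cmod z)\<^sup>2 > 0" by (simp add: add_pos_nonneg)
  ultimately have "(dist (riemann_sphere z) sphere_infinity)\<^sup>2 \<le> e\<^sup>2"
    unfolding dist_riemann_sphere_infinity by (simp add: pos_divide_le_eq)
  then show ?thesis using assms(1) by (simp add: abs_le_square_iff flip: )
qed

context perturbation
begin

text \<open>Three facts combine: each zero of \<open>q\<close> is approached, some eigenvalue leaves
  every disc, and every eigenvalue is either large or close to a zero of \<open>q\<close>. On the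
  sphere, large means near infinity.\<close>

lemma spectrum_limit:
  assumes fin: "finite crit"
  shows "((\<lambda>t. hausdorff_dist (riemann_sphere ` perturbed_spectrum A u v t)
            (insert sphere_infinity (riemann_sphere ` {z. poly q z = 0}))) \<longlongrightarrow> 0) at_top"
proof -
  have R0: "R \<noteq> 0" using crit_infinite fin by blast
  then have q0: "q \<noteq> 0" using g_nonzero by (simp add: num_poly_eq)
  let ?Z = "{z. poly q z = 0}"
  have finZ: "finite ?Z" using q0 by (rule poly_roots_finite)
  have near_zero: "\<forall>\<^sub>F t in at_top. \<exists>x\<in>perturbed_spectrum A u v t. dist y x < d"
    if y: "y \<in> ?Z" and d: "d > 0" for y d
  proof (cases "poly g y = 0")
    case True
    have "\<forall>\<^sub>F t in at_top. t > (0::real)" by (rule eventually_gt_at_top)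
    then show ?thesis
    proof eventually_elim
      case (elim t)
      then have "y \<in> perturbed_spectrum A u v t" using perturbed_spectrum_eq[OF elim] True by blast
      then show ?case using d by (intro bexI[of _ y]) simp_all
    qed
  next
    case False
    then have Ry: "poly R y = 0" using y by (simp add: num_poly_eq)
    then have Py: "poly P y \<noteq> 0" using no_common_root by blast
    then have "y \<in> {z. poly P z \<noteq> 0}" by simp
    then obtain e where e: "e > 0" "ball y e \<subseteq> {z. poly P z \<noteq> 0}" by (rule openE[OF open_nonpoles])
    let ?U = "ball y (min d e)"
    have sub: "?U \<subseteq> {z. poly P z \<noteq> 0}" using e(2) by auto
    have hol: "ratio holomorphic_on ?U" using ratio_holomorphic sub by (rule holomorphic_on_subset)
    have ry: "ratio y = 0" by (simp add: ratio_def Ry)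
    have yU: "y \<in> ?U" using d e(1) by simp
    have "\<not> ratio constant_on ?U"
    proof
      assume "ratio constant_on ?U"
      then obtain k where "\<And>w. w \<in> ?U \<Longrightarrow> ratio w = k" unfolding constant_on_def by blast
      then have rat0: "\<And>w. w \<in> ?U \<Longrightarrow> ratio w = 0" using yU ry by metis
      have "poly R w = 0" if "w \<in> ?U" for w
        using rat0[OF that] subsetD[OF sub that] by (simp add: ratio_def)
      then have "?U \<subseteq> {w. poly R w = 0}" by blast
      then have "finite ?U" using poly_roots_finite[OF R0] by (rule finite_subset)
      then show False using finite_imp_not_open[of ?U] yU by auto
    qed
    \<comment> \<open>By the open mapping theorem \<open>ratio\<close> takes the value 1 / t near
      its zero y as soon as t is large.\<close>
    then have "open (ratio ` ?U)" by (intro open_mapping_thm[OF hol]) auto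
    moreover have "0 \<in> ratio ` ?U" using yU ry by force
    ultimately obtain \<epsilon> where \<epsilon>: "\<epsilon> > 0" "ball 0 \<epsilon> \<subseteq> ratio ` ?U" by (meson openE)
    have "\<forall>\<^sub>F t in at_top. t > 1 / \<epsilon>" by (rule eventually_gt_at_top)
    then show ?thesis
    proof eventually_elim
      case (elim t)
      have "1 / \<epsilon> > 0" using \<epsilon>(1) by simp
      then have t: "t > 0" using elim by linarith
      then have "1 / t < \<epsilon>" using elim \<epsilon>(1) by (simp add: field_simps)
      then have "complex_of_real (1 / t) \<in> ball 0 \<epsilon>" using t by (simp add: norm_divide)
      then have "complex_of_real (1 / t) \<in> ratio ` ?U" by (rule subsetD[OF \<epsilon>(2)])
      then obtain x where x: "ratio x = complex_of_real (1 / t)" "x \<in> ?U" by (elim imageE) simp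
      have "x \<in> level (1 / t)" using x(1) subsetD[OF sub x(2)] t by (simp add: level_iff norm_divide)
      then have "x \<in> perturbed_spectrum A u v t" using perturbed_spectrum_eq[OF t] by blast
      then show ?case using x(2) by (intro bexI[of _ x]) simp_all
    qed
  qed
  have far: "\<forall>\<^sub>F t in at_top. \<exists>x\<in>perturbed_spectrum A u v t. B \<le> cmod x" for B
  proof -
    obtain x0 where x0: "poly q x0 \<noteq> 0" using q0 poly_all_0_iff_0 by blast
    \<comment> \<open>At a point x0 with q(x0) \<noteq> 0 the characteristic polynomial grows
      linearly in t, so its farthest root escapes; \<open>C\<close> turns a distance from x0 into a
      modulus of at least B.\<close>
    define C where "C = \<bar>B\<bar> + cmod x0"
    define T where "T = (C ^ CARD('n) + cmod (poly p x0)) / cmod (poly q x0)"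
    have "\<forall>\<^sub>F t in at_top. t > max T 0" by (rule eventually_gt_at_top)
    then show ?thesis
    proof eventually_elim
      case (elim t)
      let ?F = "p - smult (complex_of_real t) q"
      have t: "t > 0" "t > T" using elim by auto
      have "degree ?F > 0" by (simp only: degree_pq zero_less_card_finite)
      then obtain r where r: "poly ?F r = 0" "cmod (poly ?F x0) \<le> cmod (lead_coeff ?F) * dist x0 r ^ degree ?F"
        by (rule root_far)
      have "C ^ CARD('n) + cmod (poly p x0) < t * cmod (poly q x0)"
        using t(2) x0 by (simp add: T_def pos_divide_less_eq)
      also have "\<dots> = cmod (of_real t * poly q x0)" using t by (simp add: norm_mult)
      also have "\<dots> \<le> cmod (poly p x0) + cmod (poly ?F x0)"
        using norm_triangle_ineq4[of "poly p x0" "poly ?F x0"] by simp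
      finally have "C ^ CARD('n) < cmod (poly ?F x0)" by simp
      also have "\<dots> \<le> dist x0 r ^ CARD('n)" by (rule r(2)[unfolded lead_coeff_pq, unfolded degree_pq norm_one mult_1_left])
      finally have "C < dist x0 r" by (rule power_less_imp_less_base) simp
      also have "\<dots> \<le> cmod x0 + cmod r" unfolding dist_norm by (rule norm_triangle_ineq4)
      finally have "B \<le> cmod r" by (simp add: C_def)
      moreover have "r \<in> perturbed_spectrum A u v t"
        by (rule root_in_spectrum[OF _ t(1) r(1)]) (use t in simp)
      ultimately show ?case by blast
    qed
  qed
  have upper: "\<forall>\<^sub>F t in at_top. \<forall>x\<in>perturbed_spectrum A u v t. B \<le> cmod x \<or> (\<exists>y\<in>?Z. dist x y < d)"
    if d: "d > 0" for B d :: real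
  proof -
    obtain M where M: "M > 0" "\<And>z. cmod z \<le> B \<Longrightarrow> cmod (poly p z) \<le> M" using poly_bounded_on_cball[of B p] by blast
    \<comment> \<open>Away from the zeros of \<open>q\<close>, |q| is bounded below, so |p| = t |q|
      eventually exceeds its bound on the disc of radius B.\<close>
    let ?l = "cmod (lead_coeff q)" and ?m = "degree q"
    have l: "?l > 0" using q0 by simp
    have "\<forall>\<^sub>F t in at_top. t > M / (?l * d ^ ?m)" by (rule eventually_gt_at_top)
    moreover have "\<forall>\<^sub>F t in at_top. t > (0::real)" by (rule eventually_gt_at_top)
    ultimately show ?thesis
    proof eventually_elim
      case (elim t)
      show ?case
      proof (intro ballI, rule disjCI)
        fix x assume x: "x \<in> perturbed_spectrum A u v t" and no: "\<not> (\<exists>y\<in>?Z. dist x y < d)"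
        have eq: "cmod (poly p x) = t * cmod (poly q x)" using x perturbed_spectrum_charpoly[OF elim(2)] by blast
        have "?l * d ^ ?m \<le> cmod (poly q x)"
        proof (cases "?m = 0")
          case True
          then obtain a where "q = [:a:]" by (rule degree_eq_zeroE)
          then show ?thesis by simp
        next
          case False
          then obtain r where r: "poly q r = 0" "?l * dist x r ^ ?m \<le> cmod (poly q x)"
            using root_near[of q x] by auto
          then have "d \<le> dist x r" using no by force
          then have "?l * d ^ ?m \<le> ?l * dist x r ^ ?m" using d l by (intro mult_left_mono power_mono) auto
          then show ?thesis using r(2) by linarith
        qed
        moreover have "M < t * (?l * d ^ ?m)" using elim(1) l d by (simp add: pos_divide_less_eq)
        ultimately have "M < cmod (poly p x)" unfolding eq using elim(2)
          by (meson less_le_trans mult_left_mono less_imp_le)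
        then show "B \<le> cmod x" using M(2)[of x] by linarith
      qed
    qed
  qed
  show ?thesis
  proof (rule tendstoI)
    fix e :: real assume e: "e > 0"
    \<comment> \<open>4 / e = 2 / (e / 2) is the radius beyond which the chordal distance to
      infinity is at most e / 2.\<close>
    define B where "B = max (4 / e) 1"
    \<comment> \<open>The radius B + 1 leaves room for points within d <= 1 of the disc of radius
      B.\<close>
    have "compact (cball (0::complex) (B + 1))" by simp
    then have "uniformly_continuous_on (cball 0 (B + 1)) riemann_sphere"
      by (rule compact_uniformly_continuous[OF continuous_riemann_sphere])
    then obtain d0 where d0: "d0 > 0" "\<And>x y. x \<in> cball 0 (B + 1) \<Longrightarrow> y \<in> cball 0 (B + 1) \<Longrightarrow> dist y x < d0 \<Longrightarrow>
        dist (riemann_sphere y) (riemann_sphere x) < e / 2"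
      unfolding uniformly_continuous_on_def using e by (meson half_gt_zero)
    define d where "d = min d0 1"
    have d: "d > 0" "d \<le> d0" "d \<le> 1" using d0(1) by (auto simp: d_def)
    have inf: "dist (riemann_sphere z) sphere_infinity \<le> e / 2" if "B \<le> cmod z" for z
      using that e by (intro riemann_sphere_near_infinity) (auto simp: B_def)
    have rs: "dist (riemann_sphere x) (riemann_sphere y) \<le> e / 2" if "cmod x \<le> B" "dist x y < d" for x y
    proof -
      have "cmod y \<le> cmod x + dist x y" using norm_triangle_ineq4[of x "x - y"] by (simp add: dist_norm)
      then have "y \<in> cball 0 (B + 1)" using that d by simp
      then show ?thesis using d0(2)[of y x] that d by (simp add: less_imp_le)
    qed
    have "\<forall>\<^sub>F t in at_top. \<forall>y\<in>?Z. \<exists>x\<in>perturbed_spectrum A u v t. dist (riemann_sphere y) (riemann_sphere x) \<le> e / 2"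
    proof (rule eventually_ball_finite[OF finZ], rule ballI)
      fix y assume y: "y \<in> ?Z"
      have "isCont riemann_sphere y" using continuous_riemann_sphere[of UNIV] by (simp add: continuous_on_eq_continuous_at)
      then obtain \<delta> where \<delta>: "\<delta> > 0" "\<And>x. dist x y < \<delta> \<Longrightarrow> dist (riemann_sphere x) (riemann_sphere y) < e / 2"
        unfolding continuous_at_eps_delta using e by (meson half_gt_zero)
      from near_zero[OF y \<delta>(1)]
      show "\<forall>\<^sub>F t in at_top. \<exists>x\<in>perturbed_spectrum A u v t. dist (riemann_sphere y) (riemann_sphere x) \<le> e / 2"
      proof eventually_elim
        case (elim t)
        then obtain x where "x \<in> perturbed_spectrum A u v t" "dist y x < \<delta>" by blast
        then show ?case using \<delta>(2)[of x] by (intro bexI[of _ x]) (simp_all add: dist_commute less_imp_le)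
      qed
    qed
    moreover note far[of B] upper[OF d(1), of B]
    moreover have "\<forall>\<^sub>F t in at_top. t > (0::real)" by (rule eventually_gt_at_top)
    ultimately show "\<forall>\<^sub>F t in at_top. dist (hausdorff_dist (riemann_sphere ` perturbed_spectrum A u v t)
            (insert sphere_infinity (riemann_sphere ` ?Z))) 0 < e"
    proof eventually_elim
      case (elim t)
      have "\<bar>hausdorff_dist (riemann_sphere ` perturbed_spectrum A u v t) (insert sphere_infinity (riemann_sphere ` ?Z))\<bar> \<le> e / 2"
      proof (rule hausdorff_dist_bound)
        show "riemann_sphere ` perturbed_spectrum A u v t \<noteq> {}" using spectrum_nonempty[OF elim(4)] by simp
        fix w assume "w \<in> riemann_sphere ` perturbed_spectrum A u v t"
        then obtain x where x: "x \<in> perturbed_spectrum A u v t" "w = riemann_sphere x" by blast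
        show "\<exists>y\<in>insert sphere_infinity (riemann_sphere ` ?Z). dist w y \<le> e / 2"
        proof (cases "B \<le> cmod x")
          case True
          then show ?thesis using inf x(2) by blast
        next
          case False
          then obtain y where "y \<in> ?Z" "dist x y < d" using elim(3) x(1) by blast
          then show ?thesis using rs[of x y] False x(2) by force
        qed
      next
        fix w assume "w \<in> insert sphere_infinity (riemann_sphere ` ?Z)"
        then consider "w = sphere_infinity" | y where "y \<in> ?Z" "w = riemann_sphere y" by blast
        then show "\<exists>x\<in>riemann_sphere ` perturbed_spectrum A u v t. dist w x \<le> e / 2"
        proof cases
          case 1
          then show ?thesis using elim(2) inf by (auto simp: dist_commute)
        next
          case 2
          then show ?thesis using elim(1) by blast
        qed
      qed simp
      then show ?case using e by simp
    qed
  qed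
qed

end

section \<open>Genericity\<close>

definition polyfun :: "(('x \<Rightarrow> complex) \<Rightarrow> complex) \<Rightarrow> bool" where
  "polyfun f \<longleftrightarrow> (\<exists>p. \<forall>x. f x = mpoly_eval x p)"

definition monomial_eval :: "('x \<Rightarrow> complex) \<Rightarrow> ('x \<Rightarrow>\<^sub>0 nat) \<Rightarrow> complex" where
  "monomial_eval x m = (\<Prod>i\<in>Poly_Mapping.keys m. x i ^ Poly_Mapping.lookup m i)"

lemma mpoly_eval_superset:
  assumes "finite S" "Poly_Mapping.keys p \<subseteq> S"
  shows "mpoly_eval x p = (\<Sum>m\<in>S. Poly_Mapping.lookup p m * monomial_eval x m)"
  unfolding mpoly_eval_def monomial_eval_def
  by (rule sum.mono_neutral_left[OF assms]) (simp add: in_keys_iff)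

lemma monomial_eval_superset:
  assumes "finite S" "Poly_Mapping.keys m \<subseteq> S"
  shows "monomial_eval x m = (\<Prod>i\<in>S. x i ^ Poly_Mapping.lookup m i)"
  unfolding monomial_eval_def
  by (rule prod.mono_neutral_left[OF assms]) (simp add: in_keys_iff)

lemma monomial_eval_add: "monomial_eval x (m + k) = monomial_eval x m * monomial_eval x k"
proof -
  let ?S = "Poly_Mapping.keys m \<union> Poly_Mapping.keys k"
  have f: "finite ?S" by simp
  have "monomial_eval x (m + k) = (\<Prod>i\<in>?S. x i ^ Poly_Mapping.lookup (m + k) i)"
    by (rule monomial_eval_superset[OF f Poly_Mapping.keys_add])
  also have "\<dots> = (\<Prod>i\<in>?S. x i ^ Poly_Mapping.lookup m i) * (\<Prod>i\<in>?S. x i ^ Poly_Mapping.lookup k i)"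
    by (simp add: lookup_add power_add prod.distrib)
  also have "\<dots> = monomial_eval x m * monomial_eval x k"
    using monomial_eval_superset[OF f, of m x] monomial_eval_superset[OF f, of k x] by simp
  finally show ?thesis .
qed

lemma mpoly_eval_single: "mpoly_eval x (Poly_Mapping.single m a) = a * monomial_eval x m"
  using mpoly_eval_superset[of "{m}" "Poly_Mapping.single m a" x] by simp

lemma mpoly_eval_add: "mpoly_eval x (p + q) = mpoly_eval x p + mpoly_eval x q"
proof -
  let ?S = "Poly_Mapping.keys p \<union> Poly_Mapping.keys q"
  have f: "finite ?S" by simp
  have "mpoly_eval x (p + q) = (\<Sum>m\<in>?S. Poly_Mapping.lookup (p + q) m * monomial_eval x m)"
    by (rule mpoly_eval_superset[OF f Poly_Mapping.keys_add])
  also have "\<dots> = (\<Sum>m\<in>?S. Poly_Mapping.lookup p m * monomial_eval x m) + (\<Sum>m\<in>?S. Poly_Mapping.lookup q m * monomial_eval x m)"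
    by (simp add: lookup_add distrib_right sum.distrib)
  also have "\<dots> = mpoly_eval x p + mpoly_eval x q"
    using mpoly_eval_superset[OF f, of p x] mpoly_eval_superset[OF f, of q x] by simp
  finally show ?thesis .
qed

lemma mpoly_eval_0: "mpoly_eval x 0 = 0"
  by (simp add: mpoly_eval_def)

lemma polyfun_add: "polyfun f \<Longrightarrow> polyfun g \<Longrightarrow> polyfun (\<lambda>x. f x + g x)"
  unfolding polyfun_def by (metis mpoly_eval_add)

lemma polyfun_const: "polyfun (\<lambda>x. a)"
  unfolding polyfun_def by (rule exI[of _ "Poly_Mapping.single 0 a"]) (simp add: mpoly_eval_single monomial_eval_def)

lemma polyfun_var: "polyfun (\<lambda>x. x i)"
  unfolding polyfun_def
  by (rule exI[of _ "Poly_Mapping.single (Poly_Mapping.single i 1) 1"]) (simp add: mpoly_eval_single monomial_eval_def)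

lemma polyfun_sum: "(\<And>i. i \<in> I \<Longrightarrow> polyfun (f i)) \<Longrightarrow> polyfun (\<lambda>x. \<Sum>i\<in>I. f i x)"
  by (induction I rule: infinite_finite_induct) (auto intro: polyfun_add polyfun_const)

text \<open>A product of evaluations is a double sum of evaluated monomials, so closure under sums
  finishes the proof.\<close>

lemma polyfun_mult: "polyfun f \<Longrightarrow> polyfun g \<Longrightarrow> polyfun (\<lambda>x. f x * g x)"
proof -
  assume "polyfun f" "polyfun g"
  then obtain p q where p: "\<And>x. f x = mpoly_eval x p" and q: "\<And>x. g x = mpoly_eval x q"
    unfolding polyfun_def by blast
  have "f x * g x = (\<Sum>m\<in>Poly_Mapping.keys p. \<Sum>k\<in>Poly_Mapping.keys q.
      mpoly_eval x (Poly_Mapping.single (m + k) (Poly_Mapping.lookup p m * Poly_Mapping.lookup q k)))" for x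
    unfolding p q mpoly_eval_single monomial_eval_add mpoly_eval_superset[OF finite_keys order_refl, of x p]
      mpoly_eval_superset[OF finite_keys order_refl, of x q] sum_product
    by (intro sum.cong refl) (simp add: mult_ac)
  moreover have "polyfun (\<lambda>x. \<Sum>m\<in>Poly_Mapping.keys p. \<Sum>k\<in>Poly_Mapping.keys q.
      mpoly_eval x (Poly_Mapping.single (m + k) (Poly_Mapping.lookup p m * Poly_Mapping.lookup q k)))"
    by (intro polyfun_sum) (auto simp: polyfun_def)
  ultimately show ?thesis by simp
qed

lemma polyfun_prod: "(\<And>i. i \<in> I \<Longrightarrow> polyfun (f i)) \<Longrightarrow> polyfun (\<lambda>x. \<Prod>i\<in>I. f i x)"
  by (induction I rule: infinite_finite_induct) (auto intro: polyfun_mult polyfun_const)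

lemma polyfun_det:
  assumes "\<And>i j. i < n \<Longrightarrow> j < n \<Longrightarrow> polyfun (\<lambda>x. a x i j)"
  shows "polyfun (\<lambda>x. Determinant.det (Matrix.mat n n (\<lambda>(i, j). a x i j)))"
proof -
  have "Determinant.det (Matrix.mat n n (\<lambda>(i, j). a x i j)) =
     (\<Sum>p\<in>{p. p permutes {0..<n}}. signof p * (\<Prod>i\<in>{0..<n}. a x i (p i)))" for x
  proof -
    have "Determinant.det (Matrix.mat n n (\<lambda>(i, j). a x i j)) =
      (\<Sum>p\<in>{p. p permutes {0..<n}}. signof p * (\<Prod>i = 0..<n. Matrix.mat n n (\<lambda>(i, j). a x i j) $$ (i, p i)))"
      by (rule Determinant.det_def'[OF Matrix.mat_carrier])
    also have "\<dots> = (\<Sum>p\<in>{p. p permutes {0..<n}}. signof p * (\<Prod>i\<in>{0..<n}. a x i (p i)))"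
      by (intro sum.cong refl arg_cong2[where f = "(*)"] prod.cong) (auto simp: permutes_in_image dest: permutes_in_image)
    finally show ?thesis .
  qed
  moreover have "polyfun (\<lambda>x. \<Sum>p\<in>{p. p permutes {0..<n}}. signof p * (\<Prod>i\<in>{0..<n}. a x i (p i)))"
  proof (intro polyfun_sum polyfun_mult polyfun_const polyfun_prod assms)
    fix p i assume "p \<in> {p. p permutes {0..<n}}" "i \<in> {0..<n}"
    then show "p i < n" using permutes_in_image[of p "{0..<n}" i] by auto
  qed auto
  ultimately show ?thesis by simp
qed

lemma polyfun_line:
  assumes "polyfun f"
  obtains \<pi> where "\<And>s. f (\<lambda>i. x i + s * y i) = poly \<pi> s"
proof -
  obtain p where p: "\<And>x. f x = mpoly_eval x p" using assms unfolding polyfun_def by blast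
  let ?\<pi> = "\<Sum>m\<in>Poly_Mapping.keys p. [:Poly_Mapping.lookup p m:] *
      (\<Prod>i\<in>Poly_Mapping.keys m. [:x i, y i:] ^ Poly_Mapping.lookup m i)"
  have "f (\<lambda>i. x i + s * y i) = poly ?\<pi> s" for s
    unfolding p mpoly_eval_def by (simp add: poly_sum poly_prod)
  then show ?thesis by (rule that)
qed

text \<open>Join a point good for \<open>F\<close> to a point good for g by a line: all members
  restrict to nonzero polynomials in one variable, and these have only finitely many roots
  together.\<close>

lemma polyfun_common_nonzero:
  assumes "finite F" "\<And>f. f \<in> F \<Longrightarrow> polyfun f" "\<And>f. f \<in> F \<Longrightarrow> \<exists>x. f x \<noteq> 0"
  shows "\<exists>x. \<forall>f\<in>F. f x \<noteq> 0"
  using assms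
proof (induction F rule: finite_induct)
  case (insert g F)
  then obtain x where x: "\<forall>f\<in>F. f x \<noteq> 0" by blast
  obtain y where y: "g y \<noteq> 0" using insert by blast
  let ?l = "\<lambda>s i. x i + s * (y i - x i)"
  have "\<exists>\<pi>. \<forall>s. f (?l s) = poly \<pi> s" if "f \<in> insert g F" for f
    using polyfun_line[OF insert.prems(1)[OF that], of x "\<lambda>i. y i - x i"] by metis
  then obtain \<pi> where \<pi>: "\<And>f s. f \<in> insert g F \<Longrightarrow> f (?l s) = poly (\<pi> f) s" by metis
  have l0: "?l 0 = x" and l1: "?l 1 = y" by auto
  have "\<pi> f \<noteq> 0" if "f \<in> insert g F" for f
  proof
    assume "\<pi> f = 0"
    then have "f x = 0" "f y = 0" using \<pi>[OF that, of 0] \<pi>[OF that, of 1] l0 l1 by simp_all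
    then show False using x y that by auto
  qed
  then have "finite (\<Union>f\<in>insert g F. {s. poly (\<pi> f) s = 0})"
    using insert.hyps(1) by (intro finite_UN_I poly_roots_finite) auto
  then obtain s where "s \<notin> (\<Union>f\<in>insert g F. {s. poly (\<pi> f) s = 0})"
    using ex_new_if_finite[OF infinite_UNIV_char_0] by blast
  then show ?case using \<pi> by (intro exI[of _ "?l s"]) auto
qed simp

text \<open>
  The rows of this Sylvester matrix are the coefficients of \<open>z\<^sup>i f\<close> for \<open>i < b\<close> and of
  \<open>z\<^sup>i g\<close> for \<open>i < a\<close>, where \<open>a\<close> and \<open>b\<close> are bounds on the degrees of \<open>f\<close> and \<open>g\<close>.
\<close>

definition res_row :: "nat \<Rightarrow> complex poly \<Rightarrow> complex poly \<Rightarrow> nat \<Rightarrow> complex poly" where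
  "res_row b f g i = (if i < b then monom 1 i * f else monom 1 (i - b) * g)"

definition res :: "nat \<Rightarrow> nat \<Rightarrow> complex poly \<Rightarrow> complex poly \<Rightarrow> complex" where
  "res a b f g = Determinant.det (Matrix.mat (a + b) (a + b) (\<lambda>(i, j). coeff (res_row b f g i) j))"

lemma degree_res_row:
  assumes "degree f \<le> a" "degree g \<le> b" "i < a + b"
  shows "degree (res_row b f g i) < a + b"
proof (cases "i < b")
  case True
  have "degree (monom 1 i * f) \<le> i + degree f"
    using degree_mult_le[of "monom 1 i" f] degree_monom_le[of "1::complex" i] by linarith
  then show ?thesis using True assms by (simp add: res_row_def)
next
  case False
  have "degree (monom 1 (i - b) * g) \<le> (i - b) + degree g"
    using degree_mult_le[of "monom 1 (i - b)" g] degree_monom_le[of "1::complex" "i - b"] by linarith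
  then show ?thesis using False assms by (simp add: res_row_def)
qed

lemma poly_eq_sum_coeff:
  fixes f :: "complex poly"
  assumes "degree f < n"
  shows "poly f x = (\<Sum>j<n. coeff f j * x ^ j)"
proof -
  have "(\<Sum>j\<le>degree f. coeff f j * x ^ j) = (\<Sum>j<n. coeff f j * x ^ j)"
    using assms by (intro sum.mono_neutral_left) (auto simp: coeff_eq_0)
  then show ?thesis by (simp add: Polynomial.poly_altdef)
qed

lemma sum_lessThan_add: "(\<Sum>i<a + b. h i) = (\<Sum>i<b. h i) + (\<Sum>i<a. h (i + b))"
  for h :: "nat \<Rightarrow> 'b::comm_monoid_add"
  by (induction a) (simp_all add: ac_simps)

text \<open>The vector of powers of the common root lies in the kernel of the Sylvester
  matrix.\<close>

lemma res_common_root: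
  assumes "degree f \<le> a" "degree g \<le> b" "f \<noteq> 0" "poly f x = 0" "poly g x = 0"
  shows "res a b f g = 0"
proof -
  have "degree f > 0"
  proof (rule ccontr)
    assume "\<not> degree f > 0"
    then obtain k where "f = [:k:]" by (metis degree_eq_zeroE gr0I)
    then show False using assms(3,4) by simp
  qed
  then have n: "a + b > 0" using assms(1) by simp
  let ?M = "Matrix.mat (a + b) (a + b) (\<lambda>(i, j). coeff (res_row b f g i) j)"
  let ?v = "Matrix.vec (a + b) (\<lambda>j. x ^ j)"
  have M: "?M \<in> carrier_mat (a + b) (a + b)" by simp
  have v: "?v \<in> carrier_vec (a + b)" by simp
  have "?v \<noteq> 0\<^sub>v (a + b)"
  proof
    assume "?v = 0\<^sub>v (a + b)"
    then have "vec_index ?v 0 = vec_index (0\<^sub>v (a + b)) 0" by simp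
    then show False using n by simp
  qed
  moreover have "?M *\<^sub>v ?v = 0\<^sub>v (a + b)"
  proof (rule eq_vecI)
    fix i assume "i < dim_vec (0\<^sub>v (a + b))"
    then have i: "i < a + b" by simp
    have "vec_index (?M *\<^sub>v ?v) i = (\<Sum>j<a + b. coeff (res_row b f g i) j * x ^ j)"
      using i by (simp add: scalar_prod_def atLeast0LessThan)
    also have "\<dots> = poly (res_row b f g i) x"
      by (rule poly_eq_sum_coeff[OF degree_res_row[OF assms(1,2) i], symmetric])
    also have "\<dots> = 0" using assms(4,5) by (simp add: res_row_def)
    finally show "vec_index (?M *\<^sub>v ?v) i = vec_index (0\<^sub>v (a + b)) i" using i by simp
  qed simp
  ultimately show ?thesis unfolding res_def using det_0_iff_vec_prod_zero[OF M] v by blast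
qed

lemma dvd_of_no_common_root:
  fixes f g h :: "complex poly"
  assumes "f dvd h * g" "f \<noteq> 0" "h \<noteq> 0" "\<And>x. poly f x = 0 \<Longrightarrow> poly g x \<noteq> 0"
  shows "degree f \<le> degree h"
proof -
  have "proots f \<subseteq># proots h"
  proof (rule mset_subset_eqI)
    fix x
    show "count (proots f) x \<le> count (proots h) x"
    proof (cases "poly f x = 0")
      case True
      then have gx: "poly g x \<noteq> 0" by (rule assms(4))
      then have g0: "g \<noteq> 0" by auto
      have "order x f \<le> order x (h * g)"
        using assms(1,3) g0 by (intro dvd_imp_order_le) auto
      also have "\<dots> = order x h + order x g" using assms(3) g0 by (intro order_mult) auto
      also have "order x g = 0" using gx by (rule order_0I)
      finally show ?thesis using assms(2,3) by simp
    next
      case False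
      then show ?thesis using assms(2) by (simp add: order_0I)
    qed
  qed
  then have "size (proots f) \<le> size (proots h)" by (rule size_mset_mono)
  then show ?thesis by (simp add: size_proots_complex)
qed

text \<open>A vector in the left kernel is a relation \<alpha> f + \<beta> g = 0 with \<beta> of
  degree below a. By coprimality all roots of f are roots of \<beta> with multiplicity, so \<beta> =
  0. Here the degree of f is exactly a, while b is only a bound.\<close>

lemma res_nonzero:
  assumes "degree f = a" "f \<noteq> 0" "degree g \<le> b" "\<And>x. poly f x = 0 \<Longrightarrow> poly g x \<noteq> 0"
  shows "res a b f g \<noteq> 0"
proof
  assume "res a b f g = 0"
  let ?M = "Matrix.mat (a + b) (a + b) (\<lambda>(i, j). coeff (res_row b f g i) j)"
  have M: "transpose_mat ?M \<in> carrier_mat (a + b) (a + b)" by simp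
  have "Determinant.det (transpose_mat ?M) = 0"
    using \<open>res a b f g = 0\<close> Determinant.det_transpose[of ?M "a + b"] by (simp add: res_def)
  then obtain v where v: "v \<in> carrier_vec (a + b)" "v \<noteq> 0\<^sub>v (a + b)" "transpose_mat ?M *\<^sub>v v = 0\<^sub>v (a + b)"
    using det_0_iff_vec_prod_zero[OF M] by blast
  let ?w = "\<lambda>i. vec_index v i"
  have dv: "dim_vec v = a + b" using v(1) by auto
  have coeffs: "(\<Sum>i<a + b. ?w i * coeff (res_row b f g i) j) = 0" if j: "j < a + b" for j
  proof -
    have "vec_index (transpose_mat ?M *\<^sub>v v) j = (\<Sum>i<a + b. coeff (res_row b f g i) j * ?w i)"
      using j dv by (simp add: scalar_prod_def atLeast0LessThan)
    then show ?thesis using v(3) j by (simp add: mult.commute)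
  qed
  have sum0: "(\<Sum>i<a + b. smult (?w i) (res_row b f g i)) = 0"
  proof (rule poly_eqI)
    fix j
    show "coeff (\<Sum>i<a + b. smult (?w i) (res_row b f g i)) j = coeff 0 j"
    proof (cases "j < a + b")
      case True
      then show ?thesis using coeffs by (simp add: coeff_sum)
    next
      case False
      have "coeff (res_row b f g i) j = 0" if "i < a + b" for i
        using degree_res_row[of f a g b i] assms(1,3) that False by (intro coeff_eq_0) simp
      then show ?thesis by (simp add: coeff_sum)
    qed
  qed
  define \<alpha> where "\<alpha> = (\<Sum>i<b. monom (?w i) i)"
  define \<beta> where "\<beta> = (\<Sum>i<a. monom (?w (i + b)) i)"
  have "(\<Sum>i<a + b. smult (?w i) (res_row b f g i)) =
     (\<Sum>i<b. smult (?w i) (res_row b f g i)) + (\<Sum>i<a. smult (?w (i + b)) (res_row b f g (i + b)))"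
    by (rule sum_lessThan_add)
  also have "(\<Sum>i<b. smult (?w i) (res_row b f g i)) = \<alpha> * f"
    unfolding \<alpha>_def sum_distrib_right by (intro sum.cong refl) (simp add: res_row_def smult_monom_mult)
  also have "(\<Sum>i<a. smult (?w (i + b)) (res_row b f g (i + b))) = \<beta> * g"
    unfolding \<beta>_def sum_distrib_right by (intro sum.cong refl) (simp add: res_row_def smult_monom_mult)
  finally have eq: "\<alpha> * f + \<beta> * g = 0" using sum0 by simp
  have "\<beta> = 0"
  proof (rule ccontr)
    assume \<beta>: "\<beta> \<noteq> 0"
    then have "a > 0" unfolding \<beta>_def by (cases a) auto
    have "\<beta> * g = f * (- \<alpha>)" using eq by (simp add: add_eq_0_iff mult.commute)
    then have "f dvd \<beta> * g" by (metis dvd_triv_left)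
    then have "degree f \<le> degree \<beta>" using assms(2,4) \<beta> by (intro dvd_of_no_common_root)
    moreover have "degree \<beta> < a" unfolding \<beta>_def
      using \<open>a > 0\<close> by (intro degree_sum_less) (auto intro: le_less_trans[OF degree_monom_le])
    ultimately show False using assms(1) by simp
  qed
  moreover then have "\<alpha> = 0" using eq assms(2) by simp
  ultimately have z: "coeff \<alpha> i = 0" "coeff \<beta> i = 0" for i by simp_all
  have "?w i = 0" if i: "i < a + b" for i
  proof (cases "i < b")
    case True
    then show ?thesis using z(1)[of i] by (simp add: \<alpha>_def coeff_sum)
  next
    case False
    then have "i - b < a" using i by simp
    then show ?thesis using z(2)[of "i - b"] False by (simp add: \<beta>_def coeff_sum)
  qed
  then have "v = 0\<^sub>v (a + b)" using dv by (intro eq_vecI) auto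
  then show False using v(2) by contradiction
qed

lemma polyfun_res:
  assumes "\<And>j. polyfun (\<lambda>x. coeff (f x) j)" "\<And>j. polyfun (\<lambda>x. coeff (g x) j)"
  shows "polyfun (\<lambda>x. res a b (f x) (g x))"
  unfolding res_def
proof (rule polyfun_det)
  fix i j
  have "polyfun (\<lambda>x. coeff (monom 1 k * h x) j)" if "\<And>j. polyfun (\<lambda>x. coeff (h x) j)" for k and h :: "('a \<Rightarrow> complex) \<Rightarrow> complex poly"
    using that by (cases "j < k") (auto simp: coeff_monom_mult polyfun_const)
  then show "polyfun (\<lambda>x. coeff (res_row b (f x) (g x) i) j)"
    using assms by (cases "i < b") (simp_all add: res_row_def)
qed

text \<open>If the numerator of the derivative is the zero polynomial, then every point is critical,
  but f / h is constant on the connected complement of the zeros of h and has a single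
  value.\<close>

lemma finite_critical_values:
  fixes f h :: "complex poly"
  assumes "h \<noteq> 0"
  shows "finite {poly f z / poly h z |z. poly h z \<noteq> 0 \<and> poly (pderiv f * h - f * pderiv h) z = 0}"
    (is "finite ?V")
proof (cases "pderiv f * h - f * pderiv h = 0")
  case False
  have "?V \<subseteq> (\<lambda>z. poly f z / poly h z) ` {z. poly (pderiv f * h - f * pderiv h) z = 0}" by blast
  then show ?thesis using poly_roots_finite[OF False] by (rule finite_surj[rotated])
next
  case True
  let ?S = "UNIV - {z. poly h z = 0}"
  have fin: "finite {z. poly h z = 0}" using assms by (rule poly_roots_finite)
  have con: "connected ?S"
    using fin by (intro connected_open_delete_finite) auto
  have op: "open ?S" using fin by (intro open_Diff finite_imp_closed) auto
  have der: "((\<lambda>z. poly f z / poly h z) has_field_derivative 0) (at z)" if z: "z \<in> ?S" for z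
  proof -
    have hz: "poly h z \<noteq> 0" using z by simp
    have "((\<lambda>z. poly f z / poly h z) has_field_derivative
       (poly (pderiv f) z * poly h z - poly f z * poly (pderiv h) z) / (poly h z * poly h z)) (at z)"
      by (rule DERIV_divide[OF poly_DERIV poly_DERIV hz])
    moreover have "poly (pderiv f) z * poly h z - poly f z * poly (pderiv h) z = poly (pderiv f * h - f * pderiv h) z" by simp
    ultimately show ?thesis using True by simp
  qed
  have cont: "continuous_on ?S (\<lambda>z. poly f z / poly h z)" by (intro continuous_intros) auto
  obtain k where k: "\<And>z. z \<in> ?S \<Longrightarrow> poly f z / poly h z = k"
    by (rule DERIV_zero_connected_constant[OF con op finite.emptyI cont]) (use der in auto)
  have "?V \<subseteq> {k}"
  proof
    fix w assume "w \<in> ?V"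
    then obtain z where z: "w = poly f z / poly h z" "poly h z \<noteq> 0" by blast
    then show "w \<in> {k}" using k[of z] by simp
  qed
  then show ?thesis by (rule finite_subset) simp
qed

text \<open>\<open>Inl\<close> indexes the entries of u and \<open>Inr\<close> those of v*; the
  numerator of \<open>Q\<close> arises from the entries of the adjugate.\<close>

definition bilin :: "('n::finite \<Rightarrow> 'n \<Rightarrow> complex poly) \<Rightarrow> ('n + 'n \<Rightarrow> complex) \<Rightarrow> complex poly" where
  "bilin c x = (\<Sum>k\<in>UNIV. \<Sum>l\<in>UNIV. smult (x (Inr k) * x (Inl l)) (c k l))"

lemma pderiv_sum_set: "pderiv (\<Sum>i\<in>S. f i) = (\<Sum>i\<in>S. pderiv (f i))"
  by (induction S rule: infinite_finite_induct) (auto simp: pderiv_add)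

lemma polyfun_bilin_coeff: "polyfun (\<lambda>x. coeff (bilin c x) j)"
  unfolding bilin_def coeff_sum coeff_smult
  by (intro polyfun_sum polyfun_mult polyfun_var polyfun_const)

lemma polyfun_bilin_poly: "polyfun (\<lambda>x. poly (bilin c x) a)"
  unfolding bilin_def poly_sum poly_smult
  by (intro polyfun_sum polyfun_mult polyfun_var polyfun_const)

lemma bilin_pderiv:
  "pderiv (bilin c x) * s - bilin c x * t = bilin (\<lambda>k l. pderiv (c k l) * s - c k l * t) x"
  by (simp add: bilin_def pderiv_sum_set pderiv_smult sum_distrib_right sum_subtractf smult_diff_right)

lemma bilin_mult: "g * bilin c x = bilin (\<lambda>k l. g * c k l) x"
  by (simp add: bilin_def sum_distrib_left)

lemma bilin_unit: "bilin c (case_sum (\<lambda>i. if i = l then 1 else 0) (\<lambda>i. if i = k then 1 else 0)) = c k l"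
proof -
  let ?x = "case_sum (\<lambda>i. if i = l then 1 else 0) (\<lambda>i. if i = k then 1 else 0)"
  have "(\<Sum>l'\<in>UNIV. smult (?x (Inr k') * ?x (Inl l')) (c k' l')) = (if k' = k then c k' l else 0)" for k'
  proof -
    have "(\<Sum>l'\<in>UNIV. smult (?x (Inr k') * ?x (Inl l')) (c k' l'))
        = (\<Sum>l'\<in>UNIV. if l' = l then (if k' = k then c k' l' else 0) else 0)"
      by (intro sum.cong refl) simp
    then show ?thesis by simp
  qed
  then show ?thesis unfolding bilin_def by simp
qed

lemma degree_bilin: "degree (bilin c x) \<le> Max (range (\<lambda>(k, l). degree (c k l)))"
  unfolding bilin_def
proof (intro degree_sum_le)
  fix k l
  have "degree (smult (x (Inr k) * x (Inl l)) (c k l)) \<le> degree (c k l)" by (rule degree_smult_le)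
  also have "\<dots> \<le> Max (range (\<lambda>(k, l). degree (c k l)))"
    by (intro Max_ge) (auto intro!: image_eqI[of _ _ "(k, l)"])
  finally show "degree (smult (x (Inr k) * x (Inl l)) (c k l)) \<le> Max (range (\<lambda>(k, l). degree (c k l)))" .
qed auto

text \<open>The assumption holds for an eigenvector \<open>e\<close> and the adjugate: moving the
  \<open>Inl\<close> half along \<open>e\<close> then adds multiples of a single polynomial.\<close>

lemma bilin_line:
  assumes "\<And>k. (\<Sum>l\<in>UNIV. smult (e l) (c k l)) = smult (e k) h"
  shows "bilin c (\<lambda>i. x i + s * case_sum e (\<lambda>_. 0) i) = bilin c x + smult (s * (\<Sum>k\<in>UNIV. x (Inr k) * e k)) h"
proof -
  have "bilin c (\<lambda>i. x i + s * case_sum e (\<lambda>_. 0) i)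
    = (\<Sum>k\<in>UNIV. \<Sum>l\<in>UNIV. smult (x (Inr k) * x (Inl l)) (c k l) + smult (s * x (Inr k)) (smult (e l) (c k l)))"
    unfolding bilin_def by (intro sum.cong refl) (simp add: smult_add_left algebra_simps)
  also have "\<dots> = bilin c x + (\<Sum>k\<in>UNIV. smult (s * x (Inr k)) (\<Sum>l\<in>UNIV. smult (e l) (c k l)))"
    by (simp only: bilin_def sum.distrib smult_sum_right)
  also have "(\<Sum>k\<in>UNIV. smult (s * x (Inr k)) (\<Sum>l\<in>UNIV. smult (e l) (c k l)))
      = (\<Sum>k\<in>UNIV. smult (s * (x (Inr k) * e k)) h)"
    unfolding assms by (simp add: mult.assoc)
  also have "\<dots> = smult (s * (\<Sum>k\<in>UNIV. x (Inr k) * e k)) h"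
    by (simp add: sum_distrib_left smult_sum)
  finally show ?thesis .
qed

lemma poly_eq_off_point:
  fixes f h :: "complex poly"
  assumes "\<And>z. z \<noteq> b \<Longrightarrow> poly f z = poly h z"
  shows "f = h"
proof (rule ccontr)
  assume "f \<noteq> h"
  then have "finite {z. poly (f - h) z = 0}" by (intro poly_roots_finite) simp
  moreover have "UNIV - {b} \<subseteq> {z. poly (f - h) z = 0}" using assms by auto
  ultimately have "finite (UNIV - {b})" by (rule finite_subset[rotated])
  then show False using infinite_UNIV_char_0[where 'a = complex] by simp
qed

lemma adj_poly_eigenvector_poly:
  assumes "A *v y = b *s y"
  shows "[:- b, 1:] * (\<Sum>l\<in>UNIV. smult (y $ l) (adj_poly A k l)) = smult (y $ k) (charpoly A)"
proof (rule poly_eq_off_point)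
  fix z assume "z \<noteq> b"
  then show "poly ([:- b, 1:] * (\<Sum>l\<in>UNIV. smult (y $ l) (adj_poly A k l))) z = poly (smult (y $ k) (charpoly A)) z"
    using adj_poly_eigenvector[OF assms, of z k] by (simp add: poly_sum mult.commute algebra_simps)
qed

lemma order_eq_2:
  fixes F :: "complex poly"
  assumes "F \<noteq> 0" "poly F z = 0" "poly (pderiv F) z = 0" "poly (pderiv (pderiv F)) z \<noteq> 0"
  shows "order z F = 2"
proof -
  have nz: "pderiv F \<noteq> 0" "pderiv (pderiv F) \<noteq> 0" using assms(4) by auto
  have "order z F \<noteq> 0" "order z (pderiv F) \<noteq> 0" using assms nz by (auto simp: order_root)
  then have "order z F = Suc (order z (pderiv F))" "order z (pderiv F) = Suc (order z (pderiv (pderiv F)))"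
    using order_pderiv[of F z] order_pderiv[of "pderiv F" z] nz assms by auto
  moreover have "order z (pderiv (pderiv F)) = 0" using assms(4) by (rule order_0I)
  ultimately show ?thesis by simp
qed

text \<open>At a root b of m the derivative has order one less than m. So w has smaller order at b
  than m, which leaves b as a root of \<open>mh\<close>; maximality of w excludes a common root of
  \<open>mh\<close> and \<open>mt\<close>.\<close>

lemma radical_exists:
  fixes m :: "complex poly"
  assumes "m \<noteq> 0" "degree m > 0"
  obtains w mh mt where "m = w * mh" "pderiv m = w * mt" "\<And>b. poly mh b = 0 \<longleftrightarrow> poly m b = 0"
    "\<And>b. poly m b = 0 \<Longrightarrow> poly mt b \<noteq> 0"
proof -
  have m': "pderiv m \<noteq> 0" using assms by (simp add: pderiv_eq_0_iff)
  obtain w mh where w: "m = w * mh" "\<And>q. q \<in> {pderiv m} \<Longrightarrow> w dvd q"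
    "\<And>a. poly mh a = 0 \<Longrightarrow> \<exists>q\<in>{pderiv m}. \<forall>r. q = w * r \<longrightarrow> poly r a \<noteq> 0"
    using maximal_common_divisor[OF assms(1), of "{pderiv m}"] by blast
  obtain mt where mt: "pderiv m = w * mt" using w(2)[of "pderiv m"] unfolding dvd_def by blast
  have mh: "poly mh b = 0" if "poly m b = 0" for b
  proof -
    have "order b m \<noteq> 0" using that assms(1) by (simp add: order_root)
    then have "order b m = Suc (order b (pderiv m))" using order_pderiv[of m b] assms(1) m' that by simp
    moreover have "order b w \<le> order b (pderiv m)"
      using mt m' by (intro dvd_imp_order_le) auto
    moreover have "order b m = order b w + order b mh"
      unfolding w(1) by (rule order_mult) (use w(1) assms(1) in simp)
    ultimately have "order b mh \<noteq> 0" by linarith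
    then show ?thesis by (metis order_0I)
  qed
  show ?thesis
  proof (rule that[OF w(1) mt])
    show "poly mh b = 0 \<longleftrightarrow> poly m b = 0" for b using mh w(1) by auto
    show "poly mt b \<noteq> 0" if "poly m b = 0" for b using w(3)[OF mh[OF that]] mt by blast
  qed
qed

text \<open>\<open>D\<close> is a product of four kinds of factors: the degree of the critical
  polynomial does not drop, no pole is cancelled, critical points are simple, and critical values
  are nonzero. A simple critical point is a double root of its fibre.\<close>

lemma generic_critical_points:
  fixes A :: "complex^'n^'n"
  obtains D :: "('n + 'n \<Rightarrow> complex) \<Rightarrow> complex" where "polyfun D" "\<exists>x. D x \<noteq> 0"
    "\<And>u v. D (case_sum (\<lambda>i. u $ i) (\<lambda>i. cnj (v $ i))) \<noteq> 0 \<Longrightarrow>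
       \<exists>P R g. perturbation P R A u v g \<and>
         (\<forall>z. poly P z \<noteq> 0 \<longrightarrow> poly (pderiv R * P - R * pderiv P) z = 0 \<longrightarrow>
            poly R z \<noteq> 0 \<and> poly g z \<noteq> 0 \<and> order z (smult (poly R z / poly P z) P - R) = 2)"
proof -
  let ?p = "charpoly A"
  \<comment> \<open>Cancelling what all entries of the adjugate share makes the denominator
    independent of u and v: m is, up to a scalar, the minimal polynomial of A.\<close>
  obtain g m where gm: "?p = g * m" "\<And>q. q \<in> range (\<lambda>(k, l). adj_poly A k l) \<Longrightarrow> g dvd q"
    "\<And>a. poly m a = 0 \<Longrightarrow> \<exists>q\<in>range (\<lambda>(k, l). adj_poly A k l). \<forall>r. q = g * r \<longrightarrow> poly r a \<noteq> 0"
    using maximal_common_divisor[OF charpoly_nonzero, of A "range (\<lambda>(k, l). adj_poly A k l)"] by blast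
  have g0: "g \<noteq> 0" and m0: "m \<noteq> 0" using gm(1) charpoly_nonzero[of A] by auto
  have "g dvd adj_poly A k l" for k l by (rule gm(2)) (auto intro!: image_eqI[of _ _ "(k, l)"])
  then have "\<forall>k l. \<exists>c. adj_poly A k l = g * c" unfolding dvd_def by blast
  then obtain c where c: "\<And>k l. adj_poly A k l = g * c k l" by metis
  have c_root: "\<exists>k l. poly (c k l) b \<noteq> 0" if mb: "poly m b = 0" for b
  proof -
    obtain k l where "\<forall>r. adj_poly A k l = g * r \<longrightarrow> poly r b \<noteq> 0" using gm(3)[OF mb] by auto
    then show ?thesis using c by blast
  qed
  define X where "X = (\<lambda>(u :: complex^'n) (v :: complex^'n). case_sum (\<lambda>i. u $ i) (\<lambda>i. cnj (v $ i)))"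
  have num: "num_poly A u v = g * bilin c (X u v)" for u v
    unfolding num_poly_bilinear bilin_mult c by (simp add: bilin_def X_def)
  have eig: "[:- b, 1:] * (\<Sum>l\<in>UNIV. smult (y $ l) (c k l)) = smult (y $ k) m" if "A *v y = b *s y" for y :: "complex^'n" and b k
  proof -
    have "g * ([:- b, 1:] * (\<Sum>l\<in>UNIV. smult (y $ l) (c k l))) = [:- b, 1:] * (\<Sum>l\<in>UNIV. smult (y $ l) (adj_poly A k l))"
      by (simp only: c mult_smult_right sum_distrib_left mult.left_commute)
    also have "\<dots> = g * smult (y $ k) m" unfolding adj_poly_eigenvector_poly[OF that] gm(1) by simp
    finally show ?thesis using g0 mult_left_cancel by blast
  qed
  have eigvec: "\<exists>(y :: complex^'n) k. A *v y = b *s y \<and> y $ k \<noteq> 0" if b: "poly ?p b = 0" for b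
  proof -
    have "b \<in> spectrum A" using b by (simp add: spectrum_eq_roots)
    then obtain y where "y \<noteq> 0" "A *v y = b *s y" unfolding spectrum_def by blast
    then show ?thesis by (metis vec_eq_iff zero_index)
  qed
  have roots: "poly m b = 0" if b: "poly ?p b = 0" for b
  proof -
    obtain y :: "complex^'n" and k where y: "A *v y = b *s y" "y $ k \<noteq> 0" using eigvec[OF b] by blast
    have "poly (smult (y $ k) m) b = 0" unfolding eig[OF y(1), of k, symmetric] by simp
    then show ?thesis using y(2) by simp
  qed
  have "\<not> constant (poly ?p)" by (simp add: constant_degree degree_charpoly)
  then have "\<exists>a. poly ?p a = 0" by (rule Fundamental_Theorem_Algebra.fundamental_theorem_of_algebra)
  then obtain a where "poly ?p a = 0" ..
  then have ma0: "poly m a = 0" and "\<exists>(y :: complex^'n) k. A *v y = a *s y \<and> y $ k \<noteq> 0" using roots eigvec by blast+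
  then obtain y :: "complex^'n" and k0 where y: "A *v y = a *s y" "y $ k0 \<noteq> 0" by blast
  \<comment> \<open>Division by a nonzero coordinate of the eigenvector makes h the quotient m / (z
    - a).\<close>
  define h where "h = smult (1 / y $ k0) (\<Sum>l\<in>UNIV. smult (y $ l) (c k0 l))"
  have mh_eq: "m = [:- a, 1:] * h"
    using eig[OF y(1), of k0] y(2) unfolding h_def by (simp only: mult_smult_right smult_smult) simp
  have eig': "(\<Sum>l\<in>UNIV. smult (y $ l) (c k l)) = smult (y $ k) h" for k
  proof -
    have "[:- a, 1:] * (\<Sum>l\<in>UNIV. smult (y $ l) (c k l)) = [:- a, 1:] * smult (y $ k) h"
      unfolding eig[OF y(1)] mh_eq by (simp only: mult_smult_right)
    moreover have "[:- a, 1:] \<noteq> 0" by simp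
    ultimately show ?thesis using mult_left_cancel by blast
  qed
  have dm: "degree m > 0"
  proof (rule ccontr)
    assume "\<not> degree m > 0"
    then obtain k where "m = [:k:]" by (metis degree_eq_zeroE gr0I)
    then show False using ma0 m0 by simp
  qed
  have h0: "h \<noteq> 0" using m0 mh_eq by auto
  \<comment> \<open>The factor w divides r' m - r m' for all u and v and has roots only at poles.
    Removing it leaves f, to which the resultants are applied.\<close>
  obtain w mr mt where w: "m = w * mr" "pderiv m = w * mt" "\<And>b. poly mr b = 0 \<longleftrightarrow> poly m b = 0"
    "\<And>b. poly m b = 0 \<Longrightarrow> poly mt b \<noteq> 0"
    using radical_exists[OF m0 dm] by blast
  have w_nz: "poly w z \<noteq> 0" if "poly m z \<noteq> 0" for z using that w(1) by auto
  define r where "r = bilin c"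
  define f where "f = (\<lambda>x. pderiv (r x) * mr - r x * mt)"
  define B where "B = {b. poly m b = 0}"
  have finB: "finite B" unfolding B_def using m0 by (rule poly_roots_finite)
  have f_bilin: "f x = bilin (\<lambda>k l. pderiv (c k l) * mr - c k l * mt) x" for x
    unfolding f_def r_def by (rule bilin_pderiv)
  have f_root: "poly (f x) b = - poly (r x) b * poly mt b" if "b \<in> B" for x b
    using that w(3) by (simp add: f_def B_def)
  have Wf: "pderiv (r x) * m - r x * pderiv m = w * f x" for x
    unfolding f_def w(2) by (subst w(1)) (simp add: algebra_simps)
  have r_nz: "\<exists>x. poly (r x) b \<noteq> 0" if bB: "b \<in> B" for b
  proof -
    have "poly m b = 0" using bB by (simp add: B_def)
    from c_root[OF this] obtain k l where kl: "poly (c k l) b \<noteq> 0" by blast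
    show ?thesis
    proof
      show "poly (r (case_sum (\<lambda>i. if i = l then 1 else 0) (\<lambda>i. if i = k then 1 else 0))) b \<noteq> 0"
        unfolding r_def bilin_unit by (rule kl)
    qed
  qed
  define Kf where "Kf = Max (range (\<lambda>(k, l). degree (pderiv (c k l) * mr - c k l * mt)))"
  define Kr where "Kr = Max (range (\<lambda>(k, l). degree (c k l)))"
  have dr: "degree (r x) \<le> Kr" for x unfolding r_def Kr_def by (rule degree_bilin)
  have dfK: "degree (f x) \<le> Kf" for x unfolding f_bilin Kf_def by (rule degree_bilin)
  have aB: "a \<in> B" using ma0 by (simp add: B_def)
  obtain x' where "poly (r x') a \<noteq> 0" using r_nz[OF aB] by blast
  then have "poly (f x') a \<noteq> 0" using f_root[OF aB] w(4)[OF ma0] by simp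
  then have "f x' \<noteq> 0" by auto
  \<comment> \<open>The largest degree attained by f fixes the size of the Sylvester
    matrices.\<close>
  then obtain xs where xs: "f xs \<noteq> 0" "\<And>x. f x \<noteq> 0 \<Longrightarrow> degree (f x) \<le> degree (f xs)"
    using ex_has_greatest_nat[of "\<lambda>x. f x \<noteq> 0" x' "\<lambda>x. degree (f x)" "Suc Kf"] dfK by (auto simp: less_Suc_eq_le)
  define M where "M = degree (f xs)"
  have dfM: "degree (f x) \<le> M" for x using xs(2)[of x] by (cases "f x = 0") (auto simp: M_def)
  define D where "D = (\<lambda>x. coeff (f x) M * (\<Prod>b\<in>B. poly (r x) b) *
      res M M (f x) (pderiv (f x)) * res M Kr (f x) (r x))"
  have pf_f: "polyfun (\<lambda>x. coeff (f x) j)" for j unfolding f_bilin by (rule polyfun_bilin_coeff)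
  have pf_r: "polyfun (\<lambda>x. coeff (r x) j)" for j unfolding r_def by (rule polyfun_bilin_coeff)
  have pf_rb: "polyfun (\<lambda>x. poly (r x) b)" for b unfolding r_def by (rule polyfun_bilin_poly)
  have pf_D: "polyfun D" unfolding D_def
    by (intro polyfun_mult polyfun_prod polyfun_res pf_f pf_r pf_rb)
      (simp only: coeff_pderiv, intro polyfun_mult polyfun_const pf_f)
  \<comment> \<open>At a root of m, f is a nonzero multiple of r; so f has no root at a pole once r
    is nonzero there.\<close>
  have nopole: "poly m z \<noteq> 0" if "\<And>b. b \<in> B \<Longrightarrow> poly (r x) b \<noteq> 0" "poly (f x) z = 0" for x z
  proof
    assume mz: "poly m z = 0"
    then have "z \<in> B" by (simp add: B_def)
    then show False using f_root[of z x] that w(4)[OF mz] by auto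
  qed
  have D_nz: "\<exists>x. D x \<noteq> 0"
  proof -
    \<comment> \<open>This is v* y: only if it is nonzero does moving u along the eigenvector y
      change r.\<close>
    let ?k = "\<lambda>x :: 'n + 'n \<Rightarrow> complex. \<Sum>k\<in>UNIV. x (Inr k) * y $ k"
    let ?F = "insert (\<lambda>x. coeff (f x) M) (insert ?k ((\<lambda>b x. poly (r x) b) ` B))"
    have "\<exists>x. \<forall>q\<in>?F. q x \<noteq> 0"
    proof (rule polyfun_common_nonzero)
      show "finite ?F" using finB by simp
      show "polyfun q" if "q \<in> ?F" for q
        using that pf_f pf_rb by (auto intro!: polyfun_sum polyfun_mult polyfun_var polyfun_const)
      have "coeff (f xs) M \<noteq> 0" using xs(1) by (simp add: M_def)
      moreover have "?k (case_sum (\<lambda>i. 0) (\<lambda>i. if i = k0 then 1 else 0)) \<noteq> 0"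
      proof -
        have "?k (case_sum (\<lambda>i. 0) (\<lambda>i. if i = k0 then 1 else 0)) = (\<Sum>k\<in>UNIV. if k = k0 then y $ k else 0)"
          by (intro sum.cong refl) simp
        then show ?thesis using y(2) by simp
      qed
      ultimately show "\<exists>x. q x \<noteq> 0" if "q \<in> ?F" for q using that r_nz by blast
    qed
    then obtain x1 where x1: "coeff (f x1) M \<noteq> 0" "?k x1 \<noteq> 0" "\<And>b. b \<in> B \<Longrightarrow> poly (r x1) b \<noteq> 0" by auto
    define xE where "xE = (\<lambda>E i. x1 i + E / ?k x1 * case_sum (\<lambda>l. y $ l) (\<lambda>_. 0) i)"
    have rE: "r (xE E) = r x1 + smult E h" for E
      unfolding r_def xE_def bilin_line[OF eig'] using x1(2) by simp
    define fh where "fh = pderiv h * mr - h * mt"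
    have fE: "f (xE E) = f x1 + smult E fh" for E
      unfolding f_def rE fh_def by (simp add: pderiv_add pderiv_smult algebra_simps smult_diff_right)
    define W where "W = pderiv (r x1) * m - r x1 * pderiv m"
    \<comment> \<open>Differentiate m = (z - a) h; the mixed terms cancel.\<close>
    have hm: "pderiv h * m - h * pderiv m = - (h * h)"
    proof -
      have "pderiv [:- a, 1:] = 1" by (simp add: pderiv_pCons)
      then have "pderiv m = [:- a, 1:] * pderiv h + h * 1" unfolding mh_eq pderiv_mult by (simp only:)
      moreover have "pderiv h * (s * h) - h * (s * pderiv h + h * 1) = - (h * h)" for s
        by (simp add: algebra_simps)
      ultimately show ?thesis using mh_eq by metis
    qed
    have WE: "w * f (xE E) = W - smult E (h * h)" for E
    proof -
      have "w * f (xE E) = (pderiv (r x1) * m - r x1 * pderiv m) + smult E (pderiv h * m - h * pderiv m)"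
        unfolding Wf[symmetric] rE by (simp add: pderiv_add pderiv_smult algebra_simps smult_diff_right)
      then show ?thesis unfolding hm W_def by simp
    qed
    \<comment> \<open>A multiple root of f at the parameter E is a critical point of W / h^2 with
      value E. A common root of f and r is a critical point of r / h, with r taken at
      \<open>x1\<close>, and has value -E there.\<close>
    define V1 where "V1 = {poly W z / poly (h * h) z |z. poly (h * h) z \<noteq> 0 \<and> poly (pderiv W * (h * h) - W * pderiv (h * h)) z = 0}"
    define V2 where "V2 = {poly (r x1) z / poly h z |z. poly h z \<noteq> 0 \<and> poly (pderiv (r x1) * h - r x1 * pderiv h) z = 0}"
    have "finite V1" unfolding V1_def using h0 by (intro finite_critical_values) simp
    moreover have "finite V2" unfolding V2_def using h0 by (rule finite_critical_values)
    \<comment> \<open>The first two excluded sets keep r nonzero at the poles and the degree of f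
      equal to M.\<close>
    ultimately have "finite ((\<lambda>b. - poly (r x1) b / poly h b) ` B \<union> {- coeff (f x1) M / coeff fh M} \<union> V1 \<union> uminus ` V2)"
      using finB by simp
    from ex_new_if_finite[OF infinite_UNIV_char_0 this] obtain E where
      "E \<notin> (\<lambda>b. - poly (r x1) b / poly h b) ` B \<union> {- coeff (f x1) M / coeff fh M} \<union> V1 \<union> uminus ` V2" ..
    then have E: "E \<notin> (\<lambda>b. - poly (r x1) b / poly h b) ` B" "E \<noteq> - coeff (f x1) M / coeff fh M"
      "E \<notin> V1" "E \<notin> uminus ` V2" by (simp_all only: Un_iff insert_iff de_Morgan_disj not_False_eq_True)
    let ?x = "xE E"
    have rB: "poly (r ?x) b \<noteq> 0" if b: "b \<in> B" for b
    proof
      assume "poly (r ?x) b = 0"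
      then have eq: "poly (r x1) b + E * poly h b = 0" by (simp add: rE)
      then have "poly h b \<noteq> 0" using x1(3)[OF b] by auto
      then have "E = - poly (r x1) b / poly h b" using eq by (simp add: field_simps add_eq_0_iff)
      then have "E \<in> (\<lambda>b. - poly (r x1) b / poly h b) ` B" using b by (rule image_eqI)
      then show False using E(1) by contradiction
    qed
    have cM: "coeff (f ?x) M \<noteq> 0"
    proof
      assume "coeff (f ?x) M = 0"
      then have eq: "coeff (f x1) M + E * coeff fh M = 0" by (simp add: fE)
      then have "coeff fh M \<noteq> 0" using x1(1) by auto
      then have "E = - coeff (f x1) M / coeff fh M" using eq by (simp add: field_simps add_eq_0_iff)
      then show False using E(2) by contradiction
    qed
    have fx0: "f ?x \<noteq> 0" using cM by auto
    have dfx: "degree (f ?x) = M" using dfM[of ?x] le_degree[OF cM] by simp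
    have zz: "poly h z \<noteq> 0 \<and> poly W z = E * poly (h * h) z" if fz: "poly (f ?x) z = 0" for z
    proof -
      have mz: "poly m z \<noteq> 0" using nopole[OF rB fz] .
      then have "poly h z \<noteq> 0" unfolding mh_eq by auto
      moreover have "poly (w * f ?x) z = 0" using fz by simp
      then have "poly (W - smult E (h * h)) z = 0" unfolding WE .
      ultimately show ?thesis by simp
    qed
    have n1: "poly (pderiv (f ?x)) z \<noteq> 0" if fz: "poly (f ?x) z = 0" for z
    proof
      assume f'z: "poly (pderiv (f ?x)) z = 0"
      have "poly (pderiv (w * f ?x)) z = 0" using fz f'z by (simp add: pderiv_mult)
      then have "poly (pderiv (W - smult E (h * h))) z = 0" unfolding WE .
      then have W': "poly (pderiv W) z = E * poly (pderiv (h * h)) z" by (simp add: pderiv_diff pderiv_smult)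
      have "poly (pderiv W * (h * h) - W * pderiv (h * h)) z
          = poly (pderiv W) z * poly (h * h) z - poly W z * poly (pderiv (h * h)) z" by simp
      also have "\<dots> = 0" unfolding W' using zz[OF fz] by simp
      finally have cv: "poly (pderiv W * (h * h) - W * pderiv (h * h)) z = 0" .
      have "poly W z / poly (h * h) z \<in> V1"
        unfolding V1_def by (intro CollectI exI[of _ z] conjI refl cv) (use zz[OF fz] in simp)
      moreover have "poly W z / poly (h * h) z = E" using zz[OF fz] by simp
      ultimately show False using E(3) by simp
    qed
    have n2: "poly (r ?x) z \<noteq> 0" if fz: "poly (f ?x) z = 0" for z
    proof
      assume rz: "poly (r ?x) z = 0"
      have mz: "poly m z \<noteq> 0" using nopole[OF rB fz] .
      have hz: "poly h z \<noteq> 0" using zz[OF fz] by simp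
      have "poly (pderiv (r ?x) * m - r ?x * pderiv m) z = 0" unfolding Wf using fz by simp
      then have "poly (pderiv (r ?x)) z = 0" using rz mz by simp
      then have r': "poly (pderiv (r x1)) z = - E * poly (pderiv h) z"
        by (simp add: rE pderiv_add pderiv_smult eq_neg_iff_add_eq_0)
      have r1: "poly (r x1) z = - E * poly h z" using rz by (simp add: rE eq_neg_iff_add_eq_0)
      have "poly (pderiv (r x1) * h - r x1 * pderiv h) z = 0" using r' r1 by simp
      then have "poly (r x1) z / poly h z \<in> V2" unfolding V2_def by (intro CollectI exI[of _ z] conjI refl hz)
      then have "- (poly (r x1) z / poly h z) \<in> uminus ` V2" by (rule imageI)
      moreover have "- (poly (r x1) z / poly h z) = E" using r1 hz by simp
      ultimately show False using E(4) by simp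
    qed
    have "res M M (f ?x) (pderiv (f ?x)) \<noteq> 0"
      using dfx fx0 n1 by (intro res_nonzero) (auto simp: degree_pderiv)
    moreover have "res M Kr (f ?x) (r ?x) \<noteq> 0"
      using dfx fx0 n2 dr by (intro res_nonzero) auto
    ultimately have "D ?x \<noteq> 0" unfolding D_def using cM rB finB by simp
    then show ?thesis by blast
  qed
  show ?thesis
  proof (rule that[OF pf_D D_nz])
    fix u v :: "complex^'n"
    assume "D (case_sum (\<lambda>i. u $ i) (\<lambda>i. cnj (v $ i))) \<noteq> 0"
    then have D: "D (X u v) \<noteq> 0" by (simp add: X_def)
    let ?x = "X u v"
    have cM: "coeff (f ?x) M \<noteq> 0" and rB: "\<And>b. b \<in> B \<Longrightarrow> poly (r ?x) b \<noteq> 0"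
      and res1: "res M M (f ?x) (pderiv (f ?x)) \<noteq> 0" and res2: "res M Kr (f ?x) (r ?x) \<noteq> 0"
      using D finB by (auto simp: D_def)
    have fx0: "f ?x \<noteq> 0" using cM by auto
    have r0: "r ?x \<noteq> 0" using rB[OF aB] by auto
    have "degree g + degree (r ?x) < degree g + degree m"
      using degree_num_poly[of A u v] degree_charpoly[of A] g0 r0 m0
      by (simp add: num gm(1) degree_mult_eq r_def)
    then have per: "perturbation m (r ?x) A u v g"
      unfolding perturbation_def perturbation_axioms_def coprime_fraction_def
      using rB gm(1) num by (auto simp: B_def r_def)
    have "poly (r ?x) z \<noteq> 0 \<and> poly g z \<noteq> 0 \<and> order z (smult (poly (r ?x) z / poly m z) m - r ?x) = 2"
      if mz: "poly m z \<noteq> 0" and Wz: "poly (pderiv (r ?x) * m - r ?x * pderiv m) z = 0" for z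
    proof (intro conjI)
      have fz: "poly (f ?x) z = 0" using Wz w_nz[OF mz] unfolding Wf by simp
      show rz: "poly (r ?x) z \<noteq> 0"
        using res_common_root[OF dfM dr fx0 fz] res2 by blast
      show "poly g z \<noteq> 0" using roots[of z] mz gm(1) by auto
      have f'z: "poly (pderiv (f ?x)) z \<noteq> 0"
      proof -
        have "degree (pderiv (f ?x)) \<le> M" unfolding degree_pderiv using dfM[of ?x] by linarith
        from res_common_root[OF dfM this fx0 fz] show ?thesis using res1 by blast
      qed
      have "poly (pderiv (w * f ?x)) z \<noteq> 0" using fz f'z w_nz[OF mz] by (simp add: pderiv_mult)
      then have W'z: "poly (pderiv (pderiv (r ?x) * m - r ?x * pderiv m)) z \<noteq> 0" unfolding Wf .
      let ?t = "poly (r ?x) z / poly m z"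
      let ?F = "smult ?t m - r ?x"
      show "order z ?F = 2"
      proof (rule order_eq_2)
        show "poly ?F z = 0" using mz by simp
        show "poly (pderiv ?F) z = 0" using Wz mz by (simp add: pderiv_diff pderiv_smult field_simps)
        \<comment> \<open>At z, m F'' = - (r' m - r m')', and this derivative is nonzero because w f
          has a simple zero there.\<close>
        show F'': "poly (pderiv (pderiv ?F)) z \<noteq> 0"
        proof
          assume "poly (pderiv (pderiv ?F)) z = 0"
          then have "poly (pderiv (pderiv (r ?x))) z * poly m z = poly (r ?x) z * poly (pderiv (pderiv m)) z"
            using mz by (simp add: pderiv_diff pderiv_smult field_simps)
          then show False using W'z by (simp add: pderiv_diff pderiv_mult algebra_simps)
        qed
        then show "?F \<noteq> 0" by auto
      qed
    qed
    then show "\<exists>P R g. perturbation P R A u v g \<and>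
         (\<forall>z. poly P z \<noteq> 0 \<longrightarrow> poly (pderiv R * P - R * pderiv P) z = 0 \<longrightarrow>
            poly R z \<noteq> 0 \<and> poly g z \<noteq> 0 \<and> order z (smult (poly R z / poly P z) P - R) = 2)"
      using per by blast
  qed
qed

section \<open>The theorem\<close>

lemma real_imag_polys:
  fixes p :: "complex poly"
  shows "\<exists>U V :: real poly poly. \<forall>z. poly (poly U [:Im z:]) (Re z) = Re (poly p z) \<and>
     poly (poly V [:Im z:]) (Re z) = Im (poly p z)"
proof (induction p)
  case 0
  show ?case by (intro exI[of _ 0]) simp
next
  case (pCons a p)
  then obtain U V :: "real poly poly" where UV: "\<And>z. poly (poly U [:Im z:]) (Re z) = Re (poly p z)"
    "\<And>z. poly (poly V [:Im z:]) (Re z) = Im (poly p z)" by blast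
  \<comment> \<open>The inner variable stands for Re z and the outer one for Im z, as
    \<open>real_zero_set\<close> evaluates them; the recursion is Horner's rule in X + iY.\<close>
  let ?X = "[:[:0, 1:]:] :: real poly poly" and ?Y = "[:0, 1:] :: real poly poly"
  let ?U = "[:[:Re a:]:] + ?X * U - ?Y * V" and ?V = "[:[:Im a:]:] + ?X * V + ?Y * U"
  have "poly (poly ?U [:Im z:]) (Re z) = Re (poly (pCons a p) z)" for z
    by (simp add: UV del: mult_pCons_left mult_pCons_right)
  moreover have "poly (poly ?V [:Im z:]) (Re z) = Im (poly (pCons a p) z)" for z
    by (simp add: UV del: mult_pCons_left mult_pCons_right)
  ultimately show ?case by blast
qed

lemma closed_part_in_components:
  assumes "connected C" "C \<noteq> {}" "closed C" "closed K" "C \<inter> K = {}"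
  shows "C \<in> components (C \<union> K)"
  unfolding in_components_maximal
proof (intro conjI allI impI)
  fix d assume d: "d \<noteq> {} \<and> C \<subseteq> d \<and> d \<subseteq> C \<union> K \<and> connected d"
  have "K \<inter> d = {}"
  proof (rule ccontr)
    assume "K \<inter> d \<noteq> {}"
    moreover have "C \<inter> d \<noteq> {}" "d \<subseteq> C \<union> K" "C \<inter> K \<inter> d = {}" using d assms(2,5) by blast+
    ultimately show False using d assms(3,4) unfolding connected_closed by blast
  qed
  then show "d = C" using d by blast
qed (use assms in auto)

context coprime_fraction
begin

lemma sheets_exist:
  assumes c: "c > 0"
  obtains \<beta> \<rho> \<sigma> where "sheets P R c \<beta> \<rho> \<sigma>"
proof -
  obtain \<beta> where \<beta>: "\<And>z. ratio z = of_real c * cis \<beta> \<Longrightarrow> z \<notin> crit" using regular_angle[OF c] by blast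
  obtain \<rho> \<sigma> where s: "selection c \<beta> (\<beta> + 2 * pi) \<rho>" "monodromy \<beta> \<rho> \<sigma>"
    "\<And>j k s. j < degree P \<Longrightarrow> k < degree P \<Longrightarrow> s \<in> {\<beta>..\<beta> + 2 * pi} \<Longrightarrow> \<rho> j s = \<rho> k s \<Longrightarrow>
       cycle_of \<sigma> j = cycle_of \<sigma> k \<Longrightarrow> j = k"
    using separated_selection[OF c \<beta>] by blast
  have "sheets P R c \<beta> \<rho> \<sigma>"
    by unfold_locales (fact c, fact \<beta>, fact s(1), fact s(2), fact s(3))
  then show ?thesis by (rule that)
qed

lemma closed_level: "closed (level c)"
  unfolding level_def by (intro closed_Collect_eq continuous_intros)

text \<open>Near x only the level set matters, and its chart has exponent 1 exactly off the critical
  points.\<close>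

lemma level_local:
  assumes c: "c > 0" and x: "x \<in> level c" and W0: "open W0" "x \<in> W0" "S \<inter> W0 = level c \<inter> W0"
  shows "locally_interval S x \<longleftrightarrow> x \<notin> crit"
proof -
  have rx: "cmod (ratio x) = c" using x level_iff[OF c] by blast
  then have nz: "ratio x \<noteq> 0" using c by auto
  obtain r U \<phi> \<psi> where ch: "power_chart ratio x (order x (fibre (ratio x))) r U \<phi> \<psi>"
    "U \<subseteq> W0" "U \<subseteq> {z. poly P z \<noteq> 0}"
    using chart_exists[OF nz W0(1,2)] .
  interpret power_chart ratio x "order x (fibre (ratio x))" r U \<phi> \<psi> by (rule ch(1))
  have "S \<inter> U = level c \<inter> U" using W0(3) ch(2) by blast
  also have "\<dots> = {z \<in> U. z \<in> U \<longrightarrow> cmod (ratio z) = cmod (ratio x)}"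
    using ch(3) level_iff[OF c] rx by blast
  finally have S: "S \<inter> U = {z \<in> U. z \<in> U \<longrightarrow> cmod (ratio z) = cmod (ratio x)}" .
  show ?thesis
  proof (cases "x \<in> crit")
    case True
    then have "order x (fibre (ratio x)) \<noteq> 1" using order_fibre_eq_1[OF nz] by blast
    then have "order x (fibre (ratio x)) \<ge> 2" using k_pos by linarith
    then show ?thesis using not_locally_interval_level[OF _ open_U z0_in S] True by blast
  next
    case False
    then have "order x (fibre (ratio x)) = 1" using order_fibre_eq_1[OF nz] by blast
    then show ?thesis using locally_interval_level[OF _ open_U z0_in S] False by blast
  qed
qed

end

section \<open>Assembling the assertions\<close>

context perturbation
begin

text \<open>The equation is |p|^2 - t^2 |q|^2 = 0 in real and imaginary parts. It is nontrivial
  because the spectrum is bounded.\<close>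

lemma algebraic_equation:
  assumes t: "t > 0"
  obtains F where "F \<noteq> 0" "perturbed_spectrum A u v t = real_zero_set F"
proof -
  obtain U V where p: "\<And>z. poly (poly U [:Im z:]) (Re z) = Re (poly p z)"
    "\<And>z. poly (poly V [:Im z:]) (Re z) = Im (poly p z)" using real_imag_polys[of p] by blast
  obtain U' V' where q: "\<And>z. poly (poly U' [:Im z:]) (Re z) = Re (poly q z)"
    "\<And>z. poly (poly V' [:Im z:]) (Re z) = Im (poly q z)" using real_imag_polys[of q] by blast
  let ?F = "U\<^sup>2 + V\<^sup>2 - [:[:t\<^sup>2:]:] * (U'\<^sup>2 + V'\<^sup>2)"
  have F: "poly (poly ?F [:Im z:]) (Re z) = (cmod (poly p z))\<^sup>2 - t\<^sup>2 * (cmod (poly q z))\<^sup>2" for z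
    by (simp add: p q cmod_power2 del: mult_pCons_left)
  have eq: "perturbed_spectrum A u v t = real_zero_set ?F"
  proof -
    have "(cmod (poly p z))\<^sup>2 - t\<^sup>2 * (cmod (poly q z))\<^sup>2 = 0 \<longleftrightarrow> cmod (poly p z) = t * cmod (poly q z)" for z
    proof -
      have "(cmod (poly p z))\<^sup>2 - t\<^sup>2 * (cmod (poly q z))\<^sup>2 = 0 \<longleftrightarrow> (cmod (poly p z))\<^sup>2 = (t * cmod (poly q z))\<^sup>2"
        by (simp add: power_mult_distrib)
      also have "\<dots> \<longleftrightarrow> cmod (poly p z) = t * cmod (poly q z)"
        using t by (intro power2_eq_iff_nonneg) auto
      finally show ?thesis .
    qed
    then show ?thesis unfolding perturbed_spectrum_charpoly[OF t] real_zero_set_def F by simp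
  qed
  obtain B where B: "\<And>s z. 0 < s \<Longrightarrow> s \<le> t \<Longrightarrow> z \<in> perturbed_spectrum A u v s \<Longrightarrow> cmod z \<le> B"
    using spectrum_bounded[of t] by blast
  have "complex_of_real (\<bar>B\<bar> + 1) \<notin> perturbed_spectrum A u v t"
  proof
    assume "complex_of_real (\<bar>B\<bar> + 1) \<in> perturbed_spectrum A u v t"
    then have "cmod (complex_of_real (\<bar>B\<bar> + 1)) \<le> B" using B t by blast
    then show False unfolding norm_of_real by linarith
  qed
  moreover have "real_zero_set 0 = UNIV" by (simp add: real_zero_set_def)
  ultimately have "?F \<noteq> 0" unfolding eq by (metis UNIV_I)
  then show ?thesis using eq by (rule that)
qed

lemma level_crit_iff: "t > 0 \<Longrightarrow> z \<in> crit \<Longrightarrow> z \<in> level (1 / t) \<longleftrightarrow> t = 1 / cmod (Q_fun A u v z)"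
  using Q_crit_at_eq[of t] by (auto simp: Q_crit_at_def Q_crit_eq)

lemma finite_fixed: "finite {z. poly g z = 0}"
  using g_nonzero by (rule poly_roots_finite)

text \<open>Without critical points on the level, different curves are disjoint and all are smooth.
  Each is connected and separated from the closed rest of the algebraic set, hence a
  component.\<close>

lemma regular_level:
  assumes t: "t > 0" and reg: "\<forall>z\<in>Q_crit A u v. t \<noteq> 1 / cmod (Q_fun A u v z)"
  shows "\<exists>F \<C>. F \<noteq> 0 \<and> perturbed_spectrum A u v t = real_zero_set F \<and>
           finite \<C> \<and> disjoint \<C> \<and>
           (\<forall>C\<in>\<C>. smooth_closed_curve C \<and> C \<in> components (real_zero_set F)) \<and>
           perturbed_spectrum A u v t = \<Union>\<C> \<union> fixed_eigenvalues A u v"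
proof -
  obtain F where F: "F \<noteq> 0" "perturbed_spectrum A u v t = real_zero_set F" by (rule algebraic_equation[OF t])
  define c where "c = 1 / t"
  have c: "c > 0" using t by (simp add: c_def)
  obtain \<beta> \<rho> \<sigma> where sh: "sheets P R c \<beta> \<rho> \<sigma>" by (rule sheets_exist[OF c])
  interpret sheets P R c \<beta> \<rho> \<sigma> by (rule sh)
  let ?C = "curve ` {..<degree P}"
  have nc: "curve j \<inter> crit = {}" if "j < degree P" for j
    using curve_subset_level[OF that] level_crit_iff[OF t] reg unfolding Q_crit_eq c_def by blast
  have dis: "curve i \<inter> curve j = {}" if "i < degree P" "j < degree P" "curve i \<noteq> curve j" for i j
  proof (rule ccontr)
    assume "curve i \<inter> curve j \<noteq> {}"
    then obtain z where "z \<in> curve i" "z \<in> curve j" by blast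
    then show False using curve_meet[OF that(1,2), of z] nc[OF that(1)] curve_cong that(3) by blast
  qed
  have union: "perturbed_spectrum A u v t = \<Union>?C \<union> fixed_eigenvalues A u v"
    unfolding perturbed_spectrum_eq[OF t] fixed_eigenvalues_eq using level_eq unfolding c_def by simp
  have comp: "curve j \<in> components (real_zero_set F)" if j: "j < degree P" for j
  proof -
    \<comment> \<open>A root of g may lie on the curve itself; only those off the curve belong to
      the rest.\<close>
    let ?K = "(\<Union>i\<in>{i. i < degree P \<and> curve i \<noteq> curve j}. curve i) \<union> ({z. poly g z = 0} - curve j)"
    have "curve j \<in> components (curve j \<union> ?K)"
    proof (rule closed_part_in_components)
      show "connected (curve j)"
        using homeomorphic_connectedness[OF curve_closed_curve(1)[OF j]] connected_sphere[of "0::complex" 1] by simp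
      show "curve j \<noteq> {}" using regular_point[OF j] by blast
      show "closed (curve j)" using compact_curve[OF j] by (rule compact_imp_closed)
      show "closed ?K"
        using finite_fixed by (intro closed_Un closed_UN finite_imp_closed finite_Diff)
          (auto intro: compact_imp_closed compact_curve)
      show "curve j \<inter> ?K = {}" using dis[OF j] by blast
    qed
    moreover have "curve j \<union> ?K = real_zero_set F"
      unfolding F(2)[symmetric] union fixed_eigenvalues_eq using j by blast
    ultimately show ?thesis by simp
  qed
  have "disjoint ?C" by (rule disjointI) (use dis in blast)
  moreover have "\<forall>C\<in>?C. smooth_closed_curve C \<and> C \<in> components (real_zero_set F)"
    using curve_closed_curve(2) nc comp by blast
  ultimately show ?thesis using F union by (intro exI[of _ F] exI[of _ ?C] conjI) auto
qed

lemma critical_level: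
  assumes t: "t > 0"
  shows "x \<in> perturbed_spectrum A u v t - Q_crit_at A u v t \<Longrightarrow>
           locally_interval (perturbed_spectrum A u v t) x \<or>
           x \<in> fixed_eigenvalues A u v \<and> \<not> x islimpt perturbed_spectrum A u v t"
    and "x \<in> Q_crit_at A u v t \<Longrightarrow> x \<in> perturbed_spectrum A u v t \<and>
           \<not> locally_interval (perturbed_spectrum A u v t) x"
proof -
  define c where "c = 1 / t"
  have c: "c > 0" using t by (simp add: c_def)
  have S: "perturbed_spectrum A u v t = level c \<union> {z. poly g z = 0}"
    unfolding c_def by (rule perturbed_spectrum_eq[OF t])
  \<comment> \<open>Away from the other roots of g, the spectrum coincides with the level set near a
    point x of the latter.\<close>
  let ?W = "- ({z. poly g z = 0} - {x})"
  have W: "open ?W" using finite_fixed by (intro open_Compl finite_imp_closed finite_Diff)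
  have local: "locally_interval (perturbed_spectrum A u v t) x \<longleftrightarrow> x \<notin> crit" if x: "x \<in> level c"
  proof (rule level_local[OF c x W])
    show "perturbed_spectrum A u v t \<inter> ?W = level c \<inter> ?W" unfolding S using x by blast
  qed simp
  show "x \<in> perturbed_spectrum A u v t \<and> \<not> locally_interval (perturbed_spectrum A u v t) x"
    if "x \<in> Q_crit_at A u v t"
    using that local S unfolding Q_crit_at_eq[OF t] c_def by blast
  show "locally_interval (perturbed_spectrum A u v t) x \<or>
           x \<in> fixed_eigenvalues A u v \<and> \<not> x islimpt perturbed_spectrum A u v t"
    if x: "x \<in> perturbed_spectrum A u v t - Q_crit_at A u v t"
  proof (cases "x \<in> level c")
    case True
    then show ?thesis using x local unfolding Q_crit_at_eq[OF t] c_def by blast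
  next
    case False
    then have "x \<in> fixed_eigenvalues A u v" using x unfolding S fixed_eigenvalues_eq by blast
    moreover have "\<not> x islimpt level c" using False closed_level closed_limpt by blast
    then have "\<not> x islimpt perturbed_spectrum A u v t"
      unfolding S islimpt_Un using islimpt_finite[OF finite_fixed] by blast
    ultimately show ?thesis by blast
  qed
qed

lemma spectrum_cover:
  "spectrum A \<union> (\<Union>t\<in>{0<..}. perturbed_spectrum A u v t) \<union> Q_zeros A u v = UNIV"
proof -
  have "z \<in> (\<Union>t\<in>{0<..}. perturbed_spectrum A u v t) \<union> Q_zeros A u v" if "z \<notin> spectrum A" for z
  proof (cases "poly q z = 0")
    case True
    have "poly p z \<noteq> 0" using that by (simp add: spectrum_eq_roots)
    then have "poly R z = 0" using True by (auto simp: charpoly_eq num_poly_eq)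
    then show ?thesis by (simp add: Q_zeros_eq)
  next
    case False
    have pz: "poly p z \<noteq> 0" using that by (simp add: spectrum_eq_roots)
    let ?t = "cmod (poly p z) / cmod (poly q z)"
    have t: "?t > 0" using pz False by simp
    have "z \<in> perturbed_spectrum A u v ?t" unfolding perturbed_spectrum_charpoly[OF t] using False by simp
    then show ?thesis using t by blast
  qed
  then show ?thesis by blast
qed

text \<open>The zeros of the uncancelled numerator are the zeros of \<open>Q\<close> and the roots
  of g; the latter are eigenvalues for every t and so remain in the limit.\<close>

lemma spectrum_limit_zeros:
  assumes "finite (Q_crit A u v)"
  shows "((\<lambda>t. hausdorff_dist (riemann_sphere ` perturbed_spectrum A u v t)
            (insert sphere_infinity
               (riemann_sphere ` (Q_zeros A u v \<union> fixed_eigenvalues A u v)))) \<longlongrightarrow> 0) at_top"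
proof -
  have "Q_zeros A u v \<union> fixed_eigenvalues A u v = {z. poly q z = 0}"
    unfolding Q_zeros_eq fixed_eigenvalues_eq num_poly_eq by auto
  then show ?thesis using spectrum_limit assms unfolding Q_crit_eq by simp
qed

text \<open>Since g does not vanish at critical points, the multiplicity in the full characteristic
  polynomial is the one in the fibre, and \<open>double_point\<close> applies to every critical
  point on the level.\<close>

lemma generic_level:
  assumes dbl: "\<And>z. z \<in> crit \<Longrightarrow> poly R z \<noteq> 0 \<and> poly g z \<noteq> 0 \<and> order z (fibre (ratio z)) = 2"
  shows "z \<in> Q_crit A u v \<Longrightarrow> Q_fun A u v z \<noteq> 0 \<and> order z (charpoly (perturb A u v (1 / Q_fun A u v z))) = 2"
    and "t > 0 \<Longrightarrow> \<exists>\<C>. finite \<C> \<and>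
              perturbed_spectrum A u v t = \<Union>\<C> \<union> fixed_eigenvalues A u v \<and>
              (\<forall>C\<in>\<C>. C homeomorphic sphere (0::complex) 1 \<and>
                 (\<forall>x\<in>C - Q_crit_at A u v t. locally_interval C x)) \<and>
              (\<forall>C\<in>\<C>. \<forall>D\<in>\<C>. C \<noteq> D \<longrightarrow> C \<inter> D \<subseteq> Q_crit_at A u v t) \<and>
              (\<forall>z\<in>Q_crit_at A u v t. \<exists>C D. C \<noteq> D \<and> {B \<in> \<C>. z \<in> B} = {C, D} \<and>
                 \<not> differentiable_curve_at C z \<and> \<not> differentiable_curve_at D z \<and>
                 right_angle_contact C D z)"
proof -
  show "Q_fun A u v z \<noteq> 0 \<and> order z (charpoly (perturb A u v (1 / Q_fun A u v z))) = 2" if "z \<in> Q_crit A u v"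
  proof -
    have z: "z \<in> crit" using that by (simp add: Q_crit_eq)
    have Pz: "poly P z \<noteq> 0" using z by (simp add: crit_def)
    have w: "ratio z \<noteq> 0" using dbl[OF z] Pz by (simp add: ratio_def)
    have "P - Polynomial.smult (1 / ratio z) R = Polynomial.smult (1 / ratio z) (fibre (ratio z))"
      using w by (simp add: fibre_def smult_diff_right)
    then have "order z (charpoly (perturb A u v (1 / ratio z))) = order z (g * Polynomial.smult (1 / ratio z) (fibre (ratio z)))"
      by (simp only: perturb_eq)
    also have "\<dots> = order z g + order z (Polynomial.smult (1 / ratio z) (fibre (ratio z)))"
      using g_nonzero fibre_nonzero[OF w] w by (intro order_mult) simp
    also have "\<dots> = 2" using dbl[OF z] w by (simp add: order_0I order_smult)
    finally show ?thesis using w by (simp add: Q_fun_eq)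
  qed
next
  assume t: "t > 0"
  define c where "c = 1 / t"
  have c: "c > 0" using t by (simp add: c_def)
  obtain \<beta> \<rho> \<sigma> where sh: "sheets P R c \<beta> \<rho> \<sigma>" by (rule sheets_exist[OF c])
  interpret sheets P R c \<beta> \<rho> \<sigma> by (rule sh)
  let ?C = "curve ` {..<degree P}"
  have Qc: "Q_crit_at A u v t = crit \<inter> level c" unfolding c_def by (rule Q_crit_at_eq[OF t])
  have union: "perturbed_spectrum A u v t = \<Union>?C \<union> fixed_eigenvalues A u v"
    unfolding perturbed_spectrum_eq[OF t] fixed_eigenvalues_eq using level_eq unfolding c_def by simp
  have loc: "locally_interval (curve j) x" if j: "j < degree P" and x: "x \<in> curve j - Q_crit_at A u v t" for j x
  proof -
    have xl: "x \<in> level c" using x curve_subset_level[OF j] by blast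
    then have xc: "x \<notin> crit" using x Qc by blast
    have xj: "x \<in> curve j" using x by blast
    obtain W where "open W" "x \<in> W" "curve j \<inter> W = level c \<inter> W"
      by (rule curve_eq_level_near[OF j xj xc])
    then show ?thesis using level_local[OF c xl] xc by blast
  qed
  have meet: "curve i \<inter> curve j \<subseteq> Q_crit_at A u v t" if "i < degree P" "j < degree P" "curve i \<noteq> curve j" for i j
  proof
    fix z assume z: "z \<in> curve i \<inter> curve j"
    then have "z \<in> crit" using curve_meet[OF that(1,2), of z] curve_cong that(3) by blast
    then show "z \<in> Q_crit_at A u v t" using z curve_subset_level[OF that(1)] Qc by blast
  qed
  have dp: "\<forall>z\<in>Q_crit_at A u v t. \<exists>C D. C \<noteq> D \<and> {B \<in> ?C. z \<in> B} = {C, D} \<and>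
      \<not> differentiable_curve_at C z \<and> \<not> differentiable_curve_at D z \<and> right_angle_contact C D z"
  proof
    fix z assume "z \<in> Q_crit_at A u v t"
    then have z: "z \<in> crit" "z \<in> level c" using Qc by auto
    show "\<exists>C D. C \<noteq> D \<and> {B \<in> ?C. z \<in> B} = {C, D} \<and>
      \<not> differentiable_curve_at C z \<and> \<not> differentiable_curve_at D z \<and> right_angle_contact C D z"
      using double_point[OF z] dbl[OF z(1)] by blast
  qed
  show "\<exists>\<C>. finite \<C> \<and>
              perturbed_spectrum A u v t = \<Union>\<C> \<union> fixed_eigenvalues A u v \<and>
              (\<forall>C\<in>\<C>. C homeomorphic sphere (0::complex) 1 \<and>
                 (\<forall>x\<in>C - Q_crit_at A u v t. locally_interval C x)) \<and>
              (\<forall>C\<in>\<C>. \<forall>D\<in>\<C>. C \<noteq> D \<longrightarrow> C \<inter> D \<subseteq> Q_crit_at A u v t) \<and>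
              (\<forall>z\<in>Q_crit_at A u v t. \<exists>C D. C \<noteq> D \<and> {B \<in> \<C>. z \<in> B} = {C, D} \<and>
                 \<not> differentiable_curve_at C z \<and> \<not> differentiable_curve_at D z \<and>
                 right_angle_contact C D z)"
  proof (intro exI[of _ ?C] conjI)
    show "\<forall>C\<in>?C. C homeomorphic sphere (0::complex) 1 \<and> (\<forall>x\<in>C - Q_crit_at A u v t. locally_interval C x)"
      using curve_closed_curve(1) loc by blast
    show "\<forall>C\<in>?C. \<forall>D\<in>?C. C \<noteq> D \<longrightarrow> C \<inter> D \<subseteq> Q_crit_at A u v t" using meet by blast
  qed (use union dp in simp_all)
qed

end

text \<open>A single polynomial representing \<open>D\<close> witnesses genericity; it is nonzero
  because \<open>D\<close> takes a nonzero value.\<close>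

lemma generic_properties:
  fixes A :: "complex^'n^'n"
  shows "generic (\<lambda>u v :: complex^'n.
        (\<forall>z\<in>Q_crit A u v. Q_fun A u v z \<noteq> 0 \<and>
           order z (charpoly (perturb A u v (1 / Q_fun A u v z))) = 2) \<and>
        (\<forall>t>0. (\<exists>z\<in>Q_crit A u v. t = 1 / cmod (Q_fun A u v z)) \<longrightarrow>
           (\<exists>\<C>. finite \<C> \<and>
              perturbed_spectrum A u v t = \<Union>\<C> \<union> fixed_eigenvalues A u v \<and>
              (\<forall>C\<in>\<C>. C homeomorphic sphere (0::complex) 1 \<and>
                 (\<forall>x\<in>C - Q_crit_at A u v t. locally_interval C x)) \<and>
              (\<forall>C\<in>\<C>. \<forall>D\<in>\<C>. C \<noteq> D \<longrightarrow> C \<inter> D \<subseteq> Q_crit_at A u v t) \<and>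
              (\<forall>z\<in>Q_crit_at A u v t. \<exists>C D. C \<noteq> D \<and> {B \<in> \<C>. z \<in> B} = {C, D} \<and>
                 \<not> differentiable_curve_at C z \<and> \<not> differentiable_curve_at D z \<and>
                 right_angle_contact C D z))))"
    (is "generic ?Q")
proof -
  obtain D :: "('n + 'n \<Rightarrow> complex) \<Rightarrow> complex" where D: "polyfun D" "\<exists>x. D x \<noteq> 0"
    "\<And>u v. D (case_sum (\<lambda>i. vec_nth u i) (\<lambda>i. cnj (vec_nth v i))) \<noteq> 0 \<Longrightarrow>
       \<exists>P R g. perturbation P R A u v g \<and>
         (\<forall>z. poly P z \<noteq> 0 \<longrightarrow> poly (pderiv R * P - R * pderiv P) z = 0 \<longrightarrow>
            poly R z \<noteq> 0 \<and> poly g z \<noteq> 0 \<and> order z (Polynomial.smult (poly R z / poly P z) P - R) = 2)"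
    using generic_critical_points[of A] by blast
  obtain p where p: "\<And>x. D x = mpoly_eval x p" using D(1) unfolding polyfun_def by blast
  have "p \<noteq> 0" using D(2) p mpoly_eval_0 by metis
  have Q: "?Q u v" if "D (case_sum (\<lambda>i. vec_nth u i) (\<lambda>i. cnj (vec_nth v i))) \<noteq> 0" for u v
  proof -
    note nz = that
    obtain P R g where per: "perturbation P R A u v g" and
      *: "\<forall>z. poly P z \<noteq> 0 \<longrightarrow> poly (pderiv R * P - R * pderiv P) z = 0 \<longrightarrow>
            poly R z \<noteq> 0 \<and> poly g z \<noteq> 0 \<and> order z (Polynomial.smult (poly R z / poly P z) P - R) = 2"
      using D(3)[OF nz] by blast
    interpret perturbation P R A u v g by (rule per)
    have dbl: "poly R z \<noteq> 0 \<and> poly g z \<noteq> 0 \<and> order z (fibre (ratio z)) = 2" if "z \<in> crit" for z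
    proof -
      have z: "poly P z \<noteq> 0" "poly (pderiv R * P - R * pderiv P) z = 0"
        using that unfolding crit_def by blast+
      show ?thesis unfolding fibre_def ratio_def by (rule *[rule_format, OF z])
    qed
    show ?thesis
      by (intro conjI ballI allI impI; (elim bexE)?)
        (rule generic_level(1)[OF dbl, THEN conjunct1] generic_level(1)[OF dbl, THEN conjunct2]
          generic_level(2)[OF dbl]; assumption)+
  qed
  have "\<forall>u v. \<not> ?Q u v \<longrightarrow> (\<forall>q\<in>{p}. mpoly_eval (case_sum (\<lambda>i. vec_nth u i) (\<lambda>i. cnj (vec_nth v i))) q = 0)"
  proof (intro allI impI ballI)
    fix u v :: "complex^'n" and q
    assume nQ: "\<not> ?Q u v" and "q \<in> {p}"
    then have "q = p" by blast
    moreover have "D (case_sum (\<lambda>i. vec_nth u i) (\<lambda>i. cnj (vec_nth v i))) = 0"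
      using nQ by (rule contrapos_np) (rule Q)
    ultimately show "mpoly_eval (case_sum (\<lambda>i. vec_nth u i) (\<lambda>i. cnj (vec_nth v i))) q = 0"
      by (simp only: p)
  qed
  then show ?thesis unfolding generic_def using \<open>p \<noteq> 0\<close>
    by (intro exI[of _ "{p}"] conjI) (assumption | simp)+
qed

theorem theorem7:
  fixes A :: "complex^'n^'n" and u v :: "complex^'n"
  assumes "u \<noteq> 0" and "v \<noteq> 0"
  shows
    "\<comment> \<open>(i)\<close>
     (\<forall>t>0. (\<forall>z\<in>Q_crit A u v. t \<noteq> 1 / cmod (Q_fun A u v z)) \<longrightarrow>
        (\<exists>F \<C>. F \<noteq> 0 \<and> perturbed_spectrum A u v t = real_zero_set F \<and>
           finite \<C> \<and> disjoint \<C> \<and>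
           (\<forall>C\<in>\<C>. smooth_closed_curve C \<and> C \<in> components (real_zero_set F)) \<and>
           perturbed_spectrum A u v t = \<Union>\<C> \<union> fixed_eigenvalues A u v)) \<and>
     \<comment> \<open>(ii)\<close>
     (\<forall>t>0. (\<exists>z\<in>Q_crit A u v. t = 1 / cmod (Q_fun A u v z)) \<longrightarrow>
        (\<forall>x\<in>perturbed_spectrum A u v t - Q_crit_at A u v t.
           locally_interval (perturbed_spectrum A u v t) x \<or>
           x \<in> fixed_eigenvalues A u v \<and> \<not> x islimpt perturbed_spectrum A u v t) \<and>
        (\<forall>x\<in>Q_crit_at A u v t. x \<in> perturbed_spectrum A u v t \<and>
           \<not> locally_interval (perturbed_spectrum A u v t) x)) \<and>
     \<comment> \<open>(iii)\<close>
     generic (\<lambda>u v :: complex^'n.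
        (\<forall>z\<in>Q_crit A u v. Q_fun A u v z \<noteq> 0 \<and>
           order z (charpoly (perturb A u v (1 / Q_fun A u v z))) = 2) \<and>
        (\<forall>t>0. (\<exists>z\<in>Q_crit A u v. t = 1 / cmod (Q_fun A u v z)) \<longrightarrow>
           (\<exists>\<C>. finite \<C> \<and>
              perturbed_spectrum A u v t = \<Union>\<C> \<union> fixed_eigenvalues A u v \<and>
              (\<forall>C\<in>\<C>. C homeomorphic sphere (0::complex) 1 \<and>
                 (\<forall>x\<in>C - Q_crit_at A u v t. locally_interval C x)) \<and>
              (\<forall>C\<in>\<C>. \<forall>D\<in>\<C>. C \<noteq> D \<longrightarrow> C \<inter> D \<subseteq> Q_crit_at A u v t) \<and>
              (\<forall>z\<in>Q_crit_at A u v t. \<exists>C D. C \<noteq> D \<and> {B \<in> \<C>. z \<in> B} = {C, D} \<and>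
                 \<not> differentiable_curve_at C z \<and> \<not> differentiable_curve_at D z \<and>
                 right_angle_contact C D z)))) \<and>
     \<comment> \<open>(iv)\<close>
     spectrum A \<union> (\<Union>t\<in>{0<..}. perturbed_spectrum A u v t) \<union> Q_zeros A u v = UNIV \<and>
     \<comment> \<open>(v)\<close>
     (\<forall>t>0. ((\<lambda>s. hausdorff_dist (perturbed_spectrum A u v s) (perturbed_spectrum A u v t))
        \<longlongrightarrow> 0) (at t)) \<and>
     \<comment> \<open>(vi)\<close>
     (finite (Q_crit A u v) \<longrightarrow>
        ((\<lambda>t. hausdorff_dist (riemann_sphere ` perturbed_spectrum A u v t)
            (insert sphere_infinity
               (riemann_sphere ` (Q_zeros A u v \<union> fixed_eigenvalues A u v))))
        \<longlongrightarrow> 0) at_top)"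
proof -
  obtain P R g where per: "perturbation P R A u v g" by (rule perturbation_exists)
  interpret perturbation P R A u v g by (rule per)
  show ?thesis
    using regular_level critical_level generic_properties[of A] spectrum_cover spectrum_continuous
      spectrum_limit_zeros
    by (intro conjI allI impI ballI) (assumption | blast)+
qed

end
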